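(* Let $d>6$ and assume that $( * )$ (defined in the context) holds. There exists $C>0$ such that, for every (finite or infinite) $S\subset \mathbb Z^d$ containing $0$, $$\varphi_{p_c}(S)\leq C.$$
   Context: Setting: $\mathcal E$ is a fixed edge set on $\mathbb Z^d$, either nearest-neighbour, $\mathcal E=\{\{x,y\}:\|x-y\|_1=1\}$, or spread-out with parameter $L\ge 1$, $\mathcal E=\{\{x,y\}: x\neq y,\ \|x-y\|_1\le L\}$. Write $x\sim y$ if $\{x,y\}\in\mathcal E$. $\mathbb P_p$ is Bernoulli bond percolation (each edge of $\mathcal E$ open independently with probability $p$), and $p_c:=\inf\{p:\mathbb P_p[0\leftrightarrow\infty]>0\}\in(0,1)$. $\{x\xleftrightarrow{S}y\}$ is the event that there is an open path from $x$ to $y$ with all vertices in $S$; $\tau_{S,p}(x,y):=\mathbb P_p[x\xleftrightarrow{S}y]$; $\tau_p:=\tau_{\mathbb Z^d,p}$. For $S\ni 0$, $$\varphi_p(S):=\sum_{u\in S,\ v\notin S,\ u\sim v}\tau_{S,p}(0,u)\cdot p .$$ Assumption $( * )$: there are constants $0<a\le b<\infty$ with $a(1\vee|x-y|)^{-(d-2)}\le\tau_{p_c}(x,y)\le b(1\vee|x-y|)^{-(d-2)}$ for all $x,y\in\mathbb Z^d$, where $|\cdot|$ is the $\ell^\infty$ norm. *)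

theory Defs
  imports "HOL-Probability.Probability"
begin

text \<open>
  The lattice \<open>\<int>\<^sup>d\<close> is the type \<open>int ^ 'd\<close>, with \<open>d = CARD('d)\<close>.
\<close>

definition l1_norm :: "int ^ 'd \<Rightarrow> int" where
  "l1_norm x = (\<Sum>i\<in>UNIV. \<bar>x $ i\<bar>)"

definition linf_norm :: "int ^ 'd \<Rightarrow> int" where
  "linf_norm x = Max (range (\<lambda>i. \<bar>x $ i\<bar>))"

definition nearest_neighbour_edges :: "(int ^ 'd) set set" where
  "nearest_neighbour_edges = {{x, y} | x y. l1_norm (x - y) = 1}"

definition spread_out_edges :: "nat \<Rightarrow> (int ^ 'd) set set" where
  "spread_out_edges L = {{x, y} | x y. x \<noteq> y \<and> l1_norm (x - y) \<le> int L}"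

text \<open>
  A configuration maps each edge to \<open>True\<close> (open) or \<open>False\<close> (closed). The library's
  \<open>bernoulli_pmf p\<close> truncates \<open>p\<close> to the unit interval, so the law below is only meaningful
  for \<open>0 \<le> p \<le> 1\<close>.
\<close>

definition percolation :: "(int ^ 'd) set set \<Rightarrow> real \<Rightarrow> ((int ^ 'd) set \<Rightarrow> bool) measure" where
  "percolation E p = (\<Pi>\<^sub>M e\<in>E. measure_pmf (bernoulli_pmf p))"

text \<open>
  A path is the nonempty list of its vertices; a single vertex of \<open>S\<close> is a path in \<open>S\<close>,
  so that \<open>x\<close> is connected to itself in \<open>S\<close> iff \<open>x \<in> S\<close>.
\<close>

definition open_path ::
  "(int ^ 'd) set set \<Rightarrow> ((int ^ 'd) set \<Rightarrow> bool) \<Rightarrow> (int ^ 'd) list \<Rightarrow> bool" where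
  "open_path E \<omega> xs \<longleftrightarrow> xs \<noteq> [] \<and> successively (\<lambda>u v. {u, v} \<in> E \<and> \<omega> {u, v}) xs"

definition connected_in ::
  "(int ^ 'd) set set \<Rightarrow> ((int ^ 'd) set \<Rightarrow> bool) \<Rightarrow> (int ^ 'd) set \<Rightarrow> int ^ 'd \<Rightarrow> int ^ 'd \<Rightarrow> bool" where
  "connected_in E \<omega> S x y \<longleftrightarrow>
     (\<exists>xs. open_path E \<omega> xs \<and> hd xs = x \<and> last xs = y \<and> set xs \<subseteq> S)"

definition connected_to_infinity ::
  "(int ^ 'd) set set \<Rightarrow> ((int ^ 'd) set \<Rightarrow> bool) \<Rightarrow> int ^ 'd \<Rightarrow> bool" where
  "connected_to_infinity E \<omega> x \<longleftrightarrow> infinite {y. connected_in E \<omega> UNIV x y}"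

definition tau_in ::
  "(int ^ 'd) set set \<Rightarrow> real \<Rightarrow> (int ^ 'd) set \<Rightarrow> int ^ 'd \<Rightarrow> int ^ 'd \<Rightarrow> real" where
  "tau_in E p S x y =
     measure (percolation E p) {\<omega> \<in> space (percolation E p). connected_in E \<omega> S x y}"

abbreviation tau :: "(int ^ 'd) set set \<Rightarrow> real \<Rightarrow> int ^ 'd \<Rightarrow> int ^ 'd \<Rightarrow> real" where
  "tau E p \<equiv> tau_in E p UNIV"

definition p_crit :: "(int ^ 'd) set set \<Rightarrow> real" where
  "p_crit E = Inf {p \<in> {0..1}.
     measure (percolation E p) {\<omega> \<in> space (percolation E p). connected_to_infinity E \<omega> 0} > 0}"

text \<open>
  For infinite \<open>S\<close> the sum may have infinitely many terms. It is taken in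
  \<open>[0, \<infinity>]\<close>, where every family is summable, so that a bound by a real number
  includes the convergence of the series.
\<close>

definition phi :: "(int ^ 'd) set set \<Rightarrow> real \<Rightarrow> (int ^ 'd) set \<Rightarrow> ennreal" where
  "phi E p S =
     (\<Sum>\<^sub>\<infinity>(u, v)\<in>{(u, v). u \<in> S \<and> v \<notin> S \<and> {u, v} \<in> E}. ennreal (tau_in E p S 0 u * p))"

definition two_point_assumption :: "(int ^ 'd) set set \<Rightarrow> bool" where
  "two_point_assumption E \<longleftrightarrow>
     (\<exists>a b. 0 < a \<and> a \<le> b \<and>
       (\<forall>x y. a * real_of_int (max 1 (linf_norm (x - y))) powr (- (real CARD('d) - 2))
                \<le> tau E (p_crit E) x y \<and>
              tau E (p_crit E) x y
                \<le> b * real_of_int (max 1 (linf_norm (x - y))) powr (- (real CARD('d) - 2))))"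

end

theory Submission
  imports Defs
begin

text \<open>
  For finite \<open>S\<close> let \<open>\<Phi>\<close> be the sum of \<open>\<tau>\<^sub>S(0, u)\<close> over the vertices \<open>u\<close> of \<open>S\<close> with a neighbour
  outside \<open>S\<close>, and for each such \<open>u\<close> with \<open>0 \<leftrightarrow> u\<close> in \<open>S\<close> choose an open path from \<open>0\<close> to \<open>u\<close> in \<open>S\<close>,
  the first one in a fixed enumeration. Take \<open>y\<close> within distance \<open>K\<close> of \<open>u\<close> and \<open>x\<close> far away.
  Conditioning on the cluster of \<open>0\<close> and using the inequality of van den Berg and Kesten, \<open>0 \<leftrightarrow> u\<close>
  in \<open>S\<close> and \<open>y \<leftrightarrow> x\<close> happen in disjoint clusters with probability at least \<open>\<tau>\<^sub>S(0, u) \<tau>(y, x)\<close>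
  minus a sum of open triangles between \<open>y\<close> and the vertices \<open>a\<close> of the path, each of order
  \<open>\<bar>a - y\<bar>\<^sup>4\<^sup>-\<^sup>d\<close>.

  The path visits the box of radius \<open>r\<close> around \<open>u\<close> at most \<open>r\<^sup>5\<^sup>/\<^sup>2\<close> times in mean, because more
  visits produce chains of \<open>k\<close> consecutive connections whose expected number is smaller by any
  power of \<open>r\<close> if \<open>k\<close> is large, while by the inequality of Harris the vertices of \<open>S\<close> within
  distance \<open>r\<close> of its complement carry at most a power of \<open>r\<close> times \<open>\<Phi>\<close>. As \<open>d > 6\<close>, the
  triangles, averaged over \<open>y\<close>, thus amount to at most half of the main term for large \<open>K\<close>.

  When the two clusters are disjoint, changing the configuration in a box around \<open>u\<close> joins them by
  a path that first leaves \<open>S\<close> through a pivotal edge in that box. A configuration has at most one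
  edge of this kind, so summing over \<open>u\<close> bounds \<open>\<Phi> \<tau>(0, x)\<close> by a constant times \<open>\<tau>(0, x)\<close>, both
  summed over \<open>x\<close>.
\<close>

section \<open>Increasing events in finite product spaces\<close>

text \<open>The estimate for \<Phi> closes on itself: the loss is a small multiple of \<Phi> and is
  absorbed, which is legitimate because \<Phi> is finite for finite \<open>S\<close>. All constants
  must therefore be independent of \<open>S\<close>. The obstacle is that no bound from below is
  available for connections restricted to \<open>S\<close>, so the path from 0 to \<open>u\<close>
  can be controlled near \<open>u\<close> only on average over \<open>u\<close>. A triangle based at
  \<open>u\<close> itself has order one; averaging \<open>y\<close> over a box of radius
  \<open>K\<close> replaces the distance from \<open>a\<close> to \<open>u\<close> by its maximum
  with \<open>K\<close>. The exponents then leave room. For d at least 7 the triangles decay at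
  least like the inverse cube of the distance, while the visits grow more slowly than the cube of
  the radius. The mean number of points of a box joined to a given one is of order r squared, so any
  visit exponent strictly between 2 and 3 would serve; 5/2 is the middle. Summing over dyadic radii
  from \<open>K\<close> on gives a loss of order \<open>K\<close> to the power -1/2. Radii are
  written as squares, with \<open>K\<close> the square of \<kappa>, so that all powers stay integral
  and the loss is of order 1/\<kappa>. The total connection probability to an annulus of radius
  \<open>R\<close> has order \<open>R\<close> squared on both sides and cancels.\<close>

definition weight :: "real \<Rightarrow> 'e set \<Rightarrow> 'e set \<Rightarrow> real" where
  "weight p F \<omega> = (\<Prod>e\<in>F. if e \<in> \<omega> then p else 1 - p)"

text \<open>A configuration is the set of its open edges and an expectation is a finite sum, so that
  the inequalities below can be proved by adding one edge at a time.\<close>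

definition bexp :: "real \<Rightarrow> 'e set \<Rightarrow> ('e set \<Rightarrow> real) \<Rightarrow> real" where
  "bexp p F f = (\<Sum>\<omega>\<in>Pow F. weight p F \<omega> * f \<omega>)"

definition bprob :: "real \<Rightarrow> 'e set \<Rightarrow> ('e set \<Rightarrow> bool) \<Rightarrow> real" where
  "bprob p F A = bexp p F (\<lambda>\<omega>. of_bool (A \<omega>))"

definition incr_event :: "('e set \<Rightarrow> bool) \<Rightarrow> bool" where
  "incr_event A \<longleftrightarrow> (\<forall>\<omega> \<omega>'. \<omega> \<subseteq> \<omega>' \<longrightarrow> A \<omega> \<longrightarrow> A \<omega>')"

text \<open>For increasing events this is the usual disjoint occurrence: the witnesses are
  themselves configurations, namely disjoint sets of open edges.\<close>

definition disj_occ :: "('e set \<Rightarrow> bool) \<Rightarrow> ('e set \<Rightarrow> bool) \<Rightarrow> 'e set \<Rightarrow> bool" where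
  "disj_occ A B \<omega> \<longleftrightarrow> (\<exists>\<omega>1 \<omega>2. \<omega>1 \<union> \<omega>2 \<subseteq> \<omega> \<and> \<omega>1 \<inter> \<omega>2 = {} \<and> A \<omega>1 \<and> B \<omega>2)"

lemma incr_eventD: "incr_event A \<Longrightarrow> A \<omega> \<Longrightarrow> \<omega> \<subseteq> \<omega>' \<Longrightarrow> A \<omega>'"
  unfolding incr_event_def by blast

lemma incr_eventI: "(\<And>\<omega> \<omega>'. A \<omega> \<Longrightarrow> \<omega> \<subseteq> \<omega>' \<Longrightarrow> A \<omega>') \<Longrightarrow> incr_event A"
  unfolding incr_event_def by blast

lemma incr_event_disj_occ: "incr_event (disj_occ A B)"
  unfolding incr_event_def disj_occ_def by (meson subset_trans)

lemma incr_event_const [simp]: "incr_event (\<lambda>_. c)"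
  unfolding incr_event_def by simp

lemma bexp_empty [simp]: "bexp p {} f = f {}"
  by (simp add: bexp_def weight_def)

lemma bexp_insert:
  assumes "finite F" "e \<notin> F"
  shows "bexp p (insert e F) f = p * bexp p F (\<lambda>\<omega>. f (insert e \<omega>)) + (1 - p) * bexp p F f"
proof -
  have inj: "inj_on (insert e) (Pow F)"
    using assms(2) by (auto simp: inj_on_def)
  have w1: "weight p (insert e F) (insert e \<omega>) = p * weight p F \<omega>" if "\<omega> \<subseteq> F" for \<omega>
  proof -
    have "(\<Prod>x\<in>F. if x \<in> insert e \<omega> then p else 1 - p) = (\<Prod>x\<in>F. if x \<in> \<omega> then p else 1 - p)"
      using assms by (intro prod.cong) auto
    then show ?thesis
      using assms by (simp add: weight_def)
  qed
  have w0: "weight p (insert e F) \<omega> = (1 - p) * weight p F \<omega>" if "\<omega> \<subseteq> F" for \<omega>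
    using assms that by (auto simp: weight_def)
  have "bexp p (insert e F) f
      = (\<Sum>\<omega>\<in>Pow F. weight p (insert e F) \<omega> * f \<omega>)
        + (\<Sum>\<omega>\<in>insert e ` Pow F. weight p (insert e F) \<omega> * f \<omega>)"
    unfolding bexp_def Pow_insert using assms
    by (intro sum.union_disjoint) auto
  also have "(\<Sum>\<omega>\<in>insert e ` Pow F. weight p (insert e F) \<omega> * f \<omega>)
      = (\<Sum>\<omega>\<in>Pow F. weight p (insert e F) (insert e \<omega>) * f (insert e \<omega>))"
    by (subst sum.reindex[OF inj]) simp
  also have "\<dots> = p * bexp p F (\<lambda>\<omega>. f (insert e \<omega>))"
    unfolding bexp_def sum_distrib_left by (intro sum.cong) (auto simp: w1)
  also have "(\<Sum>\<omega>\<in>Pow F. weight p (insert e F) \<omega> * f \<omega>) = (1 - p) * bexp p F f"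
    unfolding bexp_def sum_distrib_left by (intro sum.cong) (auto simp: w0)
  finally show ?thesis by simp
qed

lemma bexp_cong:
  assumes "\<And>\<omega>. \<omega> \<subseteq> F \<Longrightarrow> f \<omega> = g \<omega>"
  shows "bexp p F f = bexp p F g"
  unfolding bexp_def using assms by (intro sum.cong) auto

lemma bprob_cong:
  assumes "\<And>\<omega>. \<omega> \<subseteq> F \<Longrightarrow> A \<omega> = B \<omega>"
  shows "bprob p F A = bprob p F B"
  unfolding bprob_def using assms by (intro bexp_cong) auto

lemma bexp_add: "bexp p F (\<lambda>\<omega>. f \<omega> + g \<omega>) = bexp p F f + bexp p F g"
  by (simp add: bexp_def distrib_left sum.distrib)

lemma bexp_diff: "bexp p F (\<lambda>\<omega>. f \<omega> - g \<omega>) = bexp p F f - bexp p F g"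
  by (simp add: bexp_def right_diff_distrib sum_subtractf)

lemma bexp_cmult: "bexp p F (\<lambda>\<omega>. c * f \<omega>) = c * bexp p F f"
  by (simp add: bexp_def sum_distrib_left mult.left_commute)

lemma bexp_multc: "bexp p F (\<lambda>\<omega>. f \<omega> * c) = bexp p F f * c"
  by (simp add: bexp_def sum_distrib_right mult.assoc)

lemma bexp_sum: "bexp p F (\<lambda>\<omega>. \<Sum>i\<in>I. f i \<omega>) = (\<Sum>i\<in>I. bexp p F (f i))"
  unfolding bexp_def sum_distrib_left by (rule sum.swap)

lemma bexp_const:
  assumes "finite F"
  shows "bexp p F (\<lambda>_. c) = c"
  using assms by (induction F) (auto simp: bexp_insert algebra_simps)

lemma bprob_True:
  assumes "finite F"
  shows "bprob p F (\<lambda>_. True) = 1"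
  using assms by (simp add: bprob_def bexp_const)

lemma bexp_split:
  assumes "finite F" "finite G" "F \<inter> G = {}"
  shows "bexp p (F \<union> G) f = bexp p F (\<lambda>\<omega>. bexp p G (\<lambda>\<eta>. f (\<omega> \<union> \<eta>)))"
  using assms
proof (induction F arbitrary: f)
  case empty
  then show ?case by simp
next
  case (insert e F)
  have "bexp p (insert e F \<union> G) f
      = p * bexp p (F \<union> G) (\<lambda>\<omega>. f (insert e \<omega>)) + (1 - p) * bexp p (F \<union> G) f"
    using insert by (simp add: bexp_insert)
  also have "\<dots> = p * bexp p F (\<lambda>\<omega>. bexp p G (\<lambda>\<eta>. f (insert e (\<omega> \<union> \<eta>))))
      + (1 - p) * bexp p F (\<lambda>\<omega>. bexp p G (\<lambda>\<eta>. f (\<omega> \<union> \<eta>)))"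
    using insert by simp
  also have "\<dots> = bexp p (insert e F) (\<lambda>\<omega>. bexp p G (\<lambda>\<eta>. f (\<omega> \<union> \<eta>)))"
    using insert by (simp add: bexp_insert)
  finally show ?case .
qed

section \<open>Union bounds and correlation inequalities\<close>

locale bernoulli =
  fixes p :: real
  assumes p_pos: "0 < p" and p_less: "p < 1"
begin

abbreviation EE :: "'e set \<Rightarrow> ('e set \<Rightarrow> real) \<Rightarrow> real" where "EE \<equiv> bexp p"
abbreviation PR :: "'e set \<Rightarrow> ('e set \<Rightarrow> bool) \<Rightarrow> real" where "PR \<equiv> bprob p"

lemma weight_nonneg: "0 \<le> weight p F \<omega>"
  unfolding weight_def using p_pos p_less by (intro prod_nonneg) auto

lemma EE_mono:
  assumes "\<And>\<omega>. \<omega> \<subseteq> F \<Longrightarrow> f \<omega> \<le> g \<omega>"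
  shows "EE F f \<le> EE F g"
  unfolding bexp_def using assms weight_nonneg by (intro sum_mono mult_left_mono) auto

lemma EE_nonneg:
  assumes "\<And>\<omega>. \<omega> \<subseteq> F \<Longrightarrow> 0 \<le> f \<omega>"
  shows "0 \<le> EE F f"
  unfolding bexp_def using assms weight_nonneg by (intro sum_nonneg mult_nonneg_nonneg) auto

lemma PR_mono:
  assumes "\<And>\<omega>. \<omega> \<subseteq> F \<Longrightarrow> A \<omega> \<Longrightarrow> B \<omega>"
  shows "PR F A \<le> PR F B"
  unfolding bprob_def using assms by (intro EE_mono) auto

lemma PR_nonneg: "0 \<le> PR F A"
  unfolding bprob_def by (intro EE_nonneg) auto

lemma PR_le_1:
  assumes "finite F"
  shows "PR F A \<le> 1"
  using PR_mono[of F A "\<lambda>_. True"] bprob_True[OF assms] by auto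

lemma PR_le_sum:
  assumes "finite I" "\<And>\<omega>. \<omega> \<subseteq> F \<Longrightarrow> A \<omega> \<Longrightarrow> \<exists>i\<in>I. B i \<omega>"
  shows "PR F A \<le> (\<Sum>i\<in>I. PR F (B i))"
proof -
  have "of_bool (A \<omega>) \<le> (\<Sum>i\<in>I. of_bool (B i \<omega>) :: real)" if "\<omega> \<subseteq> F" for \<omega>
  proof (cases "A \<omega>")
    case True
    with assms(2)[OF that] obtain i where i: "i \<in> I" "B i \<omega>" by auto
    have "of_bool (B i \<omega>) \<le> (\<Sum>i\<in>I. of_bool (B i \<omega>) :: real)"
      using i assms by (intro member_le_sum) auto
    then show ?thesis using i True by simp
  next
    case False
    have "(0::real) \<le> (\<Sum>i\<in>I. of_bool (B i \<omega>))" by (rule sum_nonneg) simp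
    then show ?thesis using False by simp
  qed
  then show ?thesis
    unfolding bprob_def bexp_sum[symmetric] by (intro EE_mono)
qed

text \<open>Mutual exclusiveness keeps the sum of the indicators at most one. This converse of the
  union bound is used for first paths, for clusters and for pivotal exit edges.\<close>

lemma sum_PR_le:
  assumes "finite I" "\<And>i \<omega>. i \<in> I \<Longrightarrow> \<omega> \<subseteq> F \<Longrightarrow> B i \<omega> \<Longrightarrow> A \<omega>"
    and "\<And>i j \<omega>. i \<in> I \<Longrightarrow> j \<in> I \<Longrightarrow> \<omega> \<subseteq> F \<Longrightarrow> B i \<omega> \<Longrightarrow> B j \<omega> \<Longrightarrow> i = j"
  shows "(\<Sum>i\<in>I. PR F (B i)) \<le> PR F A"
proof -
  have "(\<Sum>i\<in>I. of_bool (B i \<omega>) :: real) \<le> of_bool (A \<omega>)" if \<omega>: "\<omega> \<subseteq> F" for \<omega>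
  proof (cases "\<exists>i\<in>I. B i \<omega>")
    case True
    then obtain i where i: "i \<in> I" "B i \<omega>" by blast
    have "(\<Sum>j\<in>I. of_bool (B j \<omega>) :: real) = (\<Sum>j\<in>I. if j = i then 1 else 0)"
      using i assms(3) \<omega> by (intro sum.cong) auto
    also have "\<dots> = 1" using i assms(1) by simp
    finally show ?thesis using i assms(2) \<omega> by auto
  qed auto
  then show ?thesis
    unfolding bprob_def bexp_sum[symmetric] by (intro EE_mono)
qed

lemma PR_disj:
  "PR F (\<lambda>\<omega>. A \<omega> \<or> B \<omega>) = PR F A + PR F B - PR F (\<lambda>\<omega>. A \<omega> \<and> B \<omega>)"
  unfolding bprob_def bexp_add[symmetric] bexp_diff[symmetric]
  by (intro bexp_cong) auto

lemma PR_not: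
  assumes "finite F"
  shows "PR F (\<lambda>\<omega>. \<not> A \<omega>) = 1 - PR F A"
proof -
  have "PR F (\<lambda>\<omega>. \<not> A \<omega>) = EE F (\<lambda>\<omega>. 1 - of_bool (A \<omega>))"
    unfolding bprob_def by (intro bexp_cong) auto
  then show ?thesis
    using assms by (simp add: bprob_def bexp_diff bexp_const)
qed

lemma PR_insert:
  assumes "finite F" "e \<notin> F"
  shows "PR (insert e F) A = p * PR F (\<lambda>\<omega>. A (insert e \<omega>)) + (1 - p) * PR F A"
  unfolding bprob_def using assms by (rule bexp_insert)

lemma incr_event_insert: "incr_event A \<Longrightarrow> incr_event (\<lambda>\<omega>. A (insert e \<omega>))"
  by (rule incr_eventI) (erule incr_eventD, assumption, blast)

lemma harris:
  assumes "finite F" "incr_event A" "incr_event B"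
  shows "PR F A * PR F B \<le> PR F (\<lambda>\<omega>. A \<omega> \<and> B \<omega>)"
  using assms
proof (induction F arbitrary: A B)
  case empty
  then show ?case by (auto simp: bprob_def)
next
  case (insert e F)
  let ?a1 = "PR F (\<lambda>\<omega>. A (insert e \<omega>))" and ?a0 = "PR F A"
  let ?b1 = "PR F (\<lambda>\<omega>. B (insert e \<omega>))" and ?b0 = "PR F B"
  have a: "?a0 \<le> ?a1" and b: "?b0 \<le> ?b1"
    using insert.prems by (auto intro!: PR_mono elim: incr_eventD)
  \<comment> \<open>This is the exact difference between the mixture of the products and the product
    of the mixtures: the covariance of two increasing functions of the single edge
    \<open>e\<close>.\<close>
  have "0 \<le> p * (1 - p) * ((?a1 - ?a0) * (?b1 - ?b0))"
    using a b p_pos p_less by (intro mult_nonneg_nonneg) auto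
  then have "PR (insert e F) A * PR (insert e F) B \<le> p * (?a1 * ?b1) + (1 - p) * (?a0 * ?b0)"
    unfolding PR_insert[OF insert.hyps] by (simp add: algebra_simps)
  also have "\<dots> \<le> p * PR F (\<lambda>\<omega>. A (insert e \<omega>) \<and> B (insert e \<omega>))
      + (1 - p) * PR F (\<lambda>\<omega>. A \<omega> \<and> B \<omega>)"
    using insert.prems p_pos p_less
    by (intro add_mono mult_left_mono insert.IH incr_event_insert) auto
  also have "\<dots> = PR (insert e F) (\<lambda>\<omega>. A \<omega> \<and> B \<omega>)"
    by (simp add: PR_insert[OF insert.hyps])
  finally show ?case .
qed

text \<open>Harris applied to \<open>A\<close> and the complement of \<open>D\<close>.\<close>

lemma harris_decreasing:
  assumes "finite F" "incr_event A" "incr_event (\<lambda>\<omega>. \<not> D \<omega>)"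
  shows "PR F (\<lambda>\<omega>. D \<omega> \<and> A \<omega>) \<le> PR F D * PR F A"
proof -
  let ?N = "\<lambda>\<omega>. \<not> D \<omega>"
  have "PR F A = PR F (\<lambda>\<omega>. D \<omega> \<and> A \<omega>) + PR F (\<lambda>\<omega>. ?N \<omega> \<and> A \<omega>)"
    unfolding bprob_def bexp_add[symmetric] by (intro bexp_cong) auto
  moreover have "PR F ?N * PR F A \<le> PR F (\<lambda>\<omega>. ?N \<omega> \<and> A \<omega>)"
    using assms by (intro harris)
  ultimately show ?thesis
    using PR_not[OF assms(1), of D] by (simp add: algebra_simps)
qed

text \<open>Probability of a relation between two independent copies of the configuration; for a
  product relation it is the product of the two probabilities.\<close>

definition PR2 :: "'e set \<Rightarrow> ('e set \<Rightarrow> 'e set \<Rightarrow> bool) \<Rightarrow> real" where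
  "PR2 F J = EE F (\<lambda>\<omega>. PR F (J \<omega>))"

lemma PR2_insert:
  assumes "finite F" "e \<notin> F"
  shows "PR2 (insert e F) J =
      p * p * PR2 F (\<lambda>\<omega> \<eta>. J (insert e \<omega>) (insert e \<eta>))
    + p * (1 - p) * PR2 F (\<lambda>\<omega> \<eta>. J (insert e \<omega>) \<eta>)
    + p * (1 - p) * PR2 F (\<lambda>\<omega> \<eta>. J \<omega> (insert e \<eta>))
    + (1 - p) * (1 - p) * PR2 F J"
  unfolding PR2_def PR_insert[OF assms] bexp_insert[OF assms] bexp_add bexp_cmult
  by (simp add: algebra_simps)

lemma PR2_mono:
  assumes "\<And>\<omega> \<eta>. J \<omega> \<eta> \<Longrightarrow> K \<omega> \<eta>"
  shows "PR2 F J \<le> PR2 F K"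
  unfolding PR2_def using assms by (intro EE_mono PR_mono) auto

lemma PR2_disj:
  "PR2 F (\<lambda>\<omega> \<eta>. J \<omega> \<eta> \<or> K \<omega> \<eta>) = PR2 F J + PR2 F K - PR2 F (\<lambda>\<omega> \<eta>. J \<omega> \<eta> \<and> K \<omega> \<eta>)"
  unfolding PR2_def PR_disj bexp_add bexp_diff by simp

text \<open>
  Stating the inequality for arbitrary up-closed relations \<open>J\<close> instead of products of events
  makes the induction work: when \<open>e\<close> is open, the two ways of assigning \<open>e\<close> to a witness
  are again described by a single up-closed relation.
\<close>

lemma van_den_berg_kesten_rel:
  assumes "finite F"
    and "\<And>\<omega> \<omega>' \<eta> \<eta>'. J \<omega> \<eta> \<Longrightarrow> \<omega> \<subseteq> \<omega>' \<Longrightarrow> \<eta> \<subseteq> \<eta>' \<Longrightarrow> J \<omega>' \<eta>'"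
  shows "PR F (\<lambda>\<omega>. \<exists>\<omega>1 \<omega>2. \<omega>1 \<union> \<omega>2 \<subseteq> \<omega> \<and> \<omega>1 \<inter> \<omega>2 = {} \<and> J \<omega>1 \<omega>2) \<le> PR2 F J"
  using assms
proof (induction F arbitrary: J)
  case empty
  then show ?case by (auto simp: bprob_def PR2_def)
next
  case (insert e F)
  define S where "S J \<omega> \<longleftrightarrow> (\<exists>\<omega>1 \<omega>2. \<omega>1 \<union> \<omega>2 \<subseteq> \<omega> \<and> \<omega>1 \<inter> \<omega>2 = {} \<and> J \<omega>1 \<omega>2)"
    for J :: "'a set \<Rightarrow> 'a set \<Rightarrow> bool" and \<omega>
  let ?J10 = "\<lambda>\<omega> \<eta>. J (insert e \<omega>) \<eta>" and ?J01 = "\<lambda>\<omega> \<eta>. J \<omega> (insert e \<eta>)"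
  let ?J11 = "\<lambda>\<omega> \<eta>. J (insert e \<omega>) (insert e \<eta>)"
  let ?U = "\<lambda>\<omega> \<eta>. ?J10 \<omega> \<eta> \<or> ?J01 \<omega> \<eta>" and ?I = "\<lambda>\<omega> \<eta>. ?J10 \<omega> \<eta> \<and> ?J01 \<omega> \<eta>"
  have up: "J \<omega> \<eta> \<Longrightarrow> \<omega> \<subseteq> \<omega>' \<Longrightarrow> \<eta> \<subseteq> \<eta>' \<Longrightarrow> J \<omega>' \<eta>'" for \<omega> \<omega>' \<eta> \<eta>'
    using insert.prems by blast
  have open_case: "S J (insert e \<omega>) \<Longrightarrow> S ?U \<omega>" if "\<omega> \<subseteq> F" for \<omega>
  proof -
    assume "S J (insert e \<omega>)"
    then obtain \<omega>1 \<omega>2 where 1: "\<omega>1 \<union> \<omega>2 \<subseteq> insert e \<omega>" "\<omega>1 \<inter> \<omega>2 = {}" "J \<omega>1 \<omega>2"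
      unfolding S_def by blast
    have "(\<omega>1 - {e}) \<union> (\<omega>2 - {e}) \<subseteq> \<omega>" "(\<omega>1 - {e}) \<inter> (\<omega>2 - {e}) = {}"
      using 1 by auto
    moreover have "?U (\<omega>1 - {e}) (\<omega>2 - {e})"
    proof (cases "e \<in> \<omega>2")
      case True
      then have "\<omega>1 - {e} = \<omega>1" "insert e (\<omega>2 - {e}) = \<omega>2" using 1 by auto
      then show ?thesis using 1 by simp
    next
      case False
      then show ?thesis using up[OF 1(3), of "insert e (\<omega>1 - {e})" "\<omega>2 - {e}"] by auto
    qed
    ultimately show ?thesis unfolding S_def by blast
  qed
  have "PR (insert e F) (S J) = p * PR F (\<lambda>\<omega>. S J (insert e \<omega>)) + (1 - p) * PR F (S J)"
    by (rule PR_insert[OF insert.hyps])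
  also have "\<dots> \<le> p * PR F (S ?U) + (1 - p) * PR F (S J)"
    using open_case p_pos p_less by (intro add_mono mult_left_mono PR_mono) auto
  also have "\<dots> \<le> p * PR2 F ?U + (1 - p) * PR2 F J"
  proof (intro add_mono mult_left_mono)
    show "PR F (S ?U) \<le> PR2 F ?U"
      unfolding S_def
    proof (rule insert.IH)
      fix \<omega> \<omega>' \<eta> \<eta>' assume "?U \<omega> \<eta>" "\<omega> \<subseteq> \<omega>'" "\<eta> \<subseteq> \<eta>'"
      then show "?U \<omega>' \<eta>'"
        using up[of "insert e \<omega>" \<eta> "insert e \<omega>'" \<eta>'] up[of \<omega> "insert e \<eta>" \<omega>' "insert e \<eta>'"]
        by blast
    qed
    show "PR F (S J) \<le> PR2 F J"
      unfolding S_def by (rule insert.IH) (meson up)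
  qed (use p_pos p_less in auto)
  also have "\<dots> \<le> PR2 (insert e F) J"
  proof -
    \<comment> \<open>By inclusion and exclusion the two mixed terms of \<open>PR2_insert\<close>
      add up to the terms of \<open>?U\<close> and \<open>?I\<close>. The right side then exceeds
      the left by \<open>p * p\<close> times the gap from \<open>?U\<close> to \<open>?J11\<close>
      plus \<open>p * (1 - p)\<close> times the gap from \<open>J\<close> to
      \<open>?I\<close>.\<close>
    have "PR2 F J \<le> PR2 F ?I" "PR2 F ?U \<le> PR2 F ?J11"
      by (intro PR2_mono; blast intro: up)+
    then have "p * (1 - p) * PR2 F J \<le> p * (1 - p) * PR2 F ?I"
      "p * p * PR2 F ?U \<le> p * p * PR2 F ?J11"
      using p_pos p_less by (auto intro!: mult_left_mono)
    then show ?thesis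
      unfolding PR2_insert[OF insert.hyps] PR2_disj[of F ?J10 ?J01]
      by (simp add: algebra_simps)
  qed
  finally show ?case unfolding S_def .
qed

lemma van_den_berg_kesten:
  assumes "finite F" "incr_event A" "incr_event B"
  shows "PR F (disj_occ A B) \<le> PR F A * PR F B"
proof -
  have "PR F (disj_occ A B) \<le> PR2 F (\<lambda>\<omega> \<eta>. A \<omega> \<and> B \<eta>)"
    unfolding disj_occ_def
    by (rule van_den_berg_kesten_rel[OF assms(1)]) (meson incr_eventD assms)
  also have "\<dots> = EE F (\<lambda>\<omega>. of_bool (A \<omega>) * PR F B)"
    unfolding PR2_def by (intro bexp_cong) (auto simp: bprob_def bexp_const assms)
  also have "\<dots> = PR F A * PR F B"
    unfolding bexp_multc by (simp add: bprob_def)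
  finally show ?thesis .
qed

section \<open>Conditioning on part of the edges and finite energy\<close>

lemma PR_split:
  assumes "finite F" "G \<subseteq> F"
  shows "PR F A = EE G (\<lambda>\<omega>. PR (F - G) (\<lambda>\<eta>. A (\<omega> \<union> \<eta>)))"
proof -
  have "G \<union> (F - G) = F" using assms by auto
  then show ?thesis
    using assms bexp_split[of G "F - G" p "\<lambda>\<omega>. of_bool (A \<omega>)"] finite_subset[OF assms(2,1)]
    by (simp add: bprob_def)
qed

lemma PR_independent:
  assumes "finite F"
    and "\<And>\<omega>. \<omega> \<subseteq> F \<Longrightarrow> A \<omega> = A (\<omega> \<inter> G)"
    and "\<And>\<omega>. \<omega> \<subseteq> F \<Longrightarrow> B \<omega> = B (\<omega> - G)"
  shows "PR F (\<lambda>\<omega>. A \<omega> \<and> B \<omega>) = PR F A * PR F B"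
proof -
  define H where "H = F \<inter> G"
  have H: "H \<subseteq> F" by (auto simp: H_def)
  have A: "A (\<omega> \<union> \<eta>) = A \<omega>" if "\<omega> \<subseteq> H" "\<eta> \<subseteq> F - H" for \<omega> \<eta>
  proof -
    have "(\<omega> \<union> \<eta>) \<inter> G = \<omega> \<inter> G" "\<omega> \<union> \<eta> \<subseteq> F" "\<omega> \<subseteq> F" using that by (auto simp: H_def)
    then show ?thesis using assms(2) by metis
  qed
  have B: "B (\<omega> \<union> \<eta>) = B \<eta>" if "\<omega> \<subseteq> H" "\<eta> \<subseteq> F - H" for \<omega> \<eta>
  proof -
    have "(\<omega> \<union> \<eta>) - G = \<eta> - G" "\<omega> \<union> \<eta> \<subseteq> F" "\<eta> \<subseteq> F" using that by (auto simp: H_def)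
    then show ?thesis using assms(3) by metis
  qed
  have fin: "finite (F - H)" "finite H" using assms(1) H by (auto intro: finite_subset)
  have PA: "PR F A = PR H A"
  proof (subst PR_split[OF assms(1) H, of A], subst (2) bprob_def, rule bexp_cong)
    fix \<omega> assume \<omega>: "\<omega> \<subseteq> H"
    have "PR (F - H) (\<lambda>\<eta>. A (\<omega> \<union> \<eta>)) = PR (F - H) (\<lambda>\<eta>. A \<omega>)"
      using A[OF \<omega>] by (intro bprob_cong) simp
    then show "PR (F - H) (\<lambda>\<eta>. A (\<omega> \<union> \<eta>)) = of_bool (A \<omega>)"
      using fin by (simp add: bprob_def bexp_const)
  qed
  have PB: "PR F B = PR (F - H) B"
    unfolding PR_split[OF assms(1) H, of B]
  proof -
    have "EE H (\<lambda>\<omega>. PR (F - H) (\<lambda>\<eta>. B (\<omega> \<union> \<eta>))) = EE H (\<lambda>\<omega>. PR (F - H) B)"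
      using B by (intro bexp_cong bprob_cong) auto
    then show "EE H (\<lambda>\<omega>. PR (F - H) (\<lambda>\<eta>. B (\<omega> \<union> \<eta>))) = PR (F - H) B"
      using fin by (simp add: bexp_const)
  qed
  have "PR F (\<lambda>\<omega>. A \<omega> \<and> B \<omega>) = EE H (\<lambda>\<omega>. PR (F - H) (\<lambda>\<eta>. A (\<omega> \<union> \<eta>) \<and> B (\<omega> \<union> \<eta>)))"
    by (rule PR_split[OF assms(1) H])
  also have "\<dots> = EE H (\<lambda>\<omega>. of_bool (A \<omega>) * PR (F - H) B)"
  proof (rule bexp_cong)
    fix \<omega> assume "\<omega> \<subseteq> H"
    then have "PR (F - H) (\<lambda>\<eta>. A (\<omega> \<union> \<eta>) \<and> B (\<omega> \<union> \<eta>)) = PR (F - H) (\<lambda>\<eta>. A \<omega> \<and> B \<eta>)"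
      using A B by (intro bprob_cong) auto
    also have "\<dots> = of_bool (A \<omega>) * PR (F - H) B"
      using fin by (cases "A \<omega>") (auto simp: bprob_def bexp_const)
    finally show "PR (F - H) (\<lambda>\<eta>. A (\<omega> \<union> \<eta>) \<and> B (\<omega> \<union> \<eta>)) = of_bool (A \<omega>) * PR (F - H) B" .
  qed
  also have "\<dots> = PR H A * PR (F - H) B"
    unfolding bexp_multc by (simp add: bprob_def)
  finally show ?thesis using PA PB by simp
qed

lemma PR_supset_conj:
  assumes "finite F" "G \<subseteq> F"
  shows "PR F (\<lambda>\<omega>. G \<subseteq> \<omega> \<and> A \<omega>) = p ^ card G * PR (F - G) (\<lambda>\<eta>. A (G \<union> \<eta>))"
proof -
  have fin: "finite G" using assms finite_subset by auto
  have "EE G (\<lambda>\<omega>. of_bool (G \<subseteq> \<omega>) * f \<omega>) = p ^ card G * f G" if "finite G" for G :: "'a set" and f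
    using that
  proof (induction G arbitrary: f)
    case (insert e G)
    have 1: "EE G (\<lambda>\<omega>. of_bool (insert e G \<subseteq> insert e \<omega>) * f (insert e \<omega>))
        = EE G (\<lambda>\<omega>. of_bool (G \<subseteq> \<omega>) * f (insert e \<omega>))"
      using insert.hyps by (intro bexp_cong) auto
    have 2: "EE G (\<lambda>\<omega>. of_bool (insert e G \<subseteq> \<omega>) * f \<omega>) = EE G (\<lambda>\<omega>. 0)"
      using insert.hyps by (intro bexp_cong) auto
    show ?case
      unfolding bexp_insert[OF insert.hyps] 1 2 insert.IH
      using insert.hyps by (simp add: bexp_const)
  qed simp
  note this[OF fin, of "\<lambda>\<omega>. PR (F - G) (\<lambda>\<eta>. A (\<omega> \<union> \<eta>))"]
  moreover have "PR F (\<lambda>\<omega>. G \<subseteq> \<omega> \<and> A \<omega>)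
      = EE G (\<lambda>\<omega>. of_bool (G \<subseteq> \<omega>) * PR (F - G) (\<lambda>\<eta>. A (\<omega> \<union> \<eta>)))"
    unfolding PR_split[OF assms]
  proof (intro bexp_cong)
    fix \<omega> assume \<omega>: "\<omega> \<subseteq> G"
    have "PR (F - G) (\<lambda>\<eta>. G \<subseteq> \<omega> \<union> \<eta> \<and> A (\<omega> \<union> \<eta>)) = PR (F - G) (\<lambda>\<eta>. G \<subseteq> \<omega> \<and> A (\<omega> \<union> \<eta>))"
      by (intro bprob_cong) auto
    also have "\<dots> = of_bool (G \<subseteq> \<omega>) * PR (F - G) (\<lambda>\<eta>. A (\<omega> \<union> \<eta>))"
      using assms by (cases "G \<subseteq> \<omega>") (auto simp: bprob_def bexp_const)
    finally show "PR (F - G) (\<lambda>\<eta>. G \<subseteq> \<omega> \<union> \<eta> \<and> A (\<omega> \<union> \<eta>))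
      = of_bool (G \<subseteq> \<omega>) * PR (F - G) (\<lambda>\<eta>. A (\<omega> \<union> \<eta>))" .
  qed
  ultimately show ?thesis by simp
qed

text \<open>Once the edges of \<open>G\<close> are known to be open, \<open>D\<close> is decreasing
  and \<open>A\<close> increasing in the remaining edges, so Harris makes them negatively
  correlated. The intended use has \<open>G\<close> a path and \<open>D\<close> the event that no
  earlier path is open.\<close>

lemma PR_supset_decreasing_le:
  assumes "finite F" "G \<subseteq> F" "incr_event A" "incr_event (\<lambda>\<omega>. \<not> D \<omega>)"
  shows "PR F (\<lambda>\<omega>. (G \<subseteq> \<omega> \<and> D \<omega>) \<and> A (\<omega> - G)) \<le> PR F (\<lambda>\<omega>. G \<subseteq> \<omega> \<and> D \<omega>) * PR F A"
proof -
  have fin: "finite (F - G)" using assms by auto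
  have "PR F (\<lambda>\<omega>. (G \<subseteq> \<omega> \<and> D \<omega>) \<and> A (\<omega> - G)) = PR F (\<lambda>\<omega>. G \<subseteq> \<omega> \<and> (D \<omega> \<and> A (\<omega> - G)))"
    by (rule bprob_cong) auto
  also have "\<dots> = p ^ card G * PR (F - G) (\<lambda>\<eta>. D (G \<union> \<eta>) \<and> A ((G \<union> \<eta>) - G))"
    by (rule PR_supset_conj[OF assms(1,2)])
  also have "PR (F - G) (\<lambda>\<eta>. D (G \<union> \<eta>) \<and> A ((G \<union> \<eta>) - G))
      = PR (F - G) (\<lambda>\<eta>. D (G \<union> \<eta>) \<and> A \<eta>)"
  proof (rule bprob_cong)
    fix \<eta> assume "\<eta> \<subseteq> F - G"
    then have "(G \<union> \<eta>) - G = \<eta>" by auto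
    then show "(D (G \<union> \<eta>) \<and> A ((G \<union> \<eta>) - G)) = (D (G \<union> \<eta>) \<and> A \<eta>)" by simp
  qed
  also have "p ^ card G * \<dots> \<le> p ^ card G * (PR (F - G) (\<lambda>\<eta>. D (G \<union> \<eta>)) * PR (F - G) A)"
    using assms p_pos
    by (intro mult_left_mono harris_decreasing fin) (auto simp: incr_event_def, meson Un_mono subset_refl)
  also have "\<dots> = PR F (\<lambda>\<omega>. G \<subseteq> \<omega> \<and> D \<omega>) * PR (F - G) A"
    by (simp add: PR_supset_conj[OF assms(1,2)])
  \<comment> \<open>Letting an increasing event also use the edges of \<open>G\<close> can only
    raise its probability.\<close>
  also have "\<dots> \<le> PR F (\<lambda>\<omega>. G \<subseteq> \<omega> \<and> D \<omega>) * PR F A"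
  proof (intro mult_left_mono PR_nonneg)
    have "PR (F - G) A = EE G (\<lambda>\<omega>. PR (F - G) A)"
      using assms by (simp add: bexp_const finite_subset)
    also have "\<dots> \<le> EE G (\<lambda>\<omega>. PR (F - G) (\<lambda>\<eta>. A (\<omega> \<union> \<eta>)))"
      using assms(3) by (intro EE_mono PR_mono) (auto elim: incr_eventD)
    also have "\<dots> = PR F A"
      by (rule PR_split[OF assms(1,2), symmetric])
    finally show "PR (F - G) A \<le> PR F A" .
  qed
  finally show ?thesis .
qed

definition rho :: real where "rho = min p (1 - p)"

lemma rho_pos: "0 < rho" and rho_le: "rho \<le> 1"
  using p_pos p_less by (auto simp: rho_def)

lemma rho_power_le_weight:
  assumes "finite H"
  shows "rho ^ card H \<le> weight p H \<xi>"
proof -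
  have "rho ^ card H = (\<Prod>e\<in>H. rho)" by simp
  also have "\<dots> \<le> weight p H \<xi>"
    unfolding weight_def using rho_pos by (intro prod_mono) (auto simp: rho_def)
  finally show ?thesis .
qed

text \<open>Finite energy. Freeze the configuration off \<open>H\<close>: if \<open>A\<close> can
  occur at all, some completion on \<open>H\<close> yields \<open>B\<close>, and that single
  completion has weight at least \<open>rho ^ card H\<close>.\<close>

lemma PR_local_modification:
  assumes "finite F" "H \<subseteq> F" "card H \<le> n"
    and "\<And>\<omega>. \<omega> \<subseteq> F \<Longrightarrow> A \<omega> \<Longrightarrow> \<exists>\<omega>'\<subseteq>F. \<omega>' - H = \<omega> - H \<and> B \<omega>'"
  shows "rho ^ n * PR F A \<le> PR F B"
proof -
  have fH: "finite H" "finite (F - H)" using assms finite_subset by auto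
  have F: "F = (F - H) \<union> H" using assms by auto
  have split: "PR F C = EE (F - H) (\<lambda>\<eta>. PR H (\<lambda>\<xi>. C (\<eta> \<union> \<xi>)))" for C
    unfolding bprob_def using bexp_split[of "F - H" H p "\<lambda>\<omega>. of_bool (C \<omega>)"] fH F by auto
  have *: "rho ^ n * PR H (\<lambda>\<xi>. A (\<eta> \<union> \<xi>)) \<le> PR H (\<lambda>\<xi>. B (\<eta> \<union> \<xi>))" if \<eta>: "\<eta> \<subseteq> F - H" for \<eta>
  proof (cases "\<exists>\<xi>\<subseteq>H. A (\<eta> \<union> \<xi>)")
    case False
    then have "PR H (\<lambda>\<xi>. A (\<eta> \<union> \<xi>)) = PR H (\<lambda>_. False)"
      by (intro bprob_cong) auto
    then show ?thesis using fH PR_nonneg by (simp add: bprob_def bexp_const)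
  next
    case True
    then obtain \<xi> where "\<xi> \<subseteq> H" "A (\<eta> \<union> \<xi>)" by blast
    then obtain \<omega>' where \<omega>': "\<omega>' \<subseteq> F" "\<omega>' - H = (\<eta> \<union> \<xi>) - H" "B \<omega>'"
      using assms(2) assms(4)[of "\<eta> \<union> \<xi>"] \<eta> by (meson Diff_subset Un_least subset_trans)
    have eq: "\<eta> \<union> (\<omega>' \<inter> H) = \<omega>'" using \<omega>' \<eta> \<open>\<xi> \<subseteq> H\<close> by auto
    have "rho ^ n * PR H (\<lambda>\<xi>. A (\<eta> \<union> \<xi>)) \<le> rho ^ card H * 1"
      using rho_pos rho_le assms(3) PR_nonneg PR_le_1[OF fH(1)]
      by (intro mult_mono power_decreasing) auto
    also have "\<dots> \<le> weight p H (\<omega>' \<inter> H) * of_bool (B (\<eta> \<union> (\<omega>' \<inter> H)))"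
      using eq \<omega>' rho_power_le_weight[OF fH(1)] by simp
    also have "\<dots> \<le> PR H (\<lambda>\<xi>. B (\<eta> \<union> \<xi>))"
      unfolding bprob_def bexp_def using fH weight_nonneg
      by (intro member_le_sum) auto
    finally show ?thesis .
  qed
  have "rho ^ n * PR F A = EE (F - H) (\<lambda>\<eta>. rho ^ n * PR H (\<lambda>\<xi>. A (\<eta> \<union> \<xi>)))"
    by (simp add: split[of A] bexp_cmult)
  also have "\<dots> \<le> PR F B"
    unfolding split[of B] using * by (intro EE_mono)
  finally show ?thesis .
qed

end

section \<open>Open paths and rerouting\<close>

fun path_edges :: "'v list \<Rightarrow> 'v set set" where
  "path_edges (x # y # zs) = insert {x, y} (path_edges (y # zs))"
| "path_edges _ = {}"

definition path_in :: "'v set set \<Rightarrow> 'v set \<Rightarrow> 'v \<Rightarrow> 'v \<Rightarrow> 'v list \<Rightarrow> bool" where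
  "path_in \<omega> S x y xs \<longleftrightarrow>
     xs \<noteq> [] \<and> hd xs = x \<and> last xs = y \<and> set xs \<subseteq> S \<and> path_edges xs \<subseteq> \<omega>"

definition conn :: "'v set set \<Rightarrow> 'v set \<Rightarrow> 'v \<Rightarrow> 'v \<Rightarrow> bool" where
  "conn \<omega> S x y \<longleftrightarrow> (\<exists>xs. path_in \<omega> S x y xs)"

text \<open>Consecutive points are joined by edge-disjoint connections. The nesting lets the van den
  Berg-Kesten inequality split off one link at a time.\<close>

fun chain :: "'v set \<Rightarrow> 'v list \<Rightarrow> 'v set set \<Rightarrow> bool" where
  "chain S (a # b # cs) = disj_occ (\<lambda>\<omega>. conn \<omega> S a b) (chain S (b # cs))"
| "chain S _ = (\<lambda>_. True)"

section \<open>Edges of a path and elementary properties of connections\<close>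

lemma successively_iff_path_edges:
  "successively (\<lambda>u v. {u, v} \<in> \<omega>) xs \<longleftrightarrow> path_edges xs \<subseteq> \<omega>"
  by (induction xs rule: path_edges.induct) auto

lemma path_edges_append:
  "path_edges (xs @ a # ys) = path_edges (xs @ [a]) \<union> path_edges (a # ys)"
  by (induction xs rule: path_edges.induct) auto

lemma path_edges_append2:
  "xs \<noteq> [] \<Longrightarrow> ys \<noteq> [] \<Longrightarrow>
    path_edges (xs @ ys) = path_edges xs \<union> {{last xs, hd ys}} \<union> path_edges ys"
  by (induction xs rule: path_edges.induct) (auto simp: neq_Nil_conv)

lemma path_edges_rev: "path_edges (rev xs) = path_edges xs"
proof (induction xs rule: path_edges.induct)
  case (1 x y zs)
  have "path_edges (rev (x # y # zs)) = path_edges (rev zs @ y # [x])" by simp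
  also have "\<dots> = path_edges (rev (y # zs)) \<union> {{x, y}}"
    by (subst path_edges_append) (auto simp: insert_commute)
  finally show ?case using 1 by simp
qed auto

lemma path_edges_subset: "e \<in> path_edges xs \<Longrightarrow> e \<subseteq> set xs"
  by (induction xs rule: path_edges.induct) auto

lemma path_edges_meet_tl: "e \<in> path_edges (a # zs) \<Longrightarrow> \<exists>b\<in>set zs. b \<in> e"
  by (induction "a # zs" arbitrary: a zs rule: path_edges.induct) auto

lemma path_edges_distinct: "e \<in> path_edges xs \<Longrightarrow> distinct xs \<Longrightarrow> \<exists>u v. u \<noteq> v \<and> e = {u, v}"
  by (induction xs rule: path_edges.induct) auto

text \<open>The two halves of a simple path share only the vertex \<open>a\<close>, whereas every
  edge of a simple path has two distinct endpoints.\<close>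

lemma path_edges_disjoint:
  assumes "distinct (xs @ a # ys)"
  shows "path_edges (xs @ [a]) \<inter> path_edges (a # ys) = {}"
proof (rule ccontr)
  assume "path_edges (xs @ [a]) \<inter> path_edges (a # ys) \<noteq> {}"
  then obtain e where e: "e \<in> path_edges (xs @ [a])" "e \<in> path_edges (a # ys)" by blast
  then have "e \<subseteq> set (xs @ [a])" "e \<subseteq> set (a # ys)" by (blast dest: path_edges_subset)+
  moreover have "set (xs @ [a]) \<inter> set (a # ys) \<subseteq> {a}" using assms by auto
  ultimately have "e \<subseteq> {a}" by blast
  moreover have "\<exists>u v. u \<noteq> v \<and> e = {u, v}"
    using e(2) assms by (intro path_edges_distinct[of e "a # ys"]) auto
  ultimately show False by auto
qed

lemma path_in_split:
  "path_in \<omega> S x y (xs @ a # ys) \<longleftrightarrow> path_in \<omega> S x a (xs @ [a]) \<and> path_in \<omega> S a y (a # ys)"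
  unfolding path_in_def path_edges_append[of xs a ys] by (cases xs) auto

lemma path_in_join:
  assumes "path_in \<omega> S x a xs" "path_in \<omega> S b y ys" "{a, b} \<in> \<omega>"
  shows "path_in \<omega> S x y (xs @ ys)"
proof -
  have ne: "xs \<noteq> []" "ys \<noteq> []" using assms by (auto simp: path_in_def)
  show ?thesis
    using assms ne unfolding path_in_def path_edges_append2[OF ne] by simp
qed

lemma conn_refl: "x \<in> S \<Longrightarrow> conn \<omega> S x x"
  unfolding conn_def path_in_def by (intro exI[of _ "[x]"]) auto

lemma conn_in: "conn \<omega> S x y \<Longrightarrow> x \<in> S \<and> y \<in> S"
  unfolding conn_def path_in_def by force

lemma conn_mono: "conn \<omega> S x y \<Longrightarrow> \<omega> \<subseteq> \<omega>' \<Longrightarrow> S \<subseteq> S' \<Longrightarrow> conn \<omega>' S' x y"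
  unfolding conn_def path_in_def by (blast intro: subset_trans)

lemma conn_sym: "conn \<omega> S x y \<Longrightarrow> conn \<omega> S y x"
proof -
  assume "conn \<omega> S x y"
  then obtain xs where "path_in \<omega> S x y xs" by (auto simp: conn_def)
  then have "path_in \<omega> S y x (rev xs)"
    by (auto simp: path_in_def path_edges_rev hd_rev last_rev)
  then show ?thesis by (auto simp: conn_def)
qed

lemma conn_trans:
  assumes "conn \<omega> S x y" "conn \<omega> S y z"
  shows "conn \<omega> S x z"
proof -
  obtain xs ys where p: "path_in \<omega> S x y xs" "path_in \<omega> S y z ys"
    using assms by (auto simp: conn_def)
  obtain xs' where xs': "xs = xs' @ [y]"
    using p(1) by (metis append_butlast_last_id path_in_def)
  obtain ys' where ys': "ys = y # ys'"
    using p(2) by (metis list.collapse path_in_def)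
  have "path_in \<omega> S x z (xs' @ y # ys')"
    unfolding path_in_split[of _ _ _ _ xs' y ys'] using p xs' ys' by simp
  then show ?thesis by (auto simp: conn_def)
qed

lemma conn_edge: "{x, y} \<in> \<omega> \<Longrightarrow> x \<in> S \<Longrightarrow> y \<in> S \<Longrightarrow> conn \<omega> S x y"
  unfolding conn_def path_in_def by (intro exI[of _ "[x, y]"]) auto

lemma conn_path: "path_edges xs \<subseteq> \<omega> \<Longrightarrow> set xs \<subseteq> S \<Longrightarrow> xs \<noteq> [] \<Longrightarrow> conn \<omega> S (hd xs) (last xs)"
  unfolding conn_def path_in_def by auto

lemma incr_conn: "incr_event (\<lambda>\<omega>. conn \<omega> S x y)"
  by (rule incr_eventI) (auto intro: conn_mono)

lemma incr_chain: "incr_event (chain S as)"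
  by (cases "(S, as)" rule: chain.cases) (auto simp: incr_event_disj_occ)

lemma conn_induct [consumes 1, case_names base step]:
  assumes "conn \<omega> S x y"
    and "P x"
    and "\<And>u v. conn \<omega> S x u \<Longrightarrow> P u \<Longrightarrow> {u, v} \<in> \<omega> \<Longrightarrow> v \<in> S \<Longrightarrow> P v"
  shows "P y"
proof -
  have "path_in \<omega> S x y xs \<Longrightarrow> P y" for xs
  proof (induction xs arbitrary: y rule: rev_induct)
    case Nil
    then show ?case by (simp add: path_in_def)
  next
    case (snoc z xs)
    show ?case
    proof (cases xs rule: rev_cases)
      case Nil
      then show ?thesis using snoc.prems assms(2) by (auto simp: path_in_def)
    next
      case (snoc ys u)
      have 1: "path_in \<omega> S x u xs" "{u, y} \<in> \<omega>" "y \<in> S"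
        using snoc.prems unfolding snoc path_in_def
        by (auto simp: path_edges_append[of ys u "[z]"] hd_append split: if_splits)
      then show ?thesis
        using snoc.IH assms(3)[of u y] by (auto simp: conn_def)
    qed
  qed
  then show ?thesis using assms(1) by (auto simp: conn_def)
qed

lemma conn_closed:
  assumes "conn \<omega> S x y" "x \<in> Z" "\<And>u v. {u, v} \<in> \<omega> \<Longrightarrow> u \<in> Z \<Longrightarrow> v \<in> S \<Longrightarrow> v \<in> Z"
  shows "y \<in> Z"
  using assms(1,2) by (induction rule: conn_induct) (use assms(3) in blast)+

lemma conn_distinct_path:
  assumes "conn \<omega> S x y"
  shows "\<exists>xs. path_in \<omega> S x y xs \<and> distinct xs"
proof -
  have "x \<in> S" using assms conn_in by metis
  with assms show ?thesis
  proof (induction rule: conn_induct)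
    case base
    then show ?case by (intro exI[of _ "[x]"]) (auto simp: path_in_def)
  next
    case (step u v)
    then obtain xs where xs: "path_in \<omega> S x u xs" "distinct xs" by blast
    show ?case
    proof (cases "v \<in> set xs")
      case True
      then obtain ys zs where "xs = ys @ v # zs" by (meson split_list)
      then have "path_in \<omega> S x v (ys @ [v]) \<and> distinct (ys @ [v])"
        using xs path_in_split[of \<omega> S x u ys v zs] by auto
      then show ?thesis by blast
    next
      case False
      have "path_in \<omega> S v v [v]" using step by (simp add: path_in_def)
      then have "path_in \<omega> S x v (xs @ [v])"
        using xs step path_in_join by metis
      then show ?thesis using False xs by auto
    qed
  qed
qed

section \<open>Locality of connections and cutting of paths\<close>

lemma conn_cong:
  assumes "\<And>e. e \<subseteq> S \<Longrightarrow> e \<in> \<omega> \<longleftrightarrow> e \<in> \<omega>'"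
  shows "conn \<omega> S x y = conn \<omega>' S x y"
proof -
  have "path_in \<omega> S x y xs = path_in \<omega>' S x y xs" for xs
  proof (cases "set xs \<subseteq> S")
    case True
    then have "e \<in> \<omega> \<longleftrightarrow> e \<in> \<omega>'" if "e \<in> path_edges xs" for e
      using path_edges_subset[OF that] by (intro assms) auto
    then show ?thesis unfolding path_in_def by blast
  qed (simp add: path_in_def)
  then show ?thesis by (simp add: conn_def)
qed

text \<open>A simple path from \<open>x\<close> to \<open>y\<close> must meet \<open>A\<close>;
  cutting it there gives two edge-disjoint halves.\<close>

lemma conn_through:
  assumes "conn \<omega> V x y" "\<not> conn \<omega> (V - A) x y"
  shows "\<exists>w\<in>A \<inter> V. disj_occ (\<lambda>\<omega>. conn \<omega> V x w) (\<lambda>\<omega>. conn \<omega> V w y) \<omega>"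
proof -
  obtain xs where xs: "path_in \<omega> V x y xs" "distinct xs"
    using conn_distinct_path[OF assms(1)] by blast
  have "\<not> set xs \<subseteq> V - A"
    using assms(2) xs by (auto simp: conn_def path_in_def)
  then obtain w where w: "w \<in> set xs" "w \<in> A" "w \<in> V" using xs by (auto simp: path_in_def)
  then obtain ys zs where s: "xs = ys @ w # zs" by (meson split_list)
  have "path_in (path_edges (ys @ [w])) V x w (ys @ [w])" "path_in (path_edges (w # zs)) V w y (w # zs)"
    using xs(1) unfolding s path_in_split[of _ _ _ _ ys w zs] by (auto simp: path_in_def)
  moreover have "path_edges (ys @ [w]) \<union> path_edges (w # zs) \<subseteq> \<omega>"
    using xs(1) unfolding s path_in_split[of _ _ _ _ ys w zs] by (auto simp: path_in_def)
  moreover have "path_edges (ys @ [w]) \<inter> path_edges (w # zs) = {}"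
    using xs(2) s path_edges_disjoint by metis
  ultimately show ?thesis
    using w unfolding disj_occ_def conn_def by blast
qed

text \<open>Cutting a simple path at the listed points gives edge-disjoint pieces. The configuration
  is the path itself, so the conclusion passes to every configuration in which the path is
  open.\<close>

lemma subseq_chain:
  assumes "subseq as xs" "as \<noteq> []" "distinct xs" "set xs \<subseteq> S"
  shows "disj_occ (\<lambda>\<omega>. conn \<omega> S (hd xs) (hd as)) (chain S as) (path_edges xs)"
  using assms
proof (induction as arbitrary: xs)
  case Nil
  then show ?case by simp
next
  case (Cons a as)
  obtain ys zs where s: "xs = ys @ a # zs" "subseq as zs"
    using Cons.prems(1) list_emb_ConsD[of "(=)" a as xs] by auto
  have c: "conn (path_edges (ys @ [a])) S (hd xs) a"
    using Cons.prems(4) s conn_path[of "ys @ [a]" _ S] by (auto simp: hd_append)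
  have "chain S (a # as) (path_edges (a # zs))"
  proof (cases as)
    case (Cons b bs)
    have "disj_occ (\<lambda>\<omega>. conn \<omega> S (hd (a # zs)) (hd as)) (chain S as) (path_edges (a # zs))"
      using Cons.prems s Cons by (intro Cons.IH list_emb_Cons) auto
    then show ?thesis using Cons by simp
  qed simp
  moreover have "path_edges xs = path_edges (ys @ [a]) \<union> path_edges (a # zs)"
    "path_edges (ys @ [a]) \<inter> path_edges (a # zs) = {}"
    using path_edges_append path_edges_disjoint s Cons.prems by metis+
  ultimately show ?case
    using c unfolding disj_occ_def
    by (intro exI[of _ "path_edges (ys @ [a])"] exI[of _ "path_edges (a # zs)"]) simp
qed

text \<open>Let \<open>a\<close> be the last vertex on \<open>xs\<close> of a connection from
  \<open>x\<close> to \<open>w\<close>. Every later edge contains a vertex off \<open>xs\<close>,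
  hence is not an edge of \<open>xs\<close>.\<close>

lemma conn_branch:
  assumes "conn \<omega> V x w" "x \<in> set xs"
  shows "\<exists>a\<in>set xs. conn (\<omega> - path_edges xs) V a w"
proof -
  obtain ys where ys: "path_in \<omega> V x w ys" using assms(1) by (auto simp: conn_def)
  then have "\<exists>a\<in>set ys. a \<in> set xs"
    using assms(2) by (metis hd_in_set path_in_def)
  then obtain as a bs where s: "ys = as @ a # bs" "a \<in> set xs" "\<forall>b\<in>set bs. b \<notin> set xs"
    using split_list_last_prop[of ys "\<lambda>a. a \<in> set xs"] by blast
  have "path_edges (a # bs) \<inter> path_edges xs = {}"
    using s(3) path_edges_meet_tl[of _ a bs] path_edges_subset[of _ xs] by blast
  then have "path_in (\<omega> - path_edges xs) V a w (a # bs)"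
    using ys unfolding s path_in_split[of _ _ _ _ as a bs] by (auto simp: path_in_def)
  then show ?thesis using s by (auto simp: conn_def)
qed

text \<open>Follow the connection backwards from \<open>y\<close>: it stays in the cluster of
  \<open>y\<close> in \<omega> without \<open>G\<close> until it first meets an edge of
  \<open>G\<close>.\<close>

lemma conn_last_edge:
  assumes "conn \<omega> V x y" "\<not> conn (\<omega> - G) V x y"
  shows "\<exists>e\<in>G. \<exists>z\<in>e. conn (\<omega> - G) V z y"
proof (rule ccontr)
  assume no: "\<not> ?thesis"
  have "conn (\<omega> - G) V x y"
    using conn_sym[OF assms(1)]
  proof (induction rule: conn_induct)
    case base
    then show ?case using conn_in[OF assms(1)] by (auto intro: conn_refl)
  next
    case (step u v)
    have "{u, v} \<notin> G" using no step by auto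
    then have "{u, v} \<in> \<omega> - G" using step by auto
    then have "conn (\<omega> - G) V v u"
      using conn_in[OF step(1)] step by (auto intro!: conn_edge simp: insert_commute)
    then show ?case using step conn_trans by metis
  qed
  then show False using assms(2) by simp
qed

text \<open>
  All open paths from \<open>o'\<close> to \<open>x\<close> leave \<open>S\<close> for the first time through \<open>{u, v}\<close>, so a
  configuration has at most one such edge.
\<close>

definition exit_pivotal :: "'v set \<Rightarrow> 'v set \<Rightarrow> 'v \<Rightarrow> 'v \<Rightarrow> 'v \<times> 'v \<Rightarrow> 'v set set \<Rightarrow> bool" where
  "exit_pivotal V S o' x = (\<lambda>(u, v) \<omega>. u \<in> S \<and> v \<notin> S \<and> {u, v} \<in> \<omega> \<and> conn \<omega> S o' u \<and>
     conn \<omega> V o' x \<and> \<not> conn (\<omega> - {{u, v}}) V o' x)"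

text \<open>Delete both edges; connections inside \<open>S\<close> survive, since both edges leave
  \<open>S\<close>. Starting backwards from \<open>x\<close>, some endpoint \<open>z\<close> of one
  of the edges still reaches \<open>x\<close>. If \<open>z\<close> is its inner endpoint, that edge
  is not pivotal. If \<open>z\<close> is its outer endpoint, going to the inner one inside
  \<open>S\<close> and crossing avoids the other edge, which is then not pivotal.\<close>

lemma exit_pivotal_unique:
  assumes "exit_pivotal V S o' x (u1, v1) \<omega>" "exit_pivotal V S o' x (u2, v2) \<omega>" "S \<subseteq> V"
  shows "(u1, v1) = (u2, v2)"
proof (rule ccontr)
  assume ne: "(u1, v1) \<noteq> (u2, v2)"
  let ?e1 = "{u1, v1}" and ?e2 = "{u2, v2}"
  have ne': "?e1 \<noteq> ?e2"
    using assms ne unfolding exit_pivotal_def by (auto simp: doubleton_eq_iff)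
  define \<omega>' where "\<omega>' = \<omega> - {?e1, ?e2}"
  have inside: "conn \<omega>' S o' u" if "conn \<omega> S o' u" for u
  proof -
    have "conn \<omega> S o' u = conn \<omega>' S o' u"
      using assms unfolding exit_pivotal_def \<omega>'_def by (intro conn_cong) auto
    then show ?thesis using that by simp
  qed
  have key: False
    if A: "exit_pivotal V S o' x (u, v) \<omega>" "exit_pivotal V S o' x (u', v') \<omega>"
      "{u, v} \<noteq> {u', v'}" "{?e1, ?e2} = {{u, v}, {u', v'}}" "conn \<omega>' V z x" "z \<in> {u, v}" for u v u' v' z
  proof -
    have u: "conn \<omega>' V o' u"
      using A(1) inside assms(3) by (auto simp: exit_pivotal_def intro: conn_mono)
    have sub: "\<omega>' \<subseteq> \<omega> - {{u, v}}" "\<omega>' \<subseteq> \<omega> - {{u', v'}}"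
      using A(4) by (auto simp: \<omega>'_def)
    show False
    proof (cases "z = u")
      case True
      then have "conn \<omega>' V o' x" using A u conn_trans by metis
      then have "conn (\<omega> - {{u, v}}) V o' x" using conn_mono[OF _ sub(1) subset_refl] by simp
      then show False using A(1) by (simp add: exit_pivotal_def)
    next
      case False
      then have z: "z = v" using A by auto
      have "{u, v} \<in> \<omega> - {{u', v'}}" using A by (auto simp: exit_pivotal_def)
      then have "conn (\<omega> - {{u', v'}}) V u v"
        using conn_in[OF u] conn_in[OF A(5)] z by (simp add: conn_edge)
      moreover have "conn (\<omega> - {{u', v'}}) V o' u" "conn (\<omega> - {{u', v'}}) V v x"
        using u A(5) z conn_mono[OF _ sub(2) subset_refl] by simp_all
      ultimately have "conn (\<omega> - {{u', v'}}) V o' x" using conn_trans by metis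
      then show False using A(2) by (simp add: exit_pivotal_def)
    qed
  qed
  have "\<not> conn \<omega>' V o' x"
    using assms(1) conn_mono[of \<omega>' V o' x "\<omega> - {?e1}" V]
    by (auto simp: exit_pivotal_def \<omega>'_def)
  then obtain e z where "e \<in> {?e1, ?e2}" "z \<in> e" "conn \<omega>' V z x"
    using conn_last_edge[of \<omega> V o' x "{?e1, ?e2}"] assms(1)
    unfolding \<omega>'_def exit_pivotal_def by auto
  then show False
    using key[of u1 v1 u2 v2 z] key[of u2 v2 u1 v1 z] assms ne' by auto
qed

lemma conn_enter:
  assumes "conn \<omega> S x y" "y \<in> D" "x \<notin> D"
  shows "\<exists>t' t. conn \<omega> (S - D) x t' \<and> t' \<notin> D \<and> {t', t} \<in> \<omega> \<and> t \<in> D \<and> conn \<omega> S x t"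
proof -
  obtain xs where xs: "path_in \<omega> S x y xs" using assms(1) by (auto simp: conn_def)
  have "\<exists>a\<in>set xs. a \<in> D" using xs assms by (metis last_in_set path_in_def)
  then obtain as t bs where s: "xs = as @ t # bs" "t \<in> D" "\<forall>a\<in>set as. a \<notin> D"
    using split_list_first_prop[of xs "\<lambda>a. a \<in> D"] by blast
  have p: "path_in \<omega> S x t (as @ [t])" using xs unfolding s path_in_split[of _ _ _ _ as t bs] by simp
  have "as \<noteq> []" using p assms s by (auto simp: path_in_def)
  then obtain cs t' where cs: "as = cs @ [t']" by (metis rev_exhaust)
  have q: "path_in \<omega> S x t' as" "{t', t} \<in> \<omega>"
    using p unfolding cs
    by (auto simp: path_in_def path_edges_append[of cs t' "[t]"] hd_append split: if_splits)
  then have "path_in \<omega> (S - D) x t' as" using s by (auto simp: path_in_def)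
  moreover have "t' \<notin> D" using s cs by auto
  ultimately show ?thesis using p q s unfolding conn_def by blast
qed

definition through_paths :: "'v set set \<Rightarrow> 'v set \<Rightarrow> bool" where
  "through_paths E D \<longleftrightarrow> (\<forall>s\<in>D. \<forall>t\<in>D. \<forall>v\<in>D. s \<noteq> t \<longrightarrow>
     (\<exists>xs. path_in E D s t xs \<and> distinct xs \<and> v \<in> set xs))"

text \<open>
  All edges touching \<open>D\<close> are closed except for one edge through which the cluster of
  \<open>o'\<close> enters \<open>D\<close>, one through which the cluster of \<open>x\<close> does, and a simple path in \<open>D\<close> joining
  the two. The path is led through a vertex outside \<open>S\<close>, so it leaves \<open>S\<close> inside \<open>D\<close>.
\<close>

lemma reroute_through_exit:
  assumes "\<omega> \<subseteq> F" "S \<subseteq> V" "D \<subseteq> V" "through_paths F D"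
    and "v \<in> D" "v \<notin> S" "u \<in> D" "y \<in> D" "x \<notin> D"
    and ou: "conn \<omega> S o' u" and yx: "conn \<omega> V y x" and oy: "\<not> conn \<omega> V o' y"
  shows "\<exists>\<omega>' a b. \<omega>' \<subseteq> F \<and> \<omega>' - {e \<in> F. e \<inter> D \<noteq> {}} = \<omega> - {e \<in> F. e \<inter> D \<noteq> {}} \<and>
    a \<in> D \<and> b \<in> D \<and> exit_pivotal V S o' x (a, b) \<omega>'"
proof -
  \<comment> \<open>\<open>Z0\<close> is taken in \<open>V\<close> rather than in \<open>S\<close>:
    it has to hold everything outside \<open>D\<close> that \<open>o'\<close> can still reach once
    the exit edge is removed.\<close>
  define Z0 where "Z0 = {z. conn \<omega> (V - D) o' z}"
  define \<omega>0 where "\<omega>0 = {e \<in> \<omega>. e \<inter> D = {}}"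
  have xo: "\<not> conn \<omega> V o' x" using yx oy conn_trans conn_sym by metis
  obtain t' t where t: "conn \<omega> (V - D) x t'" "{t', t} \<in> \<omega>" "t \<in> D" "t' \<notin> D" "conn \<omega> V x t"
    using conn_enter[OF conn_sym[OF yx] \<open>y \<in> D\<close> \<open>x \<notin> D\<close>] by blast
  have t'Z: "t' \<notin> Z0"
    using xo t(1) conn_mono[of \<omega> "V - D" _ _ \<omega> V] conn_trans conn_sym
    unfolding Z0_def by (metis Diff_subset mem_Collect_eq subset_refl)
  \<comment> \<open>\<open>I\<close> carries the edge by which a path of \<open>o'\<close> inside
    \<open>S\<close> first enters \<open>D\<close> at \<open>s\<close>. If \<open>o'\<close> already
    lies in \<open>D\<close>, then \<open>I\<close> is empty and \<open>s = o'\<close>.\<close>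
  have "\<exists>s I. s \<in> D \<and> s \<in> S \<and> conn \<omega> V o' s \<and> I \<subseteq> \<omega> \<and>
      (\<forall>e\<in>I. e \<inter> D = {s} \<and> (\<exists>s'\<in>Z0. e = {s', s})) \<and> conn (\<omega>0 \<union> I) S o' s \<and>
      (o' \<in> Z0 \<or> o' = s)"
  proof (cases "o' \<in> D")
    case True
    then show ?thesis
      using conn_in[OF ou] \<open>S \<subseteq> V\<close> by (intro exI[of _ o'] exI[of _ "{}"]) (auto intro: conn_refl)
  next
    case False
    obtain s' s where s: "conn \<omega> (S - D) o' s'" "{s', s} \<in> \<omega>" "s \<in> D" "s' \<notin> D" "conn \<omega> S o' s"
      using conn_enter[OF ou \<open>u \<in> D\<close> False] by blast
    have s'Z: "s' \<in> Z0"
      using s(1) \<open>S \<subseteq> V\<close> unfolding Z0_def by (auto intro: conn_mono)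
    have "conn \<omega>0 (S - D) o' s'"
      using s(1) conn_cong[of "S - D" \<omega> \<omega>0] by (auto simp: \<omega>0_def)
    then have "conn (\<omega>0 \<union> {{s', s}}) S o' s'"
      by (auto intro: conn_mono)
    moreover have "conn (\<omega>0 \<union> {{s', s}}) S s' s"
      using conn_in[OF s(1)] conn_in[OF s(5)] by (intro conn_edge) auto
    ultimately have "conn (\<omega>0 \<union> {{s', s}}) S o' s" using conn_trans by metis
    moreover have "conn \<omega> V o' s" using s \<open>S \<subseteq> V\<close> by (auto intro: conn_mono)
    moreover have "o' \<in> Z0"
      using False conn_in[OF ou] \<open>S \<subseteq> V\<close> by (auto simp: Z0_def intro!: conn_refl)
    ultimately show ?thesis
      using s s'Z conn_in[OF s(5)] by (intro exI[of _ s] exI[of _ "{{s', s}}"]) auto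
  qed
  then obtain s I where s: "s \<in> D" "s \<in> S" "conn \<omega> V o' s" "I \<subseteq> \<omega>"
    "\<forall>e\<in>I. e \<inter> D = {s} \<and> (\<exists>s'\<in>Z0. e = {s', s})"
    "conn (\<omega>0 \<union> I) S o' s" "o' \<in> Z0 \<or> o' = s"
    by (elim exE conjE) (rule that)
  have "s \<noteq> t" using s(3) t(5) xo conn_trans conn_sym by metis
  then obtain xs where xs: "path_in F D s t xs" "distinct xs" "v \<in> set xs"
    using assms(4) s(1) t(3) \<open>v \<in> D\<close> unfolding through_paths_def by metis
  \<comment> \<open>The exit edge joins the first vertex \<open>b\<close> of the path outside
    \<open>S\<close> to its predecessor \<open>a\<close>, which exists because the path starts at
    \<open>s\<close> in \<open>S\<close>.\<close>
  have "\<exists>a\<in>set xs. a \<notin> S" using xs \<open>v \<notin> S\<close> by auto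
  then obtain as b bs where b: "xs = as @ b # bs" "b \<notin> S" "\<forall>a\<in>set as. a \<in> S"
    using split_list_first_prop[of xs "\<lambda>a. a \<notin> S"] by blast
  have "as \<noteq> []" using b xs s(2) by (auto simp: path_in_def)
  then obtain cs a where a: "as = cs @ [a]" by (metis rev_exhaust)
  have set_xs: "set xs \<subseteq> D" "path_edges xs \<subseteq> F" "hd as = s" "last xs = t" "last as = a"
    using xs(1) b \<open>as \<noteq> []\<close> a by (auto simp: path_in_def hd_append)
  have edges: "path_edges xs = path_edges as \<union> {{a, b}} \<union> path_edges (b # bs)"
    using path_edges_append2[of as "b # bs"] \<open>as \<noteq> []\<close> set_xs(5) b(1) by simp
  define \<omega>' where "\<omega>' = \<omega>0 \<union> I \<union> {{t', t}} \<union> path_edges xs"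
  have Dxs: "e \<subseteq> D" if "e \<in> path_edges xs" for e
    using path_edges_subset[OF that] set_xs by auto
  have ab: "a \<in> D" "b \<in> D" "a \<in> S" using set_xs(1) a b by auto
  have "\<omega>' \<subseteq> F" using assms(1) s(4) t(2) set_xs(2) by (auto simp: \<omega>'_def \<omega>0_def)
  moreover have "\<omega>' - {e \<in> F. e \<inter> D \<noteq> {}} = \<omega> - {e \<in> F. e \<inter> D \<noteq> {}}"
  proof -
    have "e \<inter> D \<noteq> {}" if "e \<in> I \<union> {{t', t}} \<union> path_edges xs" for e
    proof (cases "e \<in> path_edges xs")
      case True
      moreover have "e \<noteq> {}" using path_edges_distinct[OF True xs(2)] by auto
      ultimately show ?thesis using Dxs by auto
    qed (use that s(5) t(3) in auto)
    then have "\<omega>' - {e \<in> F. e \<inter> D \<noteq> {}} \<subseteq> \<omega>0"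
      using \<open>\<omega>' \<subseteq> F\<close> by (auto simp: \<omega>'_def)
    then show ?thesis using assms(1) by (auto simp: \<omega>0_def \<omega>'_def)
  qed
  moreover have "exit_pivotal V S o' x (a, b) \<omega>'"
  proof -
    have os: "conn \<omega>' S o' s" using s(6) by (rule conn_mono) (auto simp: \<omega>'_def)
    have "conn \<omega>' S s a"
      using conn_path[of as \<omega>' S] edges b(3) \<open>as \<noteq> []\<close> set_xs by (auto simp: \<omega>'_def)
    then have oa: "conn \<omega>' S o' a" using os conn_trans by metis
    have "conn \<omega>' D s t" using xs(1) by (auto simp: conn_def path_in_def \<omega>'_def)
    then have "conn \<omega>' V s t" using conn_mono[OF _ subset_refl \<open>D \<subseteq> V\<close>] by simp
    moreover have "conn \<omega>' V t t'"
      using t(3) \<open>D \<subseteq> V\<close> conn_in[OF t(1)] by (intro conn_edge) (auto simp: \<omega>'_def insert_commute)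
    moreover have "conn \<omega>0 (V - D) x t'"
      using t(1) conn_cong[of "V - D" \<omega> \<omega>0] by (auto simp: \<omega>0_def)
    then have "conn \<omega>' V x t'"
      by (rule conn_mono) (auto simp: \<omega>'_def)
    then have "conn \<omega>' V t' x" by (rule conn_sym)
    moreover have "conn \<omega>' V o' s" using os \<open>S \<subseteq> V\<close> by (auto intro: conn_mono)
    ultimately have ox: "conn \<omega>' V o' x" using conn_trans by metis
    have "\<not> conn (\<omega>' - {{a, b}}) V o' x"
    proof
      assume c: "conn (\<omega>' - {{a, b}}) V o' x"
      have dj: "set as \<inter> set (b # bs) = {}" using xs(2) b(1) by auto
      have tb: "t \<in> set (b # bs)" using set_xs(4) b(1) by auto
      have Z0D: "Z0 \<inter> D = {}" unfolding Z0_def using conn_in by fastforce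
      \<comment> \<open>With \<open>{a, b}\<close> removed, \<open>Z0\<close> together with the
        initial piece \<open>as\<close> is closed under open edges: the entry edge of
        \<open>x\<close> and the rest of the path from \<open>b\<close> on touch neither. But
        \<open>x\<close> is in neither part.\<close>
      have "x \<in> Z0 \<union> set as"
        using c
      proof (rule conn_closed)
        show "o' \<in> Z0 \<union> set as" using s(7) set_xs(3) \<open>as \<noteq> []\<close> by auto
      next
        fix c d assume cd: "{c, d} \<in> \<omega>' - {{a, b}}" "c \<in> Z0 \<union> set as" "d \<in> V"
        have asD: "set as \<subseteq> D" using set_xs(1) b(1) by auto
        have sas: "s \<in> set as" using set_xs(3) \<open>as \<noteq> []\<close> by auto
        consider "{c, d} \<in> \<omega>0" | "{c, d} \<in> I" | "{c, d} = {t', t}" | "{c, d} \<in> path_edges as"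
          | "{c, d} \<in> path_edges (b # bs)"
          using cd(1) edges by (auto simp: \<omega>'_def)
        then show "d \<in> Z0 \<union> set as"
        proof cases
          case 1
          then have "c \<in> Z0" "{c, d} \<in> \<omega>" "d \<notin> D" using cd(2) asD by (auto simp: \<omega>0_def)
          then have "conn \<omega> (V - D) o' c" "conn \<omega> (V - D) c d"
            using cd(3) conn_in[of \<omega> "V - D" o' c] by (auto simp: Z0_def intro!: conn_edge)
          then show ?thesis using conn_trans unfolding Z0_def by fast
        next
          case 2
          then obtain s' where "s' \<in> Z0" "{c, d} = {s', s}" using s(5) by blast
          then show ?thesis using sas by (auto simp: doubleton_eq_iff)
        next
          case 3
          then have "c = t' \<or> c = t" by (auto simp: doubleton_eq_iff)
          then show ?thesis using cd(2) t'Z t(3,4) tb dj Z0D asD by auto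
        next
          case 4
          then show ?thesis using path_edges_subset by fastforce
        next
          case 5
          then have "c \<in> set (b # bs)" using path_edges_subset by fastforce
          then show ?thesis using cd(2) dj Z0D set_xs(1) b(1) by auto
        qed
      qed
      then show False
        using xo set_xs(1) b(1) \<open>x \<notin> D\<close> conn_mono[of \<omega> "V - D" o' x \<omega> V] by (auto simp: Z0_def)
    qed
    then show ?thesis
      using ab b(2) edges oa ox by (auto simp: exit_pivotal_def \<omega>'_def)
  qed
  ultimately show ?thesis using ab by blast
qed

section \<open>Percolation on a finite graph\<close>

locale finite_percolation = bernoulli p for p +
  fixes F :: "'v set set" and V :: "'v set"
  assumes finite_F: "finite F" and finite_V: "finite V"
begin

definition cp :: "'v set \<Rightarrow> 'v \<Rightarrow> 'v \<Rightarrow> real" where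
  "cp S x y = PR F (\<lambda>\<omega>. conn \<omega> S x y)"

definition simple_paths :: "'v set \<Rightarrow> 'v \<Rightarrow> 'v \<Rightarrow> 'v list set" where
  "simple_paths S x u = {xs. xs \<noteq> [] \<and> distinct xs \<and> hd xs = x \<and> last xs = u \<and> set xs \<subseteq> S}"

text \<open>For different \<open>xs\<close> these events partition the connection event, and each is
  an open path combined with a decreasing event, as \<open>PR_supset_decreasing_le\<close> requires.
  The enumeration is arbitrary.\<close>

definition first_path :: "'v set \<Rightarrow> 'v \<Rightarrow> 'v \<Rightarrow> 'v list \<Rightarrow> 'v set set \<Rightarrow> bool" where
  "first_path S x u xs \<omega> \<longleftrightarrow> path_edges xs \<subseteq> \<omega> \<and>
     (\<forall>ys\<in>simple_paths S x u. to_nat_on (simple_paths S x u) ys < to_nat_on (simple_paths S x u) xs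
        \<longrightarrow> \<not> path_edges ys \<subseteq> \<omega>)"

text \<open>Probability that the chosen path from \<open>x\<close> to \<open>u\<close> exists and
  passes through \<open>a\<close>; summed over a set of \<open>a\<close> it is the mean number of
  visits to that set.\<close>

definition via :: "'v set \<Rightarrow> 'v \<Rightarrow> 'v \<Rightarrow> 'v \<Rightarrow> real" where
  "via S x u a = (\<Sum>xs\<in>simple_paths S x u. PR F (first_path S x u xs) * of_bool (a \<in> set xs))"

definition sep :: "'v set \<Rightarrow> 'v \<Rightarrow> 'v \<Rightarrow> 'v \<Rightarrow> 'v \<Rightarrow> real" where
  "sep S o' u y x = PR F (\<lambda>\<omega>. conn \<omega> S o' u \<and> conn \<omega> V y x \<and> \<not> conn \<omega> V o' y)"

lemma cp_nonneg: "0 \<le> cp S x y"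
  unfolding cp_def by (rule PR_nonneg)

lemma cp_sym: "cp S x y = cp S y x"
  unfolding cp_def by (rule bprob_cong) (blast intro: conn_sym)

lemma cp_mono: "S \<subseteq> S' \<Longrightarrow> cp S x y \<le> cp S' x y"
  unfolding cp_def by (rule PR_mono) (rule conn_mono, auto)

lemma cp_mult_le: "cp S x a * cp S a y \<le> cp S x y"
proof -
  have "cp S x a * cp S a y \<le> PR F (\<lambda>\<omega>. conn \<omega> S x a \<and> conn \<omega> S a y)"
    unfolding cp_def by (intro harris finite_F incr_conn)
  also have "\<dots> \<le> cp S x y"
    unfolding cp_def by (rule PR_mono) (auto intro: conn_trans)
  finally show ?thesis .
qed

lemma via_nonneg: "0 \<le> via S x u a"
  unfolding via_def by (intro sum_nonneg mult_nonneg_nonneg PR_nonneg) auto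

section \<open>Decomposition of a connection by its first path\<close>

lemma finite_simple_paths:
  assumes "finite S"
  shows "finite (simple_paths S x u)"
  by (rule finite_subset[OF _ finite_subset_distinct[OF assms]]) (auto simp: simple_paths_def)

lemma conn_iff_simple_path: "conn \<omega> S x u \<longleftrightarrow> (\<exists>xs\<in>simple_paths S x u. path_edges xs \<subseteq> \<omega>)"
proof
  assume "conn \<omega> S x u"
  then show "\<exists>xs\<in>simple_paths S x u. path_edges xs \<subseteq> \<omega>"
    using conn_distinct_path[of \<omega> S x u] by (auto simp: simple_paths_def path_in_def)
qed (auto simp: simple_paths_def conn_def path_in_def)

lemma first_path_exists:
  assumes "conn \<omega> S x u"
  shows "\<exists>xs\<in>simple_paths S x u. first_path S x u xs \<omega>"
proof -
  let ?P = "simple_paths S x u" and ?f = "to_nat_on (simple_paths S x u)"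
  have "\<exists>xs. xs \<in> ?P \<and> path_edges xs \<subseteq> \<omega>" using assms conn_iff_simple_path by auto
  then obtain xs where xs: "xs \<in> ?P \<and> path_edges xs \<subseteq> \<omega>"
    and min: "\<And>ys. ys \<in> ?P \<and> path_edges ys \<subseteq> \<omega> \<Longrightarrow> ?f xs \<le> ?f ys"
    using ex_has_least_nat[of "\<lambda>xs. xs \<in> ?P \<and> path_edges xs \<subseteq> \<omega>" _ ?f] by blast
  then have "first_path S x u xs \<omega>" unfolding first_path_def using not_le by blast
  then show ?thesis using xs by blast
qed

lemma first_path_unique:
  assumes "finite S" "xs \<in> simple_paths S x u" "ys \<in> simple_paths S x u"
    "first_path S x u xs \<omega>" "first_path S x u ys \<omega>"
  shows "xs = ys"
proof -
  have "to_nat_on (simple_paths S x u) xs = to_nat_on (simple_paths S x u) ys"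
    using assms unfolding first_path_def by (meson linorder_neqE_nat)
  then show ?thesis
    using assms countable_finite[OF finite_simple_paths] inj_on_to_nat_on by (metis inj_onD)
qed

lemma sum_first_path_eq:
  assumes "finite S"
  shows "(\<Sum>xs\<in>simple_paths S x u. PR F (first_path S x u xs)) = cp S x u"
  unfolding cp_def
proof (rule antisym)
  show "(\<Sum>xs\<in>simple_paths S x u. PR F (first_path S x u xs)) \<le> PR F (\<lambda>\<omega>. conn \<omega> S x u)"
  proof (rule sum_PR_le)
    show "\<And>i j \<omega>. i \<in> simple_paths S x u \<Longrightarrow> j \<in> simple_paths S x u \<Longrightarrow> \<omega> \<subseteq> F
      \<Longrightarrow> first_path S x u i \<omega> \<Longrightarrow> first_path S x u j \<omega> \<Longrightarrow> i = j"
      using first_path_unique[OF assms] by blast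
  qed (use assms finite_simple_paths conn_iff_simple_path in \<open>auto simp: first_path_def\<close>)
  show "PR F (\<lambda>\<omega>. conn \<omega> S x u) \<le> (\<Sum>xs\<in>simple_paths S x u. PR F (first_path S x u xs))"
    using assms finite_simple_paths first_path_exists by (intro PR_le_sum) auto
qed

text \<open>The connection to \<open>w\<close> leaves the chosen path for the last time at some
  \<open>a\<close> and then uses other edges. Because \<open>first_path\<close> is not an increasing
  event, the branch is split off by Harris conditionally on the path, through
  \<open>PR_supset_decreasing_le\<close>.\<close>

lemma via_branch:
  assumes "finite S" "S \<subseteq> V"
  shows "PR F (\<lambda>\<omega>. conn \<omega> S x u \<and> conn \<omega> V x w) \<le> (\<Sum>a\<in>S. via S x u a * cp V a w)"
proof -
  let ?P = "simple_paths S x u"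
  have fin: "finite ?P" using finite_simple_paths[OF assms(1)] .
  have *: "PR F (\<lambda>\<omega>. first_path S x u xs \<omega> \<and> conn (\<omega> - path_edges xs) V a w)
      \<le> PR F (first_path S x u xs) * cp V a w" for xs a
  proof (cases "path_edges xs \<subseteq> F")
    case True
    show ?thesis
      unfolding first_path_def cp_def
      by (rule PR_supset_decreasing_le[OF finite_F True incr_conn]) (rule incr_eventI, blast)
  next
    case False
    have "PR F (\<lambda>\<omega>. first_path S x u xs \<omega> \<and> conn (\<omega> - path_edges xs) V a w) = PR F (\<lambda>_. False)"
      using False by (intro bprob_cong) (auto simp: first_path_def)
    then have "PR F (\<lambda>\<omega>. first_path S x u xs \<omega> \<and> conn (\<omega> - path_edges xs) V a w) = 0"
      using finite_F by (simp add: bprob_def bexp_const)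
    then show ?thesis using cp_nonneg[of V a w] PR_nonneg[of F "first_path S x u xs"] by simp
  qed
  have "PR F (\<lambda>\<omega>. conn \<omega> S x u \<and> conn \<omega> V x w)
      \<le> (\<Sum>(xs, a)\<in>(SIGMA xs:?P. set xs). PR F (\<lambda>\<omega>. first_path S x u xs \<omega> \<and> conn (\<omega> - path_edges xs) V a w))"
  proof -
    have "\<exists>i\<in>(SIGMA xs:?P. set xs). (\<lambda>(xs, a) \<omega>. first_path S x u xs \<omega> \<and> conn (\<omega> - path_edges xs) V a w) i \<omega>"
      if c: "conn \<omega> S x u \<and> conn \<omega> V x w" for \<omega>
    proof -
      obtain xs where xs: "xs \<in> ?P" "first_path S x u xs \<omega>" using c first_path_exists by blast
      then have "x \<in> set xs" by (auto simp: simple_paths_def)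
      then obtain a where "a \<in> set xs" "conn (\<omega> - path_edges xs) V a w"
        using conn_branch c by metis
      then show ?thesis using xs by auto
    qed
    then show ?thesis
      using PR_le_sum[of "SIGMA xs:?P. set xs" F _ "\<lambda>(xs, a) \<omega>. first_path S x u xs \<omega> \<and> conn (\<omega> - path_edges xs) V a w"] fin
      by (simp add: case_prod_beta)
  qed
  also have "\<dots> \<le> (\<Sum>(xs, a)\<in>(SIGMA xs:?P. set xs). PR F (first_path S x u xs) * cp V a w)"
    using * by (intro sum_mono) auto
  also have "\<dots> = (\<Sum>xs\<in>?P. \<Sum>a\<in>set xs. PR F (first_path S x u xs) * cp V a w)"
    using fin by (intro sum.Sigma[symmetric]) auto
  also have "\<dots> = (\<Sum>xs\<in>?P. \<Sum>a\<in>S. PR F (first_path S x u xs) * of_bool (a \<in> set xs) * cp V a w)"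
  proof (rule sum.cong[OF refl])
    fix xs assume xs: "xs \<in> ?P"
    show "(\<Sum>a\<in>set xs. PR F (first_path S x u xs) * cp V a w)
        = (\<Sum>a\<in>S. PR F (first_path S x u xs) * of_bool (a \<in> set xs) * cp V a w)"
      using xs assms(1) by (intro sum.mono_neutral_cong_left) (auto simp: simple_paths_def)
  qed
  also have "\<dots> = (\<Sum>a\<in>S. via S x u a * cp V a w)"
    unfolding via_def sum_distrib_right by (rule sum.swap)
  finally show ?thesis .
qed

text \<open>If all connections from \<open>y\<close> to \<open>x\<close> meet \<open>A\<close>, some
  \<open>w\<close> in \<open>A\<close> cuts one into two edge-disjoint halves; sum the van den
  Berg-Kesten bound over \<open>w\<close>.\<close>

lemma cp_avoid_ge:
  "cp V y x - (\<Sum>w\<in>A \<inter> V. cp V y w * cp V w x) \<le> cp (V - A) y x"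
proof -
  have "cp V y x \<le> PR F (\<lambda>\<omega>. conn \<omega> (V - A) y x \<or>
      (\<exists>w\<in>A \<inter> V. disj_occ (\<lambda>\<omega>. conn \<omega> V y w) (\<lambda>\<omega>. conn \<omega> V w x) \<omega>))"
    unfolding cp_def
  proof (rule PR_mono)
    fix \<omega> assume "conn \<omega> V y x"
    then show "conn \<omega> (V - A) y x \<or>
      (\<exists>w\<in>A \<inter> V. disj_occ (\<lambda>\<omega>. conn \<omega> V y w) (\<lambda>\<omega>. conn \<omega> V w x) \<omega>)"
      using conn_through[of \<omega> V y x A] by argo
  qed
  also have "\<dots> \<le> cp (V - A) y x
      + PR F (\<lambda>\<omega>. \<exists>w\<in>A \<inter> V. disj_occ (\<lambda>\<omega>. conn \<omega> V y w) (\<lambda>\<omega>. conn \<omega> V w x) \<omega>)"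
    unfolding PR_disj cp_def using PR_nonneg by simp
  also have "PR F (\<lambda>\<omega>. \<exists>w\<in>A \<inter> V. disj_occ (\<lambda>\<omega>. conn \<omega> V y w) (\<lambda>\<omega>. conn \<omega> V w x) \<omega>)
      \<le> (\<Sum>w\<in>A \<inter> V. PR F (disj_occ (\<lambda>\<omega>. conn \<omega> V y w) (\<lambda>\<omega>. conn \<omega> V w x)))"
    using finite_V by (intro PR_le_sum) auto
  also have "\<dots> \<le> (\<Sum>w\<in>A \<inter> V. cp V y w * cp V w x)"
    unfolding cp_def by (intro sum_mono van_den_berg_kesten finite_F incr_conn)
  finally show ?thesis by simp
qed

section \<open>Conditioning on a cluster\<close>

definition cluster :: "'v \<Rightarrow> 'v set set \<Rightarrow> 'v set" where
  "cluster x \<omega> = {z. conn \<omega> V x z}"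

text \<open>Exploring the cluster of \<open>x\<close> inspects only edges that touch it, so the
  event that the cluster equals \<open>A\<close> is decided by those edges and is independent of the
  rest.\<close>

lemma cluster_local:
  assumes "cluster x \<omega> = A" "\<omega> \<inter> {e. e \<inter> A \<noteq> {}} = \<omega>' \<inter> {e. e \<inter> A \<noteq> {}}" "S \<subseteq> V"
  shows "conn \<omega> S x z \<longleftrightarrow> conn \<omega>' S x z"
proof
  assume "conn \<omega> S x z"
  then show "conn \<omega>' S x z"
  proof (induction rule: conn_induct)
    case base
    then show ?case
      using \<open>conn \<omega> S x z\<close> conn_in conn_refl by metis
  next
    case (step u v)
    have "u \<in> A" using step(1) assms(1,3) conn_mono[OF _ subset_refl assms(3)] by (auto simp: cluster_def)
    then have "{u, v} \<in> \<omega>'" using step assms(2) by blast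
    then have "conn \<omega>' S u v" using step conn_in by (metis conn_edge)
    then show ?case using step conn_trans by metis
  qed
next
  assume "conn \<omega>' S x z"
  then show "conn \<omega> S x z"
  proof (induction rule: conn_induct)
    case base
    then show ?case
      using \<open>conn \<omega>' S x z\<close> conn_in conn_refl by metis
  next
    case (step u v)
    have "u \<in> A" using step.IH assms(1,3) conn_mono[OF _ subset_refl assms(3)] by (auto simp: cluster_def)
    then have "{u, v} \<in> \<omega>" using step assms(2) by blast
    then have "conn \<omega> S u v" using step conn_in by (metis conn_edge)
    then show ?case using step conn_trans by metis
  qed
qed

text \<open>
  Given the cluster \<open>A\<close> of \<open>o'\<close>, the configuration off \<open>A\<close> is fresh, and it connects
  \<open>y\<close> to \<open>x\<close> unless every path between them runs through \<open>A\<close>.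
\<close>

lemma disjoint_clusters_ge:
  assumes "finite S" "S \<subseteq> V"
  shows "cp S o' u * cp V y x
      - (\<Sum>w\<in>V. (\<Sum>a\<in>S. via S o' u a * cp V a w) * (cp V y w * cp V w x))
    \<le> sep S o' u y x"
proof -
  define C where "C A \<omega> \<longleftrightarrow> cluster o' \<omega> = A \<and> conn \<omega> S o' u" for A \<omega>
  let ?t = "\<lambda>w. cp V y w * cp V w x"
  have clV: "cluster o' \<omega> \<subseteq> V" for \<omega> unfolding cluster_def using conn_in by fastforce
  have indep: "PR F (\<lambda>\<omega>. C A \<omega> \<and> conn \<omega> (V - A) y x) = PR F (C A) * cp (V - A) y x" for A
    unfolding cp_def
  proof (rule PR_independent[OF finite_F, where G = "{e. e \<inter> A \<noteq> {}}"])
    fix \<omega> :: "'v set set"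
    let ?\<omega>' = "\<omega> \<inter> {e. e \<inter> A \<noteq> {}}"
    \<comment> \<open>Allowing either configuration to be the one with cluster \<open>A\<close>
      gives both directions of the equality of events below.\<close>
    have eq: "conn \<omega> T o' z \<longleftrightarrow> conn ?\<omega>' T o' z"
      if "cluster o' \<omega> = A \<or> cluster o' ?\<omega>' = A" "T \<subseteq> V" for T z
      using that cluster_local[of o' \<omega> A ?\<omega>' T z] cluster_local[of o' ?\<omega>' A \<omega> T z] by auto
    have "cluster o' \<omega> = cluster o' ?\<omega>'" if "cluster o' \<omega> = A \<or> cluster o' ?\<omega>' = A"
      unfolding cluster_def by (rule Collect_cong) (rule eq[OF that subset_refl])
    then show "C A \<omega> = C A ?\<omega>'"
      using eq[OF _ assms(2), of u] unfolding C_def by blast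
    show "conn \<omega> (V - A) y x = conn (\<omega> - {e. e \<inter> A \<noteq> {}}) (V - A) y x"
      by (rule conn_cong) auto
  qed
  have partition: "(\<Sum>A\<in>Pow V. PR F (\<lambda>\<omega>. C A \<omega> \<and> P A)) = PR F (\<lambda>\<omega>. conn \<omega> S o' u \<and> P (cluster o' \<omega>))" for P
    using clV finite_V
    by (intro antisym sum_PR_le PR_le_sum) (auto simp: C_def)
  have "cp S o' u * cp V y x - (\<Sum>w\<in>V. PR F (\<lambda>\<omega>. conn \<omega> S o' u \<and> conn \<omega> V o' w) * ?t w)
      = (\<Sum>A\<in>Pow V. PR F (C A) * cp V y x) - (\<Sum>w\<in>V. (\<Sum>A\<in>Pow V. PR F (\<lambda>\<omega>. C A \<omega> \<and> w \<in> A)) * ?t w)"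
    using partition[of "\<lambda>_. True"] partition[of "\<lambda>A. _ \<in> A"]
    by (simp add: cp_def sum_distrib_right[symmetric] cluster_def)
  also have "(\<Sum>w\<in>V. (\<Sum>A\<in>Pow V. PR F (\<lambda>\<omega>. C A \<omega> \<and> w \<in> A)) * ?t w)
      = (\<Sum>A\<in>Pow V. PR F (C A) * (\<Sum>w\<in>A \<inter> V. ?t w))"
  proof -
    have "(\<Sum>w\<in>V. (\<Sum>A\<in>Pow V. PR F (\<lambda>\<omega>. C A \<omega> \<and> w \<in> A)) * ?t w)
        = (\<Sum>A\<in>Pow V. \<Sum>w\<in>V. PR F (\<lambda>\<omega>. C A \<omega> \<and> w \<in> A) * ?t w)"
      unfolding sum_distrib_right by (rule sum.swap)
    also have "\<dots> = (\<Sum>A\<in>Pow V. PR F (C A) * (\<Sum>w\<in>A \<inter> V. ?t w))"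
    proof (rule sum.cong[OF refl])
      fix A assume "A \<in> Pow V"
      have "(\<Sum>w\<in>V. PR F (\<lambda>\<omega>. C A \<omega> \<and> w \<in> A) * ?t w) = (\<Sum>w\<in>A \<inter> V. PR F (C A) * ?t w)"
      proof (rule sum.mono_neutral_cong_right)
        show "\<forall>w\<in>V - A \<inter> V. PR F (\<lambda>\<omega>. C A \<omega> \<and> w \<in> A) * ?t w = 0"
        proof
          fix w assume "w \<in> V - A \<inter> V"
          then have "PR F (\<lambda>\<omega>. C A \<omega> \<and> w \<in> A) = PR F (\<lambda>_. False)"
            by (intro bprob_cong) auto
          also have "\<dots> = 0" using finite_F by (simp add: bprob_def bexp_const)
          finally show "PR F (\<lambda>\<omega>. C A \<omega> \<and> w \<in> A) * ?t w = 0" by simp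
        qed
      qed (use finite_V in auto)
      then show "(\<Sum>w\<in>V. PR F (\<lambda>\<omega>. C A \<omega> \<and> w \<in> A) * ?t w) = PR F (C A) * (\<Sum>w\<in>A \<inter> V. ?t w)"
        by (simp add: sum_distrib_left)
    qed
    finally show ?thesis .
  qed
  \<comment> \<open>After conditioning, \<open>A\<close> is a deterministic set, and the loss of
    \<open>cp_avoid_ge\<close> summed over \<open>A\<close> turns into the probability that
    \<open>w\<close> lies in the cluster.\<close>
  also have "(\<Sum>A\<in>Pow V. PR F (C A) * cp V y x) - (\<Sum>A\<in>Pow V. PR F (C A) * (\<Sum>w\<in>A \<inter> V. ?t w))
      \<le> (\<Sum>A\<in>Pow V. PR F (C A) * cp (V - A) y x)"
    unfolding sum_subtractf[symmetric] right_diff_distrib[symmetric]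
    by (intro sum_mono mult_left_mono cp_avoid_ge PR_nonneg)
  also have "\<dots> = (\<Sum>A\<in>Pow V. PR F (\<lambda>\<omega>. C A \<omega> \<and> conn \<omega> (V - A) y x))"
    by (simp add: indep)
  also have "\<dots> \<le> sep S o' u y x"
    unfolding sep_def
  proof (rule sum_PR_le)
    fix A \<omega> assume A: "C A \<omega> \<and> conn \<omega> (V - A) y x"
    then have "y \<notin> A" using conn_in by fastforce
    then show "conn \<omega> S o' u \<and> conn \<omega> V y x \<and> \<not> conn \<omega> V o' y"
      using A conn_mono[of \<omega> "V - A" y x \<omega> V] by (auto simp: C_def cluster_def)
  qed (use finite_V in \<open>auto simp: C_def\<close>)
  finally have main: "cp S o' u * cp V y x - (\<Sum>w\<in>V. PR F (\<lambda>\<omega>. conn \<omega> S o' u \<and> conn \<omega> V o' w) * ?t w)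
    \<le> sep S o' u y x" .
  have "(\<Sum>w\<in>V. PR F (\<lambda>\<omega>. conn \<omega> S o' u \<and> conn \<omega> V o' w) * ?t w)
      \<le> (\<Sum>w\<in>V. (\<Sum>a\<in>S. via S o' u a * cp V a w) * ?t w)"
    using via_branch[OF assms] cp_nonneg by (intro sum_mono mult_right_mono) auto
  then show ?thesis using main by simp
qed

text \<open>Split off the first link by van den Berg-Kesten. The weight \<open>f\<close> is
  arbitrary because that link, seen from its other end, becomes the weight of the next
  point.\<close>

lemma sum_chain_le:
  assumes "finite B" "\<And>a. a \<in> B \<Longrightarrow> (\<Sum>b\<in>B. cp S a b) \<le> \<sigma>" "0 \<le> \<sigma>" "\<And>a. 0 \<le> f a"
  shows "(\<Sum>as | set as \<subseteq> B \<and> length as = Suc j. f (hd as) * PR F (chain S as)) \<le> (\<Sum>a\<in>B. f a) * \<sigma> ^ j"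
  using assms(4)
proof (induction j arbitrary: f)
  case 0
  have eq: "{as. set as \<subseteq> B \<and> length as = Suc 0} = (\<lambda>a. [a]) ` B"
    by (auto simp: length_Suc_conv)
  have "(\<Sum>as | set as \<subseteq> B \<and> length as = Suc 0. f (hd as) * PR F (chain S as)) = (\<Sum>a\<in>B. f a)"
    unfolding eq by (subst sum.reindex) (auto simp: inj_on_def bprob_True finite_F)
  then show ?case by simp
next
  case (Suc j)
  let ?L = "\<lambda>n. {as. set as \<subseteq> B \<and> length as = n}"
  have eq: "?L (Suc (Suc j)) = (\<lambda>(a, bs). a # bs) ` (B \<times> ?L (Suc j))"
    by (auto simp: image_iff length_Suc_conv)
  have inj: "inj_on (\<lambda>(a, bs). a # bs) (B \<times> ?L (Suc j))" by (auto simp: inj_on_def)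
  have le: "PR F (chain S (a # bs)) \<le> cp S a (hd bs) * PR F (chain S bs)" if bs: "bs \<in> ?L (Suc j)" for a bs
  proof -
    obtain b cs where "bs = b # cs" using bs by (auto simp: length_Suc_conv)
    then show ?thesis
      using van_den_berg_kesten[OF finite_F incr_conn incr_chain] by (simp add: cp_def)
  qed
  have "(\<Sum>as\<in>?L (Suc (Suc j)). f (hd as) * PR F (chain S as))
      = (\<Sum>(a, bs)\<in>B \<times> ?L (Suc j). f a * PR F (chain S (a # bs)))"
    unfolding eq by (subst sum.reindex[OF inj]) (auto simp: case_prod_beta)
  also have "\<dots> = (\<Sum>a\<in>B. \<Sum>bs\<in>?L (Suc j). f a * PR F (chain S (a # bs)))"
    by (rule sum.cartesian_product[symmetric])
  also have "\<dots> \<le> (\<Sum>a\<in>B. \<Sum>bs\<in>?L (Suc j). f a * (cp S a (hd bs) * PR F (chain S bs)))"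
    using le Suc.prems by (intro sum_mono mult_left_mono) auto
  also have "\<dots> = (\<Sum>a\<in>B. f a * (\<Sum>bs\<in>?L (Suc j). cp S a (hd bs) * PR F (chain S bs)))"
    by (simp add: sum_distrib_left)
  also have "\<dots> \<le> (\<Sum>a\<in>B. f a * ((\<Sum>b\<in>B. cp S a b) * \<sigma> ^ j))"
    using Suc.prems cp_nonneg by (intro sum_mono mult_left_mono Suc.IH) auto
  also have "\<dots> \<le> (\<Sum>a\<in>B. f a * (\<sigma> * \<sigma> ^ j))"
    using Suc.prems assms by (intro sum_mono mult_left_mono mult_right_mono) auto
  also have "\<dots> = (\<Sum>a\<in>B. f a) * \<sigma> ^ Suc j"
    by (simp add: sum_distrib_right)
  finally show ?case .
qed

text \<open>For \<open>n\<close> above \<open>t\<close>, the binomial coefficient is at least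
  \<open>n * t ^ j\<close> divided by the constant. With \<open>t\<close> well above the typical
  size, the second term is a high-moment correction.\<close>

lemma binomial_tail_bound:
  assumes "real (Suc j) \<le> t"
  shows "real n \<le> t + real (Suc j) ^ Suc j / t ^ j * real (n choose Suc j)"
proof (cases "real n \<le> t")
  case True
  moreover have "0 \<le> real (Suc j) ^ Suc j / t ^ j * real (n choose Suc j)"
    using assms by (intro mult_nonneg_nonneg divide_nonneg_nonneg) auto
  ultimately show ?thesis by linarith
next
  case False
  have t: "0 < t" using assms by linarith
  have "(real n / real (Suc j)) ^ Suc j \<le> real (n choose Suc j)"
    using False assms by (intro binomial_ge_n_over_k_pow_k) (simp add: field_simps)
  then have "real n ^ Suc j \<le> real (Suc j) ^ Suc j * real (n choose Suc j)"
    by (simp add: power_divide field_simps del: of_nat_Suc power_Suc)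
  moreover have "real n * t ^ j \<le> real n ^ Suc j"
    using False t by (auto intro!: mult_left_mono power_mono)
  ultimately have "real n \<le> real (Suc j) ^ Suc j * real (n choose Suc j) / t ^ j"
    using t by (simp add: pos_le_divide_eq)
  then show ?thesis using t by simp
qed

text \<open>Each choice of \<open>k\<close> visited points, listed in the order of the path, is a
  subsequence.\<close>

lemma binomial_le_card_subseq:
  assumes "distinct xs" "finite B"
  shows "card (set xs \<inter> B) choose k \<le> card {as. set as \<subseteq> B \<and> length as = k \<and> subseq as xs}"
proof -
  let ?N = "{I. I \<subseteq> set xs \<inter> B \<and> card I = k}"
  let ?T = "{as. set as \<subseteq> B \<and> length as = k \<and> subseq as xs}"
  have fT: "finite ?T"
    by (rule finite_subset[OF _ finite_lists_length_eq[OF assms(2), of k]]) auto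
  have "card (set xs \<inter> B) choose k = card ?N"
    using n_subsets[of "set xs \<inter> B" k] by simp
  also have "\<dots> = card ((\<lambda>I. filter (\<lambda>a. a \<in> I) xs) ` ?N)"
  proof (rule card_image[symmetric], rule inj_onI)
    fix I J assume IJ: "I \<in> ?N" "J \<in> ?N" "filter (\<lambda>a. a \<in> I) xs = filter (\<lambda>a. a \<in> J) xs"
    have "set (filter (\<lambda>a. a \<in> I) xs) = I" "set (filter (\<lambda>a. a \<in> J) xs) = J"
      using IJ(1,2) by auto
    then show "I = J" using IJ(3) by metis
  qed
  also have "\<dots> \<le> card ?T"
  proof (rule card_mono[OF fT], rule image_subsetI)
    fix I assume I: "I \<in> ?N"
    have s: "set (filter (\<lambda>a. a \<in> I) xs) = I" using I by auto
    have "length (filter (\<lambda>a. a \<in> I) xs) = k"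
      using I s distinct_card[of "filter (\<lambda>a. a \<in> I) xs"] assms by auto
    then show "filter (\<lambda>a. a \<in> I) xs \<in> ?T"
      using I s subseq_filter_left by auto
  qed
  finally show ?thesis .
qed

text \<open>
  A path visiting \<open>B\<close> often yields many chains of connected points of \<open>B\<close>, whose expected
  number is controlled by the van den Berg--Kesten inequality.
\<close>

lemma via_sum_le:
  assumes "finite S" "finite B" "B \<subseteq> S" "real (Suc j) \<le> t"
    and "\<And>a. a \<in> B \<Longrightarrow> (\<Sum>b\<in>B. cp S a b) \<le> \<sigma>" "0 \<le> \<sigma>"
  shows "(\<Sum>a\<in>B. via S x u a) \<le> t * cp S x u
    + real (Suc j) ^ Suc j / t ^ j * ((\<Sum>a\<in>B. cp S x a) * \<sigma> ^ j)"
proof -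
  let ?P = "simple_paths S x u" and ?c = "real (Suc j) ^ Suc j / t ^ j"
  let ?L = "{as. set as \<subseteq> B \<and> length as = Suc j}"
  have c: "0 \<le> ?c" using assms(4) by (intro divide_nonneg_nonneg) auto
  have fP: "finite ?P" using finite_simple_paths[OF assms(1)] .
  have fL: "finite ?L" using finite_lists_length_eq[OF assms(2)] .
  have "(\<Sum>a\<in>B. via S x u a) = (\<Sum>xs\<in>?P. PR F (first_path S x u xs) * real (card (set xs \<inter> B)))"
  proof -
    have "(\<Sum>a\<in>B. via S x u a) = (\<Sum>xs\<in>?P. \<Sum>a\<in>B. PR F (first_path S x u xs) * of_bool (a \<in> set xs))"
      unfolding via_def by (rule sum.swap)
    moreover have "(\<Sum>a\<in>B. of_bool (a \<in> set xs)) = real (card (set xs \<inter> B))" for xs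
      using assms(2) by (simp add: Int_def conj_commute)
    ultimately show ?thesis
      by (simp only: sum_distrib_left[symmetric])
  qed
  also have "\<dots> \<le> (\<Sum>xs\<in>?P. PR F (first_path S x u xs) *
      (t + ?c * real (card {as \<in> ?L. subseq as xs})))"
  proof (intro sum_mono mult_left_mono PR_nonneg)
    fix xs assume "xs \<in> ?P"
    then have "distinct xs" by (simp add: simple_paths_def)
    have "real (card (set xs \<inter> B)) \<le> t + ?c * real (card (set xs \<inter> B) choose Suc j)"
      by (rule binomial_tail_bound[OF assms(4)])
    also have "\<dots> \<le> t + ?c * real (card {as \<in> ?L. subseq as xs})"
      using binomial_le_card_subseq[OF \<open>distinct xs\<close> assms(2), of "Suc j"] c
      by (intro add_left_mono mult_left_mono) (auto simp: conj_assoc)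
    finally show "real (card (set xs \<inter> B)) \<le> t + ?c * real (card {as \<in> ?L. subseq as xs})" .
  qed
  also have "\<dots> = t * (\<Sum>xs\<in>?P. PR F (first_path S x u xs))
      + ?c * (\<Sum>xs\<in>?P. PR F (first_path S x u xs) * real (card {as \<in> ?L. subseq as xs}))"
    unfolding sum_distrib_left sum.distrib[symmetric] by (rule sum.cong) (simp_all add: algebra_simps)
  finally have via_le: "(\<Sum>a\<in>B. via S x u a) \<le> t * cp S x u
      + ?c * (\<Sum>xs\<in>?P. PR F (first_path S x u xs) * real (card {as \<in> ?L. subseq as xs}))"
    unfolding sum_first_path_eq[OF assms(1)] .
  have "(\<Sum>xs\<in>?P. PR F (first_path S x u xs) * real (card {as \<in> ?L. subseq as xs}))
      = (\<Sum>as\<in>?L. \<Sum>xs\<in>{xs \<in> ?P. subseq as xs}. PR F (first_path S x u xs))"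
  proof -
    have "(\<Sum>xs\<in>?P. PR F (first_path S x u xs) * real (card {as \<in> ?L. subseq as xs}))
        = (\<Sum>xs\<in>?P. \<Sum>as\<in>{as \<in> ?L. subseq as xs}. PR F (first_path S x u xs))"
      by (simp add: mult.commute)
    also have "\<dots> = (\<Sum>as\<in>?L. \<Sum>xs\<in>{xs \<in> ?P. subseq as xs}. PR F (first_path S x u xs))"
      using fP fL by (rule sum.swap_restrict)
    finally show ?thesis .
  qed
  \<comment> \<open>For a fixed tuple the first-path events are mutually exclusive and all imply the
    same disjoint occurrence, so summing over the paths costs no multiplicity.\<close>
  also have "\<dots> \<le> (\<Sum>as\<in>?L. PR F (disj_occ (\<lambda>\<omega>. conn \<omega> S x (hd as)) (chain S as)))"
  proof (rule sum_mono, rule sum_PR_le)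
    fix as xs ys \<omega>
    assume as: "as \<in> ?L" and xs: "xs \<in> {xs \<in> ?P. subseq as xs}" and f: "first_path S x u xs \<omega>"
    then have "disj_occ (\<lambda>\<omega>. conn \<omega> S (hd xs) (hd as)) (chain S as) (path_edges xs)"
      by (intro subseq_chain) (auto simp: simple_paths_def)
    then show "disj_occ (\<lambda>\<omega>. conn \<omega> S x (hd as)) (chain S as) \<omega>"
      using f xs incr_eventD[OF incr_event_disj_occ, of _ _ "path_edges xs" \<omega>]
      by (auto simp: first_path_def simple_paths_def)
  next
    fix as xs ys \<omega>
    assume "xs \<in> {xs \<in> ?P. subseq as xs}" "ys \<in> {xs \<in> ?P. subseq as xs}"
      "first_path S x u xs \<omega>" "first_path S x u ys \<omega>"
    then show "xs = ys" using first_path_unique[OF assms(1)] by blast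
  qed (use fP in auto)
  also have "\<dots> \<le> (\<Sum>as\<in>?L. cp S x (hd as) * PR F (chain S as))"
    unfolding cp_def by (intro sum_mono van_den_berg_kesten finite_F incr_conn incr_chain)
  also have "\<dots> \<le> (\<Sum>a\<in>B. cp S x a) * \<sigma> ^ j"
    using assms cp_nonneg by (intro sum_chain_le) auto
  finally have "?c * (\<Sum>xs\<in>?P. PR F (first_path S x u xs) * real (card {as \<in> ?L. subseq as xs}))
      \<le> ?c * ((\<Sum>a\<in>B. cp S x a) * \<sigma> ^ j)"
    using c by (rule mult_left_mono)
  then show ?thesis using via_le by linarith
qed

text \<open>For each \<open>u\<close>, finite energy in \<open>D u\<close> produces a pivotal exit
  edge starting in \<open>D u\<close>. Exchanging the sums counts an edge at most \<open>m\<close>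
  times, and at most one edge per configuration is a pivotal exit on the way to
  \<open>x\<close>.\<close>

lemma sum_disjoint_clusters_le:
  assumes "finite U" "S \<subseteq> V"
    and D: "\<And>u. u \<in> U \<Longrightarrow> D u \<subseteq> V \<and> u \<in> D u \<and> y u \<in> D u \<and> x \<notin> D u \<and> \<not> D u \<subseteq> S \<and>
      through_paths F (D u) \<and> card {e \<in> F. e \<inter> D u \<noteq> {}} \<le> n"
    and m: "\<And>a. card {u \<in> U. a \<in> D u} \<le> m"
  shows "rho ^ n * (\<Sum>u\<in>U. sep S o' u (y u) x)
    \<le> real m * cp V o' x"
proof -
  let ?X = "exit_pivotal V S o' x"
  have "rho ^ n * (\<Sum>u\<in>U. sep S o' u (y u) x)
      \<le> (\<Sum>u\<in>U. \<Sum>ab\<in>{ab \<in> V \<times> V. fst ab \<in> D u}. PR F (?X ab))"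
    unfolding sum_distrib_left
  proof (rule sum_mono)
    fix u assume u: "u \<in> U"
    note Du = D[OF u]
    obtain v where v: "v \<in> D u" "v \<notin> S" using Du by auto
    have "rho ^ n * sep S o' u (y u) x
        \<le> PR F (\<lambda>\<omega>. \<exists>ab\<in>{ab \<in> V \<times> V. fst ab \<in> D u}. ?X ab \<omega>)"
      unfolding sep_def
    proof (rule PR_local_modification[OF finite_F, where H = "{e \<in> F. e \<inter> D u \<noteq> {}}"])
      fix \<omega> assume "\<omega> \<subseteq> F" "conn \<omega> S o' u \<and> conn \<omega> V (y u) x \<and> \<not> conn \<omega> V o' (y u)"
      then obtain \<omega>' a b where "\<omega>' \<subseteq> F" "\<omega>' - {e \<in> F. e \<inter> D u \<noteq> {}} = \<omega> - {e \<in> F. e \<inter> D u \<noteq> {}}"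
        "a \<in> D u" "b \<in> D u" "?X (a, b) \<omega>'"
        using reroute_through_exit[of \<omega> F S V "D u" v u "y u" x o'] assms(2) Du v by blast
      then show "\<exists>\<omega>'\<subseteq>F. \<omega>' - {e \<in> F. e \<inter> D u \<noteq> {}} = \<omega> - {e \<in> F. e \<inter> D u \<noteq> {}} \<and>
          (\<exists>ab\<in>{ab \<in> V \<times> V. fst ab \<in> D u}. ?X ab \<omega>')"
        using Du by (intro exI[of _ \<omega>'] conjI bexI[of _ "(a, b)"]) auto
    qed (use Du in auto)
    also have "\<dots> \<le> (\<Sum>ab\<in>{ab \<in> V \<times> V. fst ab \<in> D u}. PR F (?X ab))"
      using finite_V by (intro PR_le_sum) auto
    finally show "rho ^ n * sep S o' u (y u) x
        \<le> (\<Sum>ab\<in>{ab \<in> V \<times> V. fst ab \<in> D u}. PR F (?X ab))" .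
  qed
  also have "\<dots> = (\<Sum>ab\<in>V \<times> V. \<Sum>u\<in>{u \<in> U. fst ab \<in> D u}. PR F (?X ab))"
    using assms(1) finite_V by (intro sum.swap_restrict) auto
  also have "\<dots> \<le> (\<Sum>ab\<in>V \<times> V. real m * PR F (?X ab))"
    using m PR_nonneg by (intro sum_mono) (auto intro!: mult_right_mono)
  also have "\<dots> = real m * (\<Sum>ab\<in>V \<times> V. PR F (?X ab))"
    by (simp add: sum_distrib_left)
  also have "\<dots> \<le> real m * cp V o' x"
    unfolding cp_def
  proof (intro mult_left_mono sum_PR_le)
    fix ab cd \<omega> assume "?X ab \<omega>" "?X cd \<omega>"
    then show "ab = cd" using exit_pivotal_unique[OF _ _ assms(2)] by (cases ab, cases cd) blast
  qed (use finite_V in \<open>auto simp: exit_pivotal_def\<close>)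
  finally show ?thesis .
qed

end

section \<open>Boxes in the integer lattice\<close>

lemma linf_norm_le_iff: "linf_norm (x :: int ^ 'd) \<le> r \<longleftrightarrow> (\<forall>i. \<bar>x $ i\<bar> \<le> r)"
  unfolding linf_norm_def by (subst Max_le_iff) auto

lemma linf_norm_nonneg: "0 \<le> linf_norm (x :: int ^ 'd)"
  using linf_norm_le_iff[of x "linf_norm x"] by (meson abs_ge_zero order_refl order_trans)

lemma linf_norm_minus: "linf_norm (- x :: int ^ 'd) = linf_norm x"
  by (simp add: linf_norm_def)

lemma linf_norm_minus_commute: "linf_norm (x - y :: int ^ 'd) = linf_norm (y - x)"
  using linf_norm_minus[of "x - y"] by simp

lemma linf_norm_triangle: "linf_norm (x + y :: int ^ 'd) \<le> linf_norm x + linf_norm y"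
  unfolding linf_norm_le_iff
proof
  fix i
  have "\<bar>x $ i\<bar> \<le> linf_norm x" "\<bar>y $ i\<bar> \<le> linf_norm y"
    using linf_norm_le_iff by blast+
  then show "\<bar>(x + y) $ i\<bar> \<le> linf_norm x + linf_norm y" by simp
qed

lemma linf_norm_zero [simp]: "linf_norm (0 :: int ^ 'd) = 0"
  by (simp add: linf_norm_def)

lemma linf_norm_le_l1_norm: "linf_norm (x :: int ^ 'd) \<le> l1_norm x"
  unfolding linf_norm_le_iff l1_norm_def by (auto intro: member_le_sum)

definition cube :: "int ^ 'd \<Rightarrow> nat \<Rightarrow> (int ^ 'd) set" where
  "cube u r = {z. linf_norm (z - u) \<le> int r}"

text \<open>With separate bounds in each coordinate, the half boxes, slices and columns used to lead
  paths are boxes too, obtained by updating the bounds at one coordinate.\<close>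

definition bx :: "('d \<Rightarrow> int) \<Rightarrow> ('d \<Rightarrow> int) \<Rightarrow> (int ^ 'd) set" where
  "bx lo hi = {z. \<forall>k. lo k \<le> z $ k \<and> z $ k \<le> hi k}"

lemma bx_mono:
  assumes "\<And>k. lo k \<le> lo' k" "\<And>k. hi' k \<le> hi k"
  shows "bx lo' hi' \<subseteq> bx lo hi"
  using assms unfolding bx_def by (blast intro: order_trans)

lemma bx_upd_hi: "z \<in> bx lo (hi(i := c)) \<Longrightarrow> z $ i \<le> c"
  and bx_upd_lo: "z \<in> bx (lo(i := c)) hi \<Longrightarrow> c \<le> z $ i"
  unfolding bx_def by (metis (mono_tags) fun_upd_same mem_Collect_eq)+

lemma bx_slice: "z \<in> bx (lo(i := c)) (hi(i := c)) \<Longrightarrow> z $ i = c"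
  by (rule antisym[OF bx_upd_hi bx_upd_lo])

lemma bx_col:
  assumes "z \<in> bx ((($) w)(i := a)) ((($) w)(i := b))"
  shows "a \<le> z $ i" "z $ i \<le> b" "k \<noteq> i \<Longrightarrow> z $ k = w $ k"
proof -
  have *: "((($) w)(i := a)) m \<le> z $ m \<and> z $ m \<le> ((($) w)(i := b)) m" for m
    using assms unfolding bx_def by blast
  show "a \<le> z $ i" "z $ i \<le> b" using *[of i] by auto
  show "z $ k = w $ k" if "k \<noteq> i" using *[of k] that by auto
qed

lemma bx_slice_subset: "lo i \<le> c \<Longrightarrow> c \<le> hi i \<Longrightarrow> bx (lo(i := c)) (hi(i := c)) \<subseteq> bx lo hi"
  by (intro bx_mono) auto

lemma bx_col_subset:
  assumes "\<And>k. k \<noteq> i \<Longrightarrow> lo k \<le> w $ k \<and> w $ k \<le> hi k" "lo i \<le> a" "b \<le> hi i"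
  shows "bx ((($) w)(i := a)) ((($) w)(i := b)) \<subseteq> bx lo hi"
  using assms by (intro bx_mono) auto

lemma cube_eq_bx: "cube u r = bx (\<lambda>k. u $ k - int r) (\<lambda>k. u $ k + int r)"
  unfolding cube_def bx_def linf_norm_le_iff by (auto simp: abs_le_iff algebra_simps)

lemma mem_cube_self [simp]: "u \<in> cube u r"
  by (simp add: cube_def)

lemma mem_cube_commute: "v \<in> cube u r \<longleftrightarrow> u \<in> cube v r"
  by (simp add: cube_def linf_norm_minus_commute)

lemma cube_mono: "r \<le> r' \<Longrightarrow> cube u r \<subseteq> cube u r'"
  by (auto simp: cube_def)

lemma cube_trans: "v \<in> cube u r \<Longrightarrow> w \<in> cube v r' \<Longrightarrow> w \<in> cube u (r + r')"
  using linf_norm_triangle[of "w - v" "v - u"] by (auto simp: cube_def)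

lemma finite_card_cube:
  fixes u :: "int ^ 'd"
  shows "finite (cube u r) \<and> card (cube u r) = (2 * r + 1) ^ CARD('d)"
proof -
  let ?P = "PiE (UNIV :: 'd set) (\<lambda>k. {u $ k - int r .. u $ k + int r})"
  have eq: "cube u r = vec_lambda ` ?P"
  proof (rule set_eqI, rule iffI)
    fix z assume "z \<in> cube u r"
    then have "($) z \<in> ?P" by (auto simp: cube_eq_bx bx_def)
    then show "z \<in> vec_lambda ` ?P" by (intro image_eqI[of _ _ "($) z"]) simp_all
  qed (auto simp: cube_eq_bx bx_def PiE_def)
  have inj: "inj_on vec_lambda ?P"
    by (auto simp: inj_on_def vec_lambda_inject)
  have "finite ?P" by (intro finite_PiE) auto
  moreover have "card ?P = (2 * r + 1) ^ CARD('d)"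
    by (subst card_PiE) (auto simp: nat_add_distrib nat_mult_distrib)
  ultimately show ?thesis unfolding eq using card_image[OF inj] by auto
qed

lemma finite_cube [simp]: "finite (cube u r)"
  and card_cube: "card (cube (u :: int ^ 'd) r) = (2 * r + 1) ^ CARD('d)"
  using finite_card_cube by blast+

section \<open>Simple paths through a prescribed vertex of a box\<close>

lemma nn_edge_axis:
  fixes z :: "int ^ 'd"
  assumes "\<bar>c\<bar> = 1"
  shows "{z, z + axis i c} \<in> nearest_neighbour_edges"
proof -
  have "l1_norm (z - (z + axis i c)) = (\<Sum>k\<in>UNIV. if k = i then \<bar>c\<bar> else 0)"
    unfolding l1_norm_def by (rule sum.cong) (auto simp: axis_def)
  then have "l1_norm (z - (z + axis i c)) = 1" using assms by simp
  then show ?thesis unfolding nearest_neighbour_edges_def by (intro CollectI exI conjI) (rule refl)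
qed

lemma nn_edge_axis': "\<bar>c\<bar> = 1 \<Longrightarrow> {z + axis i c, z} \<in> nearest_neighbour_edges"
  using nn_edge_axis[of c z i] by (simp add: insert_commute)

lemma conn_Un_trans: "conn \<omega> A x y \<Longrightarrow> conn \<omega> B y z \<Longrightarrow> conn \<omega> (A \<union> B) x z"
  by (rule conn_trans[of _ _ _ y]; erule conn_mono) auto

lemma bx_connected:
  fixes s t :: "int ^ 'd"
  assumes "s \<in> bx lo hi" "t \<in> bx lo hi"
  shows "conn nearest_neighbour_edges (bx lo hi) s t"
  using assms(1)
proof (induction "nat (l1_norm (s - t))" arbitrary: s rule: less_induct)
  case less
  show ?case
  proof (cases "s = t")
    case True
    then show ?thesis using assms by (simp add: conn_refl)
  next
    case False
    then obtain i where i: "s $ i \<noteq> t $ i" by (auto simp: vec_eq_iff)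
    define c :: int where "c = (if s $ i < t $ i then 1 else - 1)"
    define s' where "s' = s + axis i c"
    have c: "\<bar>c\<bar> = 1" by (simp add: c_def)
    have s': "s' \<in> bx lo hi"
      unfolding bx_def
    proof (rule CollectI, rule allI)
      fix k
      have "lo k \<le> s $ k" "s $ k \<le> hi k" "lo k \<le> t $ k" "t $ k \<le> hi k"
        using less.prems assms(2) by (auto simp: bx_def)
      then show "lo k \<le> s' $ k \<and> s' $ k \<le> hi k"
        using i by (cases "k = i") (auto simp: s'_def c_def axis_def)
    qed
    have "l1_norm (s' - t) < l1_norm (s - t)"
      unfolding l1_norm_def
    proof (rule sum_strict_mono_ex1)
      show "\<forall>k\<in>UNIV. \<bar>(s' - t) $ k\<bar> \<le> \<bar>(s - t) $ k\<bar>"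
        using i by (auto simp: s'_def c_def axis_def)
      show "\<exists>k\<in>UNIV. \<bar>(s' - t) $ k\<bar> < \<bar>(s - t) $ k\<bar>"
        using i by (intro bexI[of _ i]) (auto simp: s'_def c_def axis_def)
    qed simp
    then have "nat (l1_norm (s' - t)) < nat (l1_norm (s - t))"
      unfolding l1_norm_def by (smt (verit) nat_less_eq_zless sum_nonneg abs_ge_zero)
    then have "conn nearest_neighbour_edges (bx lo hi) s' t" using less.hyps s' by simp
    moreover have "conn nearest_neighbour_edges (bx lo hi) s s'"
      using less.prems s' nn_edge_axis[OF c] unfolding s'_def by (intro conn_edge) auto
    ultimately show ?thesis using conn_trans by metis
  qed
qed

definition simple_through :: "(int ^ 'd) set \<Rightarrow> int ^ 'd \<Rightarrow> int ^ 'd \<Rightarrow> int ^ 'd \<Rightarrow> bool" where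
  "simple_through D s t v \<longleftrightarrow>
     (\<exists>xs. path_in nearest_neighbour_edges D s t xs \<and> distinct xs \<and> v \<in> set xs)"

text \<open>Paths in the disjoint sets \<open>A\<close> and \<open>B\<close> cannot meet, so their
  union with the joining edge is simple; \<open>v\<close> is met because it is an endpoint of that
  edge.\<close>

lemma simple_through_join:
  assumes "conn nearest_neighbour_edges A s a" "conn nearest_neighbour_edges B b t"
    and "{a, b} \<in> nearest_neighbour_edges" "A \<inter> B = {}" "A \<subseteq> D" "B \<subseteq> D" "v = a \<or> v = b"
  shows "simple_through D s t v"
proof -
  obtain xs where xs: "path_in nearest_neighbour_edges A s a xs" "distinct xs"
    using conn_distinct_path[OF assms(1)] by blast
  obtain ys where ys: "path_in nearest_neighbour_edges B b t ys" "distinct ys"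
    using conn_distinct_path[OF assms(2)] by blast
  have "path_in nearest_neighbour_edges D s a xs" "path_in nearest_neighbour_edges D b t ys"
    using xs ys assms by (auto simp: path_in_def)
  then have "path_in nearest_neighbour_edges D s t (xs @ ys)" using path_in_join assms(3) by metis
  moreover have "distinct (xs @ ys)" using xs ys assms(4) by (auto simp: path_in_def)
  moreover have "a \<in> set xs" "b \<in> set ys"
    using xs ys unfolding path_in_def by (metis last_in_set, metis hd_in_set)
  ultimately show ?thesis using assms(7) unfolding simple_through_def by auto
qed

lemma simple_through_rev: "simple_through D s t v \<Longrightarrow> simple_through D t s v"
  unfolding simple_through_def path_in_def
  by (metis distinct_rev hd_rev last_rev path_edges_rev rev_is_Nil_conv set_rev)

text \<open>If \<open>v\<close> is no higher than \<open>t\<close> along axis \<open>i\<close>, a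
  hyperplane next to \<open>v\<close> cuts the box into two connected halves separating
  \<open>s\<close> from \<open>t\<close>. If \<open>v\<close> is higher, the path climbs a column
  from the height of \<open>s\<close> and comes down the column over \<open>t\<close>.\<close>

lemma simple_through_bx_aux:
  fixes s t v :: "int ^ 'd"
  assumes "s \<in> bx lo hi" "t \<in> bx lo hi" "v \<in> bx lo hi"
    and "s $ i < t $ i" "s $ i \<le> v $ i" "j \<noteq> i" "lo j < hi j"
  shows "simple_through (bx lo hi) s t v"
proof -
  let ?N = "nearest_neighbour_edges :: (int ^ 'd) set set"
  let ?col = "\<lambda>z a b. bx ((($) z)(i := a)) ((($) z)(i := b))"
  let ?slice = "\<lambda>a. bx (lo(i := a)) (hi(i := a))"
  consider (lt) "v $ i < t $ i" | (eq) "v $ i = t $ i"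
    | (gt) k where "t $ i < v $ i" "k \<noteq> i" "v $ k \<noteq> t $ k"
    | (above) "t $ i < v $ i" "\<And>k. k \<noteq> i \<Longrightarrow> v $ k = t $ k"
    by force
  then show ?thesis
  proof cases
    case lt
    have "v $ i + 1 \<le> hi i" using lt assms(2) unfolding bx_def by (smt (verit) mem_Collect_eq)
    show ?thesis
    proof (rule simple_through_join[where a = v and b = "v + axis i 1"])
      show "conn ?N (bx lo (hi(i := v $ i))) s v"
        using assms by (intro bx_connected) (auto simp: bx_def)
      show "conn ?N (bx (lo(i := v $ i + 1)) hi) (v + axis i 1) t"
        using assms lt \<open>v $ i + 1 \<le> hi i\<close> by (intro bx_connected) (auto simp: bx_def axis_def)
      show "bx lo (hi(i := v $ i)) \<subseteq> bx lo hi"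
        using assms(3) by (auto simp: bx_def split: if_splits intro: order_trans)
      show "bx (lo(i := v $ i + 1)) hi \<subseteq> bx lo hi"
        using assms(3) by (intro bx_mono) (auto simp: bx_def intro: add_increasing2)
      show "bx lo (hi(i := v $ i)) \<inter> bx (lo(i := v $ i + 1)) hi = {}"
        by (force dest: bx_upd_hi bx_upd_lo)
    qed (auto intro: nn_edge_axis)
  next
    case eq
    have "lo i < t $ i" using assms(1,4) unfolding bx_def by (auto intro: le_less_trans)
    show ?thesis
    proof (rule simple_through_join[where a = "v + axis i (- 1)" and b = v])
      show "conn ?N (bx lo (hi(i := v $ i - 1))) s (v + axis i (- 1))"
        using assms eq \<open>lo i < t $ i\<close>
        by (intro bx_connected) (auto simp: bx_def axis_def intro: order_trans[of _ "t $ i"])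
      show "conn ?N (bx (lo(i := v $ i)) hi) v t"
        using assms eq by (intro bx_connected) (auto simp: bx_def)
      show "bx lo (hi(i := v $ i - 1)) \<subseteq> bx lo hi"
        using assms(3) by (intro bx_mono) (auto simp: bx_def intro: order_trans[of _ "v $ i"])
      show "bx (lo(i := v $ i)) hi \<subseteq> bx lo hi"
        using assms(3) by (auto simp: bx_def split: if_splits intro: order_trans)
      show "bx lo (hi(i := v $ i - 1)) \<inter> bx (lo(i := v $ i)) hi = {}"
        by (force dest: bx_upd_hi bx_upd_lo)
    qed (auto intro: nn_edge_axis')
  next
    case gt
    \<comment> \<open>\<open>?v0\<close> is the foot of the column of \<open>v\<close> at the height
      of \<open>s\<close>, and \<open>?t0\<close> the point over \<open>t\<close> at the height of
      \<open>v\<close>. The columns are disjoint because \<open>v\<close> and \<open>t\<close>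
      differ in coordinate \<open>k\<close>.\<close>
    let ?v0 = "\<chi> k. if k = i then s $ i else v $ k" and ?t0 = "\<chi> k. if k = i then v $ i else t $ k"
    show ?thesis
    proof (rule simple_through_join[where a = "v + axis i (- 1)" and b = v])
      let ?A = "?slice (s $ i) \<union> ?col v (s $ i) (v $ i - 1)"
      let ?B = "?slice (v $ i) \<union> ?col t (t $ i) (v $ i)"
      have cs: "conn ?N (?slice (s $ i)) s ?v0" "conn ?N (?col v (s $ i) (v $ i - 1)) ?v0 (v + axis i (- 1))"
        "conn ?N (?slice (v $ i)) v ?t0" "conn ?N (?col t (t $ i) (v $ i)) ?t0 t"
        using assms gt(1) by (intro bx_connected; auto simp: bx_def axis_def)+
      show "conn ?N ?A s (v + axis i (- 1))" "conn ?N ?B v t"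
        using conn_Un_trans[OF cs(1,2)] conn_Un_trans[OF cs(3,4)] .
      have b: "lo m \<le> s $ m" "s $ m \<le> hi m" "lo m \<le> t $ m" "t $ m \<le> hi m" "lo m \<le> v $ m" "v $ m \<le> hi m" for m
        using assms by (auto simp: bx_def)
      have "v $ i - 1 \<le> hi i" using b(6)[of i] by linarith
      then show "?A \<subseteq> bx lo hi" "?B \<subseteq> bx lo hi"
        using b by (intro Un_least bx_slice_subset bx_col_subset; simp)+
      have "z $ i = s $ i \<or> z $ i < v $ i \<and> z $ k = v $ k" if "z \<in> ?A" for z
        using that
      proof
        assume z: "z \<in> ?col v (s $ i) (v $ i - 1)"
        show ?thesis using bx_col(2)[OF z] bx_col(3)[OF z gt(2)] by simp
      qed (simp add: bx_slice)
      moreover have "z $ i = v $ i \<or> t $ i \<le> z $ i \<and> z $ k = t $ k" if "z \<in> ?B" for z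
        using that
      proof
        assume z: "z \<in> ?col t (t $ i) (v $ i)"
        show ?thesis using bx_col(1)[OF z] bx_col(3)[OF z gt(2)] by simp
      qed (simp add: bx_slice)
      ultimately have False if "z \<in> ?A" "z \<in> ?B" for z
        using that assms(4,5) gt by force
      then show "?A \<inter> ?B = {}" by blast
    qed (auto intro: nn_edge_axis')
  next
    case above
    \<comment> \<open>Now \<open>v\<close> lies straight above \<open>t\<close>, so the ascent takes
      the neighbouring column in direction \<open>j\<close>, on the side that stays in the
      box.\<close>
    define c :: int where "c = (if t $ j < hi j then 1 else - 1)"
    have c: "\<bar>c\<bar> = 1" "lo j \<le> t $ j + c" "t $ j + c \<le> hi j"
    proof -
      have "lo j \<le> t $ j" "t $ j \<le> hi j" using assms(2) by (auto simp: bx_def)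
      then show "\<bar>c\<bar> = 1" "lo j \<le> t $ j + c" "t $ j + c \<le> hi j"
        using assms(7) by (auto simp: c_def)
    qed
    define q where "q = v + axis j c"
    let ?q0 = "\<chi> k. if k = i then s $ i else q $ k"
    have q: "q $ j = t $ j + c" "q $ i = v $ i" "\<And>k. k \<noteq> j \<Longrightarrow> q $ k = v $ k"
      using above(2)[of j] assms(6) by (auto simp: q_def axis_def)
    show ?thesis
    proof (rule simple_through_join[where a = q and b = v])
      let ?A = "?slice (s $ i) \<union> ?col q (s $ i) (v $ i)"
      let ?B = "?col t (t $ i) (v $ i)"
      have q0: "?q0 \<in> ?slice (s $ i)"
        using assms above c q by (auto simp: bx_def; metis)
      have "conn ?N (?slice (s $ i)) s ?q0"
        using assms by (intro bx_connected q0) (auto simp: bx_def)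
      moreover have "conn ?N (?col q (s $ i) (v $ i)) ?q0 q"
        using assms q by (intro bx_connected) (auto simp: bx_def)
      ultimately show "conn ?N ?A s q" by (rule conn_Un_trans)
      show "conn ?N ?B v t"
        using assms above by (intro bx_connected) (auto simp: bx_def)
      have b: "lo m \<le> s $ m" "s $ m \<le> hi m" "lo m \<le> t $ m" "t $ m \<le> hi m" "lo m \<le> v $ m" "v $ m \<le> hi m" for m
        using assms by (auto simp: bx_def)
      then show "?B \<subseteq> bx lo hi"
        by (intro bx_col_subset) simp_all
      have "lo k \<le> q $ k" "q $ k \<le> hi k" for k
        using q c assms(3) by (cases "k = j"; auto simp: bx_def)+
      with b show "?A \<subseteq> bx lo hi"
        by (intro Un_least bx_slice_subset bx_col_subset) simp_all
      have "z $ i = s $ i \<or> z $ j = q $ j" if "z \<in> ?A" for z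
        using that
      proof
        assume z: "z \<in> ?col q (s $ i) (v $ i)"
        show ?thesis using bx_col(3)[OF z assms(6)] by simp
      qed (simp add: bx_slice)
      moreover have "t $ i \<le> z $ i \<and> z $ j = t $ j" if "z \<in> ?B" for z
        using bx_col(1)[OF that] bx_col(3)[OF that assms(6)] by simp
      ultimately have False if "z \<in> ?A" "z \<in> ?B" for z
        using that assms(4) q(1) c(1) by force
      then show "?A \<inter> ?B = {}" by blast
    qed (auto simp: q_def intro!: nn_edge_axis' c)
  qed
qed

lemma path_edges_map: "path_edges (map f xs) = (`) f ` path_edges xs"
  by (induction xs rule: path_edges.induct) auto

lemma nn_edge_uminus:
  "e \<in> nearest_neighbour_edges \<Longrightarrow> uminus ` e \<in> (nearest_neighbour_edges :: (int ^ 'd) set set)"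
proof -
  assume "e \<in> nearest_neighbour_edges"
  then obtain x y :: "int ^ 'd" where e: "e = {x, y}" "l1_norm (x - y) = 1"
    by (auto simp: nearest_neighbour_edges_def)
  have "l1_norm (- x - - y) = l1_norm (x - y)"
    unfolding l1_norm_def by (rule sum.cong) auto
  then have "l1_norm (- x - - y) = 1" using e by simp
  moreover have "uminus ` e = {- x, - y}" using e by simp
  ultimately show ?thesis unfolding nearest_neighbour_edges_def by blast
qed

lemma simple_through_uminus:
  assumes "simple_through (bx lo hi) s t v"
  shows "simple_through (bx (- hi) (- lo)) (- s) (- t) (- v)"
proof -
  obtain xs where xs: "path_in nearest_neighbour_edges (bx lo hi) s t xs" "distinct xs" "v \<in> set xs"
    using assms by (auto simp: simple_through_def)
  have "path_in nearest_neighbour_edges (bx (- hi) (- lo)) (- s) (- t) (map uminus xs)"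
    using xs(1) by (auto simp: path_in_def hd_map last_map path_edges_map bx_def intro!: nn_edge_uminus)
  then show ?thesis
    using xs by (auto simp: simple_through_def distinct_map intro!: exI[of _ "map uminus xs"])
qed

text \<open>Choose an axis along which \<open>s\<close> and \<open>t\<close> differ and order them
  along it. If \<open>v\<close> lies below both, reflecting the box and exchanging the endpoints
  puts it above both.\<close>

lemma simple_through_bx:
  fixes s t v :: "int ^ 'd"
  assumes "s \<in> bx lo hi" "t \<in> bx lo hi" "v \<in> bx lo hi" "s \<noteq> t"
    and "\<And>k. lo k < hi k" "CARD('d) > 1"
  shows "simple_through (bx lo hi) s t v"
proof -
  have main: "simple_through (bx lo hi) s t v"
    if a: "s \<in> bx lo hi" "t \<in> bx lo hi" "s $ i < t $ i" for s t i
  proof -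
    obtain j where j: "j \<noteq> i"
    proof -
      have "(UNIV :: 'd set) \<noteq> {i}" using assms(6) by (metis card_1_singleton_iff less_irrefl One_nat_def)
      then show ?thesis using that by blast
    qed
    show ?thesis
    proof (cases "s $ i \<le> v $ i")
      case True
      then show ?thesis using simple_through_bx_aux assms(3,5) a j by blast
    next
      case False
      have m: "- z \<in> bx (- hi) (- lo)" if "z \<in> bx lo hi" for z :: "int ^ 'd"
        using that by (auto simp: bx_def)
      have "simple_through (bx (- hi) (- lo)) (- t) (- s) (- v)"
        using False a assms(3,5) j by (intro simple_through_bx_aux[of _ _ _ _ _ i j] m) auto
      then have "simple_through (bx (- (- lo)) (- (- hi))) (- (- t)) (- (- s)) (- (- v))"
        by (rule simple_through_uminus)
      then show ?thesis by (simp add: fun_Compl_def simple_through_rev)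
    qed
  qed
  obtain i where "s $ i \<noteq> t $ i" using assms(4) by (auto simp: vec_eq_iff)
  then consider "s $ i < t $ i" | "t $ i < s $ i" by linarith
  then show ?thesis
    using main[of s t i] main[of t s i] assms(1,2) simple_through_rev by cases blast+
qed

lemma through_paths_cube:
  fixes u :: "int ^ 'd"
  assumes "CARD('d) > 1" "0 < r" "{e \<in> nearest_neighbour_edges. e \<subseteq> cube u r} \<subseteq> F"
  shows "through_paths F (cube u r)"
  unfolding through_paths_def
proof (intro ballI impI)
  fix s t v assume "s \<in> cube u r" "t \<in> cube u r" "v \<in> cube u r" "s \<noteq> t"
  then have "simple_through (cube u r) s t v"
    unfolding cube_eq_bx using assms by (intro simple_through_bx) auto
  then obtain xs where xs: "path_in nearest_neighbour_edges (cube u r) s t xs" "distinct xs" "v \<in> set xs"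
    by (auto simp: simple_through_def)
  then have "path_in F (cube u r) s t xs"
    using assms(3) path_edges_subset[of _ xs] unfolding path_in_def by blast
  then show "\<exists>xs. path_in F (cube u r) s t xs \<and> distinct xs \<and> v \<in> set xs"
    using xs by blast
qed

section \<open>Lattice sums\<close>

definition sz :: "int ^ 'd \<Rightarrow> real" where
  "sz z = real_of_int (max 1 (linf_norm z))"

lemma sz_ge_1: "1 \<le> sz z"
  by (simp add: sz_def)

lemma sz_pos: "0 < sz z"
  using sz_ge_1[of z] by linarith

lemma abs_sz [simp]: "\<bar>sz z\<bar> = sz z"
  using sz_pos[of z] by simp

lemma sz_commute: "sz (x - y) = sz (y - x)"
  by (simp add: sz_def linf_norm_minus_commute)

lemma sz_triangle: "sz (x - z) \<le> sz (x - y) + sz (y - z)"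
  using linf_norm_triangle[of "x - y" "y - z"] by (simp add: sz_def)

lemma sz_le_iff: "1 \<le> r \<Longrightarrow> sz z \<le> real r \<longleftrightarrow> z \<in> cube 0 r"
  by (auto simp: sz_def cube_def)

text \<open>A shell of radius \<open>j\<close> has \<open>(2 * j + 1) ^ n - (2 * j - 1) ^ n\<close>
  points, a difference of powers with gap 2, hence at most
  \<open>2 * n * (3 * j) ^ (n - 1)\<close>.\<close>

definition shell_const :: "nat \<Rightarrow> real" where
  "shell_const n = 2 * real n * 3 ^ n"

lemma card_shell_le:
  fixes j :: nat
  defines "n \<equiv> CARD('d)"
  shows "real (card {z :: int ^ 'd. nat (linf_norm z) = j}) \<le> shell_const n * real (max 1 j) ^ (n - 1)"
proof (cases "j = 0")
  case True
  have "{z :: int ^ 'd. nat (linf_norm z) = j} \<subseteq> cube 0 0"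
    using True by (auto simp: cube_def)
  then have "card {z :: int ^ 'd. nat (linf_norm z) = j} \<le> 1"
    using card_mono[OF finite_cube, of _ "0 :: int ^ 'd" 0] by (simp add: card_cube)
  moreover have "1 \<le> shell_const n"
  proof -
    have "1 \<le> real n" "1 \<le> (3::real) ^ n" by (auto simp: n_def Suc_le_eq)
    then have "1 * 1 \<le> (2 * real n) * 3 ^ n" by (intro mult_mono) auto
    then show ?thesis by (simp add: shell_const_def)
  qed
  ultimately show ?thesis using True by simp
next
  case False
  let ?x = "2 * real j + 1" and ?y = "2 * real j - 1"
  have n: "0 < n" by (simp add: n_def)
  have eq: "{z :: int ^ 'd. nat (linf_norm z) = j} = cube 0 j - cube 0 (j - 1)"
  proof (rule set_eqI)
    fix z :: "int ^ 'd"
    have "0 \<le> linf_norm z" by (rule linf_norm_nonneg)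
    then show "z \<in> {z. nat (linf_norm z) = j} \<longleftrightarrow> z \<in> cube 0 j - cube 0 (j - 1)"
      using False by (auto simp: cube_def of_nat_diff)
  qed
  have "real (card {z :: int ^ 'd. nat (linf_norm z) = j}) = real ((2 * j + 1) ^ n) - real ((2 * (j - 1) + 1) ^ n)"
    unfolding eq n_def using card_cube[of "0 :: int ^ 'd"]
    by (subst card_Diff_subset) (auto simp: cube_mono of_nat_diff card_mono intro!: of_nat_diff power_mono)
  also have "\<dots> = ?x ^ n - ?y ^ n"
    using False by (simp add: of_nat_diff algebra_simps)
  also have "\<dots> = (?x - ?y) * (\<Sum>i<n. ?y ^ (n - Suc i) * ?x ^ i)"
    by (rule power_diff_sumr2)
  also have "\<dots> \<le> (?x - ?y) * (\<Sum>i<n. ?x ^ (n - 1))"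
  proof (intro mult_left_mono sum_mono)
    fix i assume i: "i \<in> {..<n}"
    have "?y ^ (n - Suc i) * ?x ^ i \<le> ?x ^ (n - Suc i) * ?x ^ i"
      using False by (intro mult_right_mono power_mono) auto
    also have "\<dots> = ?x ^ (n - 1)"
      using i by (simp add: power_add[symmetric])
    finally show "?y ^ (n - Suc i) * ?x ^ i \<le> ?x ^ (n - 1)" .
  qed simp
  also have "\<dots> = 2 * real n * ?x ^ (n - 1)" by simp
  also have "\<dots> \<le> 2 * real n * (3 * real j) ^ (n - 1)"
    using False by (intro mult_left_mono power_mono) auto
  also have "\<dots> \<le> 2 * real n * 3 ^ n * real j ^ (n - 1)"
    by (auto simp: power_mult_distrib mult.assoc intro!: mult_left_mono mult_right_mono power_increasing)
  finally show ?thesis using False by (simp add: shell_const_def max_def)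
qed

lemma shell_const_nonneg: "0 \<le> shell_const n"
  by (simp add: shell_const_def)

text \<open>The values \<open>max 1 j\<close> account for the origin, where \<open>sz\<close> equals
  1.\<close>

lemma sum_shells:
  fixes Z :: "(int ^ 'd) set"
  assumes "finite Z" "\<And>z. z \<in> Z \<Longrightarrow> lo \<le> nat (linf_norm z) \<and> nat (linf_norm z) \<le> hi" "\<And>j. 0 \<le> h j"
  shows "(\<Sum>z\<in>Z. h (sz z)) \<le> (\<Sum>j=lo..hi. shell_const CARD('d) * real (max 1 j) ^ (CARD('d) - 1) * h (real (max 1 j)))"
proof -
  have sz: "sz z = real (max 1 (nat (linf_norm z)))" for z :: "int ^ 'd"
    using linf_norm_nonneg[of z] unfolding sz_def by linarith
  have "(\<Sum>z\<in>Z. h (sz z)) = (\<Sum>j=lo..hi. \<Sum>z\<in>{z \<in> Z. nat (linf_norm z) = j}. h (sz z))"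
    by (rule sum.group[symmetric]) (use assms in auto)
  also have "\<dots> \<le> (\<Sum>j=lo..hi. shell_const CARD('d) * real (max 1 j) ^ (CARD('d) - 1) * h (real (max 1 j)))"
  proof (rule sum_mono)
    fix j assume "j \<in> {lo..hi}"
    have fin: "finite {z :: int ^ 'd. nat (linf_norm z) = j}"
      by (rule finite_subset[OF _ finite_cube[of 0 j]]) (auto simp: cube_def)
    have "(\<Sum>z\<in>{z \<in> Z. nat (linf_norm z) = j}. h (sz z)) = real (card {z \<in> Z. nat (linf_norm z) = j}) * h (real (max 1 j))"
      by (simp add: sz)
    also have "\<dots> \<le> real (card {z :: int ^ 'd. nat (linf_norm z) = j}) * h (real (max 1 j))"
      using fin assms(3) by (intro mult_right_mono) (auto intro!: card_mono)
    also have "\<dots> \<le> shell_const CARD('d) * real (max 1 j) ^ (CARD('d) - 1) * h (real (max 1 j))"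
      using assms(3) by (intro mult_right_mono card_shell_le)
    finally show "(\<Sum>z\<in>{z \<in> Z. nat (linf_norm z) = j}. h (sz z))
      \<le> shell_const CARD('d) * real (max 1 j) ^ (CARD('d) - 1) * h (real (max 1 j))" .
  qed
  finally show ?thesis .
qed

lemma sum_inverse_power_cube_le:
  fixes Z :: "(int ^ 'd) set"
  assumes "finite Z" "Z \<subseteq> cube 0 r" "1 \<le> r" "k < CARD('d)"
  shows "(\<Sum>z\<in>Z. 1 / sz z ^ k) \<le> 2 * shell_const CARD('d) * real r ^ (CARD('d) - k)"
proof -
  define n where "n = CARD('d)"
  \<comment> \<open>The absolute value makes the summand nonnegative at every real argument, as
    \<open>sum_shells\<close> requires.\<close>
  have "(\<Sum>z\<in>Z. 1 / sz z ^ k) \<le> (\<Sum>j=0..r. shell_const n * real (max 1 j) ^ (n - 1) * (1 / \<bar>real (max 1 j)\<bar> ^ k))"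
  proof -
    have "0 \<le> nat (linf_norm z) \<and> nat (linf_norm z) \<le> r" if "z \<in> Z" for z
      using assms(2) that by (auto simp: cube_def)
    then show ?thesis
      using sum_shells[of Z 0 r "\<lambda>t. 1 / \<bar>t\<bar> ^ k"] assms(1) by (simp add: n_def)
  qed
  also have "\<dots> \<le> (\<Sum>j=0..r. shell_const n * real r ^ (n - k - 1))"
  proof (rule sum_mono)
    fix j assume "j \<in> {0..r}"
    let ?m = "real (max 1 j)"
    have "n - 1 = (n - k - 1) + k" using assms(4) by (simp add: n_def)
    then have "?m ^ (n - 1) * (1 / \<bar>?m\<bar> ^ k) = ?m ^ (n - k - 1)"
      by (simp add: power_add)
    also have "\<dots> \<le> real r ^ (n - k - 1)"
      using \<open>j \<in> {0..r}\<close> assms(3) by (intro power_mono) auto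
    finally show "shell_const n * ?m ^ (n - 1) * (1 / \<bar>?m\<bar> ^ k) \<le> shell_const n * real r ^ (n - k - 1)"
      unfolding mult.assoc by (intro mult_left_mono shell_const_nonneg)
  qed
  also have "\<dots> = (real r + 1) * (shell_const n * real r ^ (n - k - 1))" by simp
  also have "\<dots> \<le> (2 * real r) * (shell_const n * real r ^ (n - k - 1))"
    using assms(3) shell_const_nonneg by (intro mult_right_mono) auto
  also have "\<dots> = 2 * shell_const n * real r ^ Suc (n - k - 1)" by simp
  also have "Suc (n - k - 1) = n - k" using assms(4) by (simp add: n_def)
  finally show ?thesis by (simp add: n_def)
qed

lemma sum_inverse_square_tail_le:
  assumes "1 \<le> m"
  shows "(\<Sum>j=Suc m..hi. 1 / real j ^ 2) \<le> 1 / real m"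
proof -
  \<comment> \<open>The maximum with \<open>m\<close> keeps the telescoped bound valid when the
    range is empty.\<close>
  have "(\<Sum>j=Suc m..hi. 1 / real j ^ 2) \<le> 1 / real m - 1 / real (max m hi)"
  proof (induction hi)
    case 0
    then show ?case using assms by simp
  next
    case (Suc hi)
    show ?case
    proof (cases "m \<le> hi")
      case True
      have "1 / real (Suc hi) ^ 2 \<le> 1 / real hi - 1 / real (Suc hi)"
      proof -
        have "0 < real hi" using True assms by simp
        then have "1 / real hi - 1 / real (Suc hi) = 1 / (real hi * real (Suc hi))"
          by (simp add: field_simps)
        also have "\<dots> \<ge> 1 / real (Suc hi) ^ 2"
          unfolding power2_eq_square using \<open>0 < real hi\<close>
          by (intro divide_left_mono mult_right_mono) auto
        finally show ?thesis .
      qed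
      then show ?thesis using Suc True by simp
    qed auto
  qed
  then show ?thesis using assms by (smt (verit) of_nat_0_le_iff zero_le_divide_1_iff)
qed

lemma sum_inverse_power_tail_le:
  fixes Z :: "(int ^ 'd) set"
  assumes "finite Z" "Z \<inter> cube 0 m = {}" "1 \<le> m" "5 \<le> CARD('d)"
  shows "(\<Sum>z\<in>Z. 1 / sz z ^ (2 * (CARD('d) - 2))) \<le> shell_const CARD('d) / real m ^ (CARD('d) - 4)"
proof -
  define n where "n = CARD('d)"
  define hi where "hi = Max (insert 0 ((\<lambda>z. nat (linf_norm z)) ` Z))"
  have hi: "nat (linf_norm z) \<le> hi" if "z \<in> Z" for z
    unfolding hi_def using assms(1) that by (intro Max_ge) auto
  have "(\<Sum>z\<in>Z. 1 / sz z ^ (2 * (n - 2))) \<le> (\<Sum>j=Suc m..hi. shell_const n * real (max 1 j) ^ (n - 1) * (1 / \<bar>real (max 1 j)\<bar> ^ (2 * (n - 2))))"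
  proof -
    have "Suc m \<le> nat (linf_norm z) \<and> nat (linf_norm z) \<le> hi" if "z \<in> Z" for z
    proof -
      have "z \<notin> cube 0 m" using assms(2) that by blast
      then have "int m < linf_norm z" by (simp add: cube_def)
      then show ?thesis using hi[OF that] by simp
    qed
    then show ?thesis
      using sum_shells[of Z "Suc m" hi "\<lambda>t. 1 / \<bar>t\<bar> ^ (2 * (n - 2))"] assms(1) by (simp add: n_def)
  qed
  also have "\<dots> \<le> (\<Sum>j=Suc m..hi. shell_const n / real m ^ (n - 5) * (1 / real j ^ 2))"
  proof (rule sum_mono)
    fix j assume j: "j \<in> {Suc m..hi}"
    \<comment> \<open>The factor \<open>n - 1\<close> cancels the size of the shell,
      \<open>n - 5\<close> powers are estimated by the inner radius, and two are kept for a
      convergent series.\<close>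
    have e: "2 * (n - 2) = (n - 1) + ((n - 5) + 2)" using assms(4) by (simp add: n_def)
    have "real (max 1 j) ^ (n - 1) * (1 / \<bar>real (max 1 j)\<bar> ^ (2 * (n - 2))) = 1 / (real j ^ (n - 5) * real j ^ 2)"
      unfolding e power_add using j by (simp add: max_def)
    also have "\<dots> \<le> 1 / (real m ^ (n - 5) * real j ^ 2)"
      using j assms(3) by (intro divide_left_mono mult_right_mono power_mono) auto
    finally show "shell_const n * real (max 1 j) ^ (n - 1) * (1 / \<bar>real (max 1 j)\<bar> ^ (2 * (n - 2)))
      \<le> shell_const n / real m ^ (n - 5) * (1 / real j ^ 2)"
      using mult_left_mono[OF _ shell_const_nonneg] by (fastforce simp: mult.assoc)
  qed
  also have "\<dots> = shell_const n / real m ^ (n - 5) * (\<Sum>j=Suc m..hi. 1 / real j ^ 2)"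
    by (simp add: sum_distrib_left)
  also have "\<dots> \<le> shell_const n / real m ^ (n - 5) * (1 / real m)"
    using assms(3) shell_const_nonneg by (intro mult_left_mono sum_inverse_square_tail_le) auto
  also have "\<dots> = shell_const n / real m ^ Suc (n - 5)" by simp
  also have "Suc (n - 5) = n - 4" using assms(4) by (simp add: n_def)
  finally show ?thesis by (simp add: n_def)
qed

text \<open>Let \<open>m\<close> be the distance from \<open>a\<close> to \<open>y\<close>. Within
  distance \<open>m\<close> of \<open>y\<close>, the factor at \<open>a\<close> is at most of order
  \<open>m ^ (2 - n)\<close> and the other sums to order \<open>m ^ 2\<close>; beyond, both factors
  are controlled by the distance to \<open>y\<close>. Each part is of order
  \<open>m ^ (4 - n)\<close>.\<close>

lemma sum_convolution_aux:
  fixes W :: "(int ^ 'd) set"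
  assumes "finite W" "6 < CARD('d)" "\<And>w. w \<in> W \<Longrightarrow> sz (w - y) \<le> sz (a - w)"
  shows "(\<Sum>w\<in>W. 1 / sz (a - w) ^ (CARD('d) - 2) * (1 / sz (w - y) ^ (CARD('d) - 2)))
    \<le> 2 ^ CARD('d) * shell_const CARD('d) / sz (a - y) ^ 3"
proof -
  define n where "n = CARD('d)"
  define m where "m = nat (max 1 (linf_norm (a - y)))"
  have m: "1 \<le> m" "sz (a - y) = real m" by (auto simp: m_def sz_def)
  have n: "6 < n" using assms(2) by (simp add: n_def)
  let ?t = "\<lambda>w. 1 / sz (a - w) ^ (n - 2) * (1 / sz (w - y) ^ (n - 2))"
  let ?W1 = "{w \<in> W. w - y \<in> cube 0 m}" and ?W2 = "{w \<in> W. w - y \<notin> cube 0 m}"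
  have inj: "inj_on (\<lambda>w. w - y) X" for X by (auto simp: inj_on_def)
  \<comment> \<open>Dimension above six enters here: the triangle decays at least like the inverse
    cube.\<close>
  have pow: "1 / real m ^ (n - 4) \<le> 1 / real m ^ 3"
    using m(1) n by (intro divide_left_mono power_increasing) auto
  have "(\<Sum>w\<in>?W1. ?t w) \<le> (\<Sum>w\<in>?W1. (2 / real m) ^ (n - 2) * (1 / sz (w - y) ^ (n - 2)))"
  proof (intro sum_mono mult_right_mono)
    fix w assume w: "w \<in> ?W1"
    have "real m / 2 \<le> sz (a - w)"
      using sz_triangle[of a y w] assms(3)[of w] w m(2) by auto
    then have "(real m / 2) ^ (n - 2) \<le> sz (a - w) ^ (n - 2)" by (intro power_mono) auto
    then have "1 / sz (a - w) ^ (n - 2) \<le> 1 / (real m / 2) ^ (n - 2)"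
      using m(1) sz_pos[of "a - w"] by (intro divide_left_mono mult_pos_pos zero_less_power) auto
    then show "1 / sz (a - w) ^ (n - 2) \<le> (2 / real m) ^ (n - 2)" by (simp add: power_divide)
  qed (simp add: sz_pos less_imp_le)
  also have "\<dots> = (2 / real m) ^ (n - 2) * (\<Sum>w\<in>?W1. 1 / sz (w - y) ^ (n - 2))"
    by (simp add: sum_distrib_left)
  also have "(\<Sum>w\<in>?W1. 1 / sz (w - y) ^ (n - 2)) = (\<Sum>z\<in>(\<lambda>w. w - y) ` ?W1. 1 / sz z ^ (n - 2))"
    by (subst sum.reindex[OF inj]) simp
  also have "(2 / real m) ^ (n - 2) * \<dots> \<le> (2 / real m) ^ (n - 2) * (2 * shell_const n * real m ^ (n - (n - 2)))"
    unfolding n_def using assms(1,2) m(1) by (intro mult_left_mono sum_inverse_power_cube_le) auto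
  also have "\<dots> = 2 ^ (n - 1) * shell_const n * (1 / real m ^ (n - 4))"
  proof -
    have e: "n - 2 = (n - 4) + 2" "n - (n - 2) = 2" "n - 1 = Suc (n - 2)" using n by auto
    have "real m ^ (n - 2) = real m ^ (n - 4) * real m ^ 2"
      unfolding power_add[symmetric] e(1)[symmetric] ..
    then have "(2 / real m) ^ (n - 2) = 2 ^ (n - 2) / (real m ^ (n - 4) * real m ^ 2)"
      by (simp add: power_divide)
    then show ?thesis using m(1) unfolding e(2,3) by simp
  qed
  also have "\<dots> \<le> 2 ^ (n - 1) * shell_const n * (1 / real m ^ 3)"
    using pow shell_const_nonneg by (intro mult_left_mono) auto
  finally have 1: "(\<Sum>w\<in>?W1. ?t w) \<le> 2 ^ (n - 1) * shell_const n * (1 / real m ^ 3)" .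
  have "(\<Sum>w\<in>?W2. ?t w) \<le> (\<Sum>w\<in>?W2. 1 / sz (w - y) ^ (2 * (n - 2)))"
  proof (rule sum_mono)
    fix w assume w: "w \<in> ?W2"
    have "?t w \<le> 1 / sz (w - y) ^ (n - 2) * (1 / sz (w - y) ^ (n - 2))"
      using assms(3)[of w] w sz_pos[of "w - y"] sz_pos[of "a - w"]
      by (intro mult_right_mono divide_left_mono power_mono) auto
    then show "?t w \<le> 1 / sz (w - y) ^ (2 * (n - 2))" by (simp add: mult_2 power_add)
  qed
  also have "\<dots> = (\<Sum>z\<in>(\<lambda>w. w - y) ` ?W2. 1 / sz z ^ (2 * (n - 2)))"
    by (subst sum.reindex[OF inj]) simp
  also have "\<dots> \<le> shell_const n / real m ^ (n - 4)"
    unfolding n_def using assms(1,2) m(1) by (intro sum_inverse_power_tail_le) auto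
  also have "\<dots> \<le> shell_const n * (1 / real m ^ 3)"
    using mult_left_mono[OF pow shell_const_nonneg[of n]] by simp
  finally have 2: "(\<Sum>w\<in>?W2. ?t w) \<le> shell_const n * (1 / real m ^ 3)" .
  have "(\<Sum>w\<in>W. ?t w) = (\<Sum>w\<in>?W1. ?t w) + (\<Sum>w\<in>?W2. ?t w)"
    using assms(1) by (subst sum.union_disjoint[symmetric]) (auto intro!: sum.cong)
  also have "\<dots> \<le> (2 ^ (n - 1) + 1) * (shell_const n * (1 / real m ^ 3))"
    using 1 2 by (simp add: algebra_simps)
  also have "\<dots> \<le> 2 ^ n * (shell_const n * (1 / real m ^ 3))"
  proof (intro mult_right_mono)
    have "(2::real) ^ n = 2 * 2 ^ (n - 1)" using n by (cases n) auto
    moreover have "(1::real) \<le> 2 ^ (n - 1)" by simp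
    ultimately show "(2::real) ^ (n - 1) + 1 \<le> 2 ^ n" by linarith
  qed (simp add: shell_const_nonneg)
  finally show ?thesis by (simp add: m(2) n_def)
qed

lemma sum_convolution_le:
  fixes W :: "(int ^ 'd) set"
  assumes "finite W" "6 < CARD('d)"
  shows "(\<Sum>w\<in>W. 1 / sz (a - w) ^ (CARD('d) - 2) * (1 / sz (w - y) ^ (CARD('d) - 2)))
    \<le> 2 * 2 ^ CARD('d) * shell_const CARD('d) / sz (a - y) ^ 3"
proof -
  let ?t = "\<lambda>a y w. 1 / sz (a - w) ^ (CARD('d) - 2) * (1 / sz (w - y) ^ (CARD('d) - 2))"
  let ?W1 = "{w \<in> W. sz (w - y) \<le> sz (a - w)}" and ?W2 = "{w \<in> W. \<not> sz (w - y) \<le> sz (a - w)}"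
  have "(\<Sum>w\<in>?W1. ?t a y w) \<le> 2 ^ CARD('d) * shell_const CARD('d) / sz (a - y) ^ 3"
    using assms by (intro sum_convolution_aux) auto
  moreover have "(\<Sum>w\<in>?W2. ?t y a w) \<le> 2 ^ CARD('d) * shell_const CARD('d) / sz (y - a) ^ 3"
    using assms sz_commute[of a] sz_commute[of y] by (intro sum_convolution_aux) auto
  moreover have "?t y a w = ?t a y w" for w
    by (simp add: sz_commute[of y w] sz_commute[of w a])
  moreover have "(\<Sum>w\<in>W. ?t a y w) = (\<Sum>w\<in>?W1. ?t a y w) + (\<Sum>w\<in>?W2. ?t a y w)"
    using assms(1) by (subst sum.union_disjoint[symmetric]) (auto intro!: sum.cong)
  ultimately show ?thesis by (simp add: sz_commute[of y a])
qed

text \<open>Averaging over \<open>h\<close> removes the singularity at \<open>z = 0\<close>. If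
  \<open>z\<close> is at distance at least \<open>2 * K\<close>, shifting at most halves its size,
  whence the 8. Otherwise all points lie in a cube of radius \<open>3 * K\<close> and the sum has
  order \<open>K ^ (n - 3)\<close>.\<close>

lemma sum_shift_inverse_cubed_le:
  fixes z :: "int ^ 'd"
  assumes "1 \<le> K" "3 < CARD('d)"
  shows "(\<Sum>h\<in>cube 0 K. 1 / sz (z - h) ^ 3)
    \<le> (16 * shell_const CARD('d) + 8) * 3 ^ CARD('d) * real K ^ CARD('d) / max (real K) (sz z) ^ 3"
proof -
  define n where "n = CARD('d)"
  let ?M = "max (real K) (sz z)" and ?c = "shell_const n"
  have M: "0 < ?M" using assms(1) by simp
  have "(\<Sum>h\<in>cube 0 K. 1 / sz (z - h) ^ 3) \<le> (16 * ?c + 8) * 3 ^ n * real K ^ n * (1 / ?M ^ 3)"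
  proof (cases "2 * real K \<le> sz z")
    case True
    have "1 / sz (z - h) ^ 3 \<le> 8 / ?M ^ 3" if h: "h \<in> cube 0 K" for h
    proof -
      have "sz h \<le> real K" using h assms(1) sz_le_iff by blast
      then have "sz z / 2 \<le> sz (z - h)"
        using sz_triangle[of z 0 h] True by simp
      then have "(sz z / 2) ^ 3 \<le> sz (z - h) ^ 3"
        using sz_pos[of z] by (intro power_mono) auto
      then have "1 / sz (z - h) ^ 3 \<le> 1 / (sz z / 2) ^ 3"
        using sz_pos[of z] sz_pos[of "z - h"]
        by (intro divide_left_mono mult_pos_pos zero_less_power) auto
      moreover have "?M = sz z" using True assms(1) by auto
      ultimately show ?thesis by (simp add: power_divide)
    qed
    then have "(\<Sum>h\<in>cube 0 K. 1 / sz (z - h) ^ 3) \<le> (\<Sum>h\<in>cube (0 :: int ^ 'd) K. 8 / ?M ^ 3)"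
      by (rule sum_mono)
    also have "\<dots> = real ((2 * K + 1) ^ n) * (8 / ?M ^ 3)"
      by (simp add: card_cube n_def)
    also have "\<dots> \<le> (3 * real K) ^ n * (8 / ?M ^ 3)"
    proof (rule mult_right_mono)
      have "real ((2 * K + 1) ^ n) = (2 * real K + 1) ^ n" by (simp add: add.commute)
      also have "\<dots> \<le> (3 * real K) ^ n" using assms(1) by (intro power_mono) auto
      finally show "real ((2 * K + 1) ^ n) \<le> (3 * real K) ^ n" .
    qed (use M in simp)
    also have "\<dots> = 8 * 3 ^ n * real K ^ n * (1 / ?M ^ 3)" by (simp add: power_mult_distrib)
    also have "\<dots> \<le> (16 * ?c + 8) * 3 ^ n * real K ^ n * (1 / ?M ^ 3)"
      using M shell_const_nonneg[of n] by (intro mult_right_mono) auto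
    finally show ?thesis .
  next
    case False
    have inj: "inj_on (\<lambda>h. z - h) X" for X by (auto simp: inj_on_def)
    have sub: "(\<lambda>h. z - h) ` cube 0 K \<subseteq> cube 0 (3 * K)"
    proof (rule image_subsetI)
      fix h :: "int ^ 'd" assume h: "h \<in> cube 0 K"
      have "sz (0 - h) \<le> real K" using h assms(1) sz_le_iff[of K h] sz_commute[of 0 h] by simp
      then have "sz (z - h) \<le> real (3 * K)"
        using sz_triangle[of z h 0] False by simp
      then show "z - h \<in> cube 0 (3 * K)" using assms(1) by (subst sz_le_iff[symmetric]) auto
    qed
    have "(\<Sum>h\<in>cube 0 K. 1 / sz (z - h) ^ 3) = (\<Sum>w\<in>(\<lambda>h. z - h) ` cube 0 K. 1 / sz w ^ 3)"
      by (subst sum.reindex[OF inj]) simp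
    also have "\<dots> \<le> 2 * ?c * real (3 * K) ^ (n - 3)"
      unfolding n_def using assms sub by (intro sum_inverse_power_cube_le) auto
    also have "\<dots> = 2 * ?c * 3 ^ (n - 3) * real K ^ n * (1 / real K ^ 3)"
    proof -
      have "real K ^ n = real K ^ (n - 3) * real K ^ 3"
        using assms(2) by (simp add: n_def power_add[symmetric])
      then show ?thesis using assms(1) by (simp add: power_mult_distrib)
    qed
    also have "\<dots> \<le> 2 * ?c * 3 ^ (n - 3) * real K ^ n * (8 / ?M ^ 3)"
    proof (rule mult_left_mono)
      have "?M \<le> 2 * real K" using False by auto
      then have "?M ^ 3 \<le> (2 * real K) ^ 3" using M by (intro power_mono) auto
      then show "1 / real K ^ 3 \<le> 8 / ?M ^ 3"
        using M assms(1) by (simp add: divide_simps power_mult_distrib)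
    qed (simp add: shell_const_nonneg)
    also have "\<dots> \<le> 2 * ?c * 3 ^ n * real K ^ n * (8 / ?M ^ 3)"
      using M shell_const_nonneg by (intro mult_right_mono mult_left_mono power_increasing) auto
    also have "\<dots> \<le> (16 * ?c + 8) * 3 ^ n * real K ^ n * (1 / ?M ^ 3)"
      using M by (simp add: algebra_simps)
    finally show ?thesis .
  qed
  then show ?thesis by (simp add: n_def)
qed

text \<open>The point is uniformity in \<open>w\<close>: for \<open>w\<close> near the cube the
  shell estimate applies after translation, and for \<open>w\<close> far away every term is at most
  \<open>1 / r ^ (n - 2)\<close>.\<close>

lemma sum_far_inverse_power_le:
  fixes X :: "(int ^ 'd) set"
  assumes "X \<subseteq> cube 0 r" "1 \<le> r" "2 < CARD('d)"
  shows "(\<Sum>x\<in>X. 1 / sz (w - x) ^ (CARD('d) - 2)) \<le> (18 * shell_const CARD('d) + 3 ^ CARD('d)) * real r ^ 2"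
proof -
  define n where "n = CARD('d)"
  have X: "finite X" by (rule finite_subset[OF assms(1) finite_cube])
  have szX: "sz (0 - x) \<le> real r" if "x \<in> X" for x
    using assms that sz_le_iff[of r x] sz_commute[of 0 x] by auto
  show ?thesis
  proof (cases "sz w \<le> 2 * real r")
    case True
    have inj: "inj_on (\<lambda>x. w - x) X" by (auto simp: inj_on_def)
    have sub: "(\<lambda>x. w - x) ` X \<subseteq> cube 0 (3 * r)"
    proof (rule image_subsetI)
      fix x assume "x \<in> X"
      then have "sz (w - x) \<le> real (3 * r)"
        using sz_triangle[of w x 0] True szX by fastforce
      then show "w - x \<in> cube 0 (3 * r)" using assms(2) by (subst sz_le_iff[symmetric]) auto
    qed
    have "(\<Sum>x\<in>X. 1 / sz (w - x) ^ (n - 2)) = (\<Sum>z\<in>(\<lambda>x. w - x) ` X. 1 / sz z ^ (n - 2))"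
      by (subst sum.reindex[OF inj]) simp
    also have "\<dots> \<le> 2 * shell_const n * real (3 * r) ^ (n - (n - 2))"
      unfolding n_def using assms sub X by (intro sum_inverse_power_cube_le) auto
    also have "n - (n - 2) = 2" using assms(3) by (simp add: n_def)
    also have "2 * shell_const n * real (3 * r) ^ 2 \<le> (18 * shell_const n + 3 ^ n) * real r ^ 2"
      by (simp add: power_mult_distrib algebra_simps)
    finally show ?thesis by (simp add: n_def)
  next
    case False
    have "(\<Sum>x\<in>X. 1 / sz (w - x) ^ (n - 2)) \<le> (\<Sum>x\<in>X. 1 / real r ^ (n - 2))"
    proof (rule sum_mono)
      fix x assume x: "x \<in> X"
      have "real r \<le> sz (w - x)"
        using sz_triangle[of w 0 x] szX[OF x] sz_commute[of x 0] False by simp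
      then show "1 / sz (w - x) ^ (n - 2) \<le> 1 / real r ^ (n - 2)"
        using assms(2) sz_pos[of "w - x"]
        by (intro divide_left_mono power_mono mult_pos_pos zero_less_power) auto
    qed
    also have "\<dots> = real (card X) * (1 / real r ^ (n - 2))" by simp
    also have "\<dots> \<le> (3 * real r) ^ n * (1 / real r ^ (n - 2))"
    proof (rule mult_right_mono)
      have "card X \<le> (2 * r + 1) ^ n"
        using card_mono[OF finite_cube assms(1)] card_cube[of "0 :: int ^ 'd" r] by (simp add: n_def)
      also have "\<dots> \<le> (3 * r) ^ n" using assms(2) by (intro power_mono) auto
      finally show "real (card X) \<le> (3 * real r) ^ n"
        using of_nat_mono by fastforce
    qed simp
    also have "\<dots> = 3 ^ n * real r ^ 2"
    proof -
      have "n = (n - 2) + 2" using assms(3) by (simp add: n_def)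
      then have "real r ^ n = real r ^ (n - 2) * real r ^ 2" by (metis power_add)
      then show ?thesis using assms(2) by (simp add: power_mult_distrib)
    qed
    also have "\<dots> \<le> (18 * shell_const n + 3 ^ n) * real r ^ 2"
      using shell_const_nonneg by (intro mult_right_mono) auto
    finally show ?thesis by (simp add: n_def)
  qed
qed

section \<open>Finite-volume approximation\<close>

lemma prod_space_percolation: "product_prob_space (\<lambda>_::(int ^ 'd) set. measure_pmf (bernoulli_pmf p))"
  unfolding product_prob_space_def product_sigma_finite_def product_prob_space_axioms_def
  by (auto intro: measure_pmf.prob_space_axioms prob_space_imp_sigma_finite)

lemma space_percolation: "space (percolation E p) = (\<Pi>\<^sub>E e\<in>E. UNIV)"
  by (simp add: percolation_def space_PiM)

text \<open>The edge probability is written as the mass of \<open>True\<close>, since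
  \<open>bernoulli_pmf\<close> truncates its parameter; this covers every real
  \<open>p\<close>.\<close>

lemma cylinder_percolation:
  fixes F :: "(int ^ 'd) set set"
  assumes "finite F" "F \<subseteq> E" "\<omega>0 \<subseteq> F"
  shows "{\<omega> \<in> space (percolation E p). {e \<in> F. \<omega> e} = \<omega>0} \<in> sets (percolation E p)"
    and "measure (percolation E p) {\<omega> \<in> space (percolation E p). {e \<in> F. \<omega> e} = \<omega>0}
      = weight (pmf (bernoulli_pmf p) True) F \<omega>0"
proof -
  interpret product_prob_space "\<lambda>_::(int ^ 'd) set. measure_pmf (bernoulli_pmf p)" E
    by (rule prod_space_percolation)
  let ?B = "measure_pmf (bernoulli_pmf p)"
  have eq: "{\<omega> \<in> space (percolation E p). {e \<in> F. \<omega> e} = \<omega>0}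
      = prod_emb E (\<lambda>_. ?B) F (Pi\<^sub>E F (\<lambda>e. {e \<in> \<omega>0}))"
    using assms by (auto simp: space_percolation prod_emb_def PiE_iff restrict_def extensional_def)
  show "{\<omega> \<in> space (percolation E p). {e \<in> F. \<omega> e} = \<omega>0} \<in> sets (percolation E p)"
    unfolding eq unfolding percolation_def using assms by (intro sets_PiM_I) auto
  have F: "pmf (bernoulli_pmf p) False = 1 - pmf (bernoulli_pmf p) True"
  proof -
    have "(\<Sum>x\<in>UNIV. pmf (bernoulli_pmf p) x) = 1" by (rule sum_pmf_eq_1) auto
    then show ?thesis by (simp add: UNIV_bool)
  qed
  have "measure (percolation E p) {\<omega> \<in> space (percolation E p). {e \<in> F. \<omega> e} = \<omega>0}
      = (\<Prod>e\<in>F. measure ?B {e \<in> \<omega>0})"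
    unfolding eq unfolding percolation_def using assms by (intro measure_PiM_emb) auto
  also have "\<dots> = weight (pmf (bernoulli_pmf p) True) F \<omega>0"
    unfolding weight_def by (intro prod.cong) (auto simp: measure_pmf_single F)
  finally show "measure (percolation E p) {\<omega> \<in> space (percolation E p). {e \<in> F. \<omega> e} = \<omega>0}
      = weight (pmf (bernoulli_pmf p) True) F \<omega>0" .
qed

lemma local_event_percolation:
  fixes F :: "(int ^ 'd) set set"
  assumes "finite F" "F \<subseteq> E"
  shows "{\<omega> \<in> space (percolation E p). A {e \<in> F. \<omega> e}} \<in> sets (percolation E p)"
    and "measure (percolation E p) {\<omega> \<in> space (percolation E p). A {e \<in> F. \<omega> e}}
      = bprob (pmf (bernoulli_pmf p) True) F A"
proof -
  interpret product_prob_space "\<lambda>_::(int ^ 'd) set. measure_pmf (bernoulli_pmf p)" E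
    by (rule prod_space_percolation)
  let ?M = "percolation E p" and ?q = "pmf (bernoulli_pmf p) True"
  let ?C = "\<lambda>\<omega>0. {\<omega> \<in> space ?M. {e \<in> F. \<omega> e} = \<omega>0}" and ?I = "{\<omega>0 \<in> Pow F. A \<omega>0}"
  have eq: "{\<omega> \<in> space ?M. A {e \<in> F. \<omega> e}} = (\<Union>\<omega>0\<in>?I. ?C \<omega>0)" by auto
  show "{\<omega> \<in> space ?M. A {e \<in> F. \<omega> e}} \<in> sets ?M"
    unfolding eq using assms cylinder_percolation(1) by (intro sets.finite_UN) auto
  have "measure ?M (\<Union>\<omega>0\<in>?I. ?C \<omega>0) = (\<Sum>\<omega>0\<in>?I. measure ?M (?C \<omega>0))"
    unfolding percolation_def
    using assms cylinder_percolation(1)[OF assms, of _ p]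
    by (intro P.finite_measure_finite_Union) (auto simp: disjoint_family_on_def percolation_def)
  also have "\<dots> = (\<Sum>\<omega>0\<in>?I. weight ?q F \<omega>0)"
    using cylinder_percolation(2)[OF assms] by (intro sum.cong) auto
  also have "\<dots> = bprob ?q F A"
    unfolding bprob_def bexp_def using assms by (intro sum.mono_neutral_cong_left) auto
  finally show "measure ?M {\<omega> \<in> space ?M. A {e \<in> F. \<omega> e}} = bprob ?q F A"
    unfolding eq .
qed

section \<open>Connections in finite sets and exhaustion by cubes\<close>

lemma connected_in_iff_conn: "connected_in E \<omega> S x y \<longleftrightarrow> conn {e \<in> E. \<omega> e} S x y"
  using successively_iff_path_edges[of "{e \<in> E. \<omega> e}"]
  unfolding connected_in_def conn_def open_path_def path_in_def by auto

lemma connected_in_local: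
  assumes "F \<subseteq> E" "{e \<in> E. e \<subseteq> S} \<subseteq> F"
  shows "connected_in E \<omega> S x y \<longleftrightarrow> conn {e \<in> F. \<omega> e} S x y"
  unfolding connected_in_iff_conn using assms by (intro conn_cong) auto

text \<open>\<open>F\<close> may be larger than the edges inside \<open>S\<close>, so one finite
  edge set serves all subsets of a large cube.\<close>

lemma tau_in_eq_bprob:
  fixes S :: "(int ^ 'd) set"
  assumes "finite F" "F \<subseteq> E" "{e \<in> E. e \<subseteq> S} \<subseteq> F"
  shows "tau_in E p S x y = bprob (pmf (bernoulli_pmf p) True) F (\<lambda>\<omega>. conn \<omega> S x y)"
  unfolding tau_in_def connected_in_local[OF assms(2,3)]
  by (rule local_event_percolation(2)[OF assms(1,2)])

lemma sets_connected_in: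
  fixes S :: "(int ^ 'd) set"
  assumes "finite S"
  shows "{\<omega> \<in> space (percolation E p). connected_in E \<omega> S x y} \<in> sets (percolation E p)"
proof -
  have "finite {e \<in> E. e \<subseteq> S}" using assms by (auto intro: finite_subset[of _ "Pow S"])
  then show ?thesis
    using local_event_percolation(1)[of "{e \<in> E. e \<subseteq> S}" E p "\<lambda>\<omega>. conn \<omega> S x y"]
    unfolding connected_in_local[of "{e \<in> E. e \<subseteq> S}" E S, OF _ subset_refl, simplified] by auto
qed

lemma connected_in_cube_iff:
  fixes S :: "(int ^ 'd) set"
  shows "connected_in E \<omega> S x y \<longleftrightarrow> (\<exists>n. connected_in E \<omega> (S \<inter> cube 0 n) x y)"
proof
  assume "connected_in E \<omega> S x y"
  then obtain xs where xs: "path_in {e \<in> E. \<omega> e} S x y xs"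
    by (auto simp: connected_in_iff_conn conn_def)
  define n where "n = nat (Max (linf_norm ` set xs))"
  have "set xs \<subseteq> cube 0 n"
  proof
    fix z assume "z \<in> set xs"
    then have "linf_norm z \<le> Max (linf_norm ` set xs)" by (intro Max_ge) auto
    then show "z \<in> cube 0 n" by (simp add: cube_def n_def)
  qed
  then have "path_in {e \<in> E. \<omega> e} (S \<inter> cube 0 n) x y xs"
    using xs by (auto simp: path_in_def)
  then show "\<exists>n. connected_in E \<omega> (S \<inter> cube 0 n) x y"
    by (auto simp: connected_in_iff_conn conn_def)
next
  assume "\<exists>n. connected_in E \<omega> (S \<inter> cube 0 n) x y"
  then obtain n where "conn {e \<in> E. \<omega> e} (S \<inter> cube 0 n) x y"
    unfolding connected_in_iff_conn by blast
  then show "connected_in E \<omega> S x y"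
    unfolding connected_in_iff_conn by (rule conn_mono[OF _ subset_refl Int_lower1])
qed

text \<open>Every path is finite, so the events in growing cubes increase to the event in
  \<open>S\<close>, and continuity of measure applies.\<close>

lemma tau_in_cube_tendsto:
  fixes S :: "(int ^ 'd) set"
  shows "(\<lambda>n. tau_in E p (S \<inter> cube 0 n) x y) \<longlonglongrightarrow> tau_in E p S x y"
    and "tau_in E p (S \<inter> cube 0 n) x y \<le> tau_in E p S x y"
proof -
  interpret product_prob_space "\<lambda>_::(int ^ 'd) set. measure_pmf (bernoulli_pmf p)" E
    by (rule prod_space_percolation)
  let ?M = "percolation E p"
  let ?A = "\<lambda>n. {\<omega> \<in> space ?M. connected_in E \<omega> (S \<inter> cube 0 n) x y}"
  have inc: "incseq ?A"
  proof (rule incseq_SucI)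
    fix n
    have sub: "S \<inter> cube 0 n \<subseteq> S \<inter> cube (0 :: int ^ 'd) (Suc n)"
      using cube_mono[of n "Suc n" "0 :: int ^ 'd"] by auto
    show "?A n \<subseteq> ?A (Suc n)"
      unfolding connected_in_iff_conn by (auto intro: conn_mono[OF _ subset_refl sub])
  qed
  have sets: "range ?A \<subseteq> sets ?M" by (auto intro!: sets_connected_in)
  have "(\<lambda>n. measure ?M (?A n)) \<longlonglongrightarrow> measure ?M (\<Union>n. ?A n)"
    using sets inc unfolding percolation_def by (rule P.finite_Lim_measure_incseq)
  moreover have "(\<Union>n. ?A n) = {\<omega> \<in> space ?M. connected_in E \<omega> S x y}"
    using connected_in_cube_iff[of E _ S] by auto
  ultimately show lim: "(\<lambda>n. tau_in E p (S \<inter> cube 0 n) x y) \<longlonglongrightarrow> tau_in E p S x y"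
    by (simp add: tau_in_def)
  have "incseq (\<lambda>n. tau_in E p (S \<inter> cube 0 n) x y)"
  proof (rule incseq_SucI)
    fix n
    show "tau_in E p (S \<inter> cube 0 n) x y \<le> tau_in E p (S \<inter> cube 0 (Suc n)) x y"
      unfolding tau_in_def using incseq_SucD[OF inc, of n] sets
      by (intro P.finite_measure_mono[folded percolation_def]) auto
  qed
  then show "tau_in E p (S \<inter> cube 0 n) x y \<le> tau_in E p S x y"
    using lim by (rule incseq_le)
qed

text \<open>The common properties of both models on which the argument rests: nearest-neighbour
  edges, for leading paths through boxes, and bounded range.\<close>

lemma edges_of_model:
  fixes E :: "(int ^ 'd) set set"
  assumes "E = nearest_neighbour_edges \<or> (\<exists>L\<ge>1. E = spread_out_edges L)"
  shows "nearest_neighbour_edges \<subseteq> E \<and>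
    (\<exists>L. \<forall>e\<in>E. \<exists>u v. e = {u, v} \<and> v \<in> cube u L)"
proof -
  have nn: "x \<noteq> y" if "l1_norm (x - y) = 1" for x y :: "int ^ 'd"
    using that by (auto simp: l1_norm_def)
  have near: "v \<in> cube u L" if "l1_norm (u - v) \<le> int L" for u v :: "int ^ 'd" and L
    using that linf_norm_le_l1_norm[of "u - v"] linf_norm_minus_commute[of u v] by (simp add: cube_def)
  from assms show ?thesis
  proof
    assume E: "E = nearest_neighbour_edges"
    have "\<forall>e\<in>E. \<exists>u v. e = {u, v} \<and> v \<in> cube u 1"
      using near[of _ _ 1] unfolding E nearest_neighbour_edges_def by fastforce
    then show ?thesis using E by blast
  next
    assume "\<exists>L\<ge>1. E = spread_out_edges L"
    then obtain L where L: "1 \<le> L" "E = spread_out_edges L" by blast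
    have "\<forall>e\<in>E. \<exists>u v. e = {u, v} \<and> v \<in> cube u L"
      using near[of _ _ L] unfolding L spread_out_edges_def by fastforce
    moreover have "nearest_neighbour_edges \<subseteq> E"
      using L(1) nn unfolding L(2) nearest_neighbour_edges_def spread_out_edges_def by fastforce
    ultimately show ?thesis by blast
  qed
qed

section \<open>Visits of a path to boxes around its endpoint\<close>

lemma cube_symD: "v \<in> cube u r \<Longrightarrow> u \<in> cube v r"
  by (subst mem_cube_commute)

definition boundary :: "'v set set \<Rightarrow> 'v set \<Rightarrow> 'v set" where
  "boundary E S = {u \<in> S. \<exists>v. v \<notin> S \<and> {u, v} \<in> E}"

text \<open>Chosen so that detours out of a cube of radius
  \<open>escape_const n a b * r\<^sup>2\<close> cost at most half of \<open>a / r ^ (n - 2)\<close>;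
  the added 2 makes that radius at least \<open>2 * r\<close>.\<close>

definition escape_const :: "nat \<Rightarrow> real \<Rightarrow> real \<Rightarrow> nat" where
  "escape_const n a b = nat \<lceil>2 * b\<^sup>2 * 2 ^ (n - 2) * shell_const n / a\<rceil> + 2"

text \<open>The factor \<open>2 / a\<close> undoes the lower bound of
  \<open>boundary_reach_ge\<close>; the power counts the points from which a given boundary vertex
  is reached.\<close>

definition harnack_const :: "nat \<Rightarrow> real \<Rightarrow> real \<Rightarrow> real" where
  "harnack_const n a b = 2 / a * (3 * real (escape_const n a b)) ^ n"

definition sigma_const :: "nat \<Rightarrow> real \<Rightarrow> real" where
  "sigma_const n b = 8 * b * shell_const n"

text \<open>The first summand is the visit threshold, the second the chain correction; the powers of
  the radius have cancelled in the latter.\<close>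

definition visit_const :: "nat \<Rightarrow> real \<Rightarrow> real \<Rightarrow> nat \<Rightarrow> real" where
  "visit_const n a b L = real (Suc (8 * n)) +
     real (Suc (8 * n)) * sigma_const n b ^ (8 * n) * (3 ^ n * harnack_const n a b * (1 + real L) ^ (3 * n))"

text \<open>Restriction to \<open>V\<close> preserves the upper two-point bound everywhere. The
  lower bound holds only well inside \<open>V\<close> and is therefore a hypothesis of the
  individual lemmas, for the pairs concerned.\<close>

locale lattice_percolation = finite_percolation p F V
  for p :: real and F :: "(int ^ 'd) set set" and V :: "(int ^ 'd) set" +
  fixes E :: "(int ^ 'd) set set" and L n :: nat and b :: real
  assumes F_def: "F = {e \<in> E. e \<subseteq> V}"
    and nn_subset: "nearest_neighbour_edges \<subseteq> E"
    and edge_range: "\<And>e. e \<in> E \<Longrightarrow> \<exists>u v. e = {u, v} \<and> v \<in> cube u L"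
    and n_def: "n = CARD('d)" and n_gt: "6 < n"
    and b_pos: "0 < b"
    and cp_upper: "\<And>x y. cp V x y \<le> b / sz (x - y) ^ (n - 2)"
begin

definition Phi :: "(int ^ 'd) set \<Rightarrow> int ^ 'd \<Rightarrow> real" where
  "Phi S o' = (\<Sum>u\<in>boundary E S. cp S o' u)"

section \<open>Reaching the boundary of a set and the Harnack estimate\<close>

lemma Phi_nonneg: "0 \<le> Phi S o'"
  unfolding Phi_def by (intro sum_nonneg cp_nonneg)

lemma edge_cube: "{u, v} \<in> E \<Longrightarrow> v \<in> cube u L"
  using edge_range[of "{u, v}"] mem_cube_commute[of v u L] by (auto simp: doubleton_eq_iff)

lemma cp_upper_real: "cp V x y \<le> b * (1 / sz (x - y) ^ (n - 2))"
  using cp_upper by simp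

lemma exit_cube_ge:
  assumes "S \<subseteq> V" "x \<in> S" "z \<notin> S"
  shows "cp (V \<inter> cube x R) x z \<le> (\<Sum>u\<in>boundary E S \<inter> cube x R. cp S x u)"
  unfolding cp_def
proof (rule PR_le_sum)
  have "finite S" using assms(1) finite_V finite_subset by blast
  then show "finite (boundary E S \<inter> cube x R)"
    by (rule finite_subset[rotated]) (auto simp: boundary_def)
next
  fix \<omega> assume \<omega>: "\<omega> \<subseteq> F" "conn \<omega> (V \<inter> cube x R) x z"
  then obtain t' t where t: "conn \<omega> (V \<inter> cube x R - - S) x t'" "t' \<notin> - S" "{t', t} \<in> \<omega>" "t \<in> - S"
    using conn_enter[of \<omega> "V \<inter> cube x R" x z "- S"] assms by blast
  have "conn \<omega> S x t'" using t(1) by (rule conn_mono) auto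
  moreover have "t' \<in> cube x R" using conn_in[OF t(1)] by blast
  moreover have "t' \<in> boundary E S"
    using t \<omega>(1) by (auto simp: boundary_def F_def)
  ultimately show "\<exists>u\<in>boundary E S \<inter> cube x R. conn \<omega> S x u" by blast
qed

text \<open>A point \<open>w\<close> outside the large cube is at least half as far from
  \<open>z\<close> as from \<open>x\<close>, so the sum is a tail with doubled exponent.\<close>

lemma leave_cube_le:
  assumes "z \<in> cube x r" "1 \<le> r" "2 * r \<le> R"
  shows "(\<Sum>w\<in>- cube x R \<inter> V. cp V x w * cp V w z)
    \<le> b\<^sup>2 * 2 ^ (n - 2) * shell_const n / real R ^ (n - 4)"
proof -
  let ?W = "- cube x R \<inter> V"
  have fin: "finite ?W" using finite_V by auto
  have inj: "inj_on (\<lambda>w. x - w) ?W" by (auto simp: inj_on_def)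
  have "(\<Sum>w\<in>?W. cp V x w * cp V w z) \<le> (\<Sum>w\<in>?W. b\<^sup>2 * 2 ^ (n - 2) * (1 / sz (x - w) ^ (2 * (n - 2))))"
  proof (rule sum_mono)
    fix w assume w: "w \<in> ?W"
    have "sz (x - z) \<le> real r"
      using assms(1,2) by (subst sz_le_iff) (auto simp: cube_def linf_norm_minus_commute)
    moreover have "real R < sz (x - w)"
    proof -
      have "\<not> sz (x - w) \<le> real R"
        using w assms by (subst sz_le_iff) (auto simp: cube_def linf_norm_minus_commute)
      then show ?thesis by simp
    qed
    ultimately have "sz (x - w) / 2 \<le> sz (w - z)"
      using sz_triangle[of x w z] assms(3) sz_commute[of z w] by simp
    then have "(sz (x - w) / 2) ^ (n - 2) \<le> sz (w - z) ^ (n - 2)"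
      using sz_pos[of "x - w"] by (intro power_mono) auto
    then have "1 / sz (w - z) ^ (n - 2) \<le> 1 / (sz (x - w) / 2) ^ (n - 2)"
      using sz_pos[of "x - w"] sz_pos[of "w - z"]
      by (intro divide_left_mono mult_pos_pos zero_less_power) auto
    then have 1: "cp V w z \<le> b * (1 / (sz (x - w) / 2) ^ (n - 2))"
      using cp_upper_real[of w z] b_pos by (meson less_imp_le mult_left_mono order_trans)
    have "cp V x w * cp V w z \<le> b * (1 / sz (x - w) ^ (n - 2)) * (b * (1 / (sz (x - w) / 2) ^ (n - 2)))"
      using cp_upper_real[of x w] 1 cp_nonneg b_pos sz_pos[of "x - w"]
      by (intro mult_mono) auto
    also have "\<dots> = b\<^sup>2 * 2 ^ (n - 2) * (1 / sz (x - w) ^ (2 * (n - 2)))"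
      by (simp add: power2_eq_square power_divide mult_2 power_add)
    finally show "cp V x w * cp V w z \<le> b\<^sup>2 * 2 ^ (n - 2) * (1 / sz (x - w) ^ (2 * (n - 2)))" .
  qed
  also have "\<dots> = b\<^sup>2 * 2 ^ (n - 2) * (\<Sum>w\<in>?W. 1 / sz (x - w) ^ (2 * (n - 2)))"
    by (simp add: sum_distrib_left)
  also have "(\<Sum>w\<in>?W. 1 / sz (x - w) ^ (2 * (n - 2))) = (\<Sum>z\<in>(\<lambda>w. x - w) ` ?W. 1 / sz z ^ (2 * (n - 2)))"
    by (subst sum.reindex[OF inj]) simp
  also have "b\<^sup>2 * 2 ^ (n - 2) * \<dots> \<le> b\<^sup>2 * 2 ^ (n - 2) * (shell_const n / real R ^ (n - 4))"
  proof (rule mult_left_mono)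
    have "(\<lambda>w. x - w) ` ?W \<inter> cube 0 R = {}"
      by (auto simp: cube_def linf_norm_minus_commute)
    then show "(\<Sum>z\<in>(\<lambda>w. x - w) ` ?W. 1 / sz z ^ (2 * (n - 2))) \<le> shell_const n / real R ^ (n - 4)"
      using fin assms n_gt unfolding n_def by (intro sum_inverse_power_tail_le) auto
  qed simp
  finally show ?thesis by simp
qed

text \<open>The connection from \<open>x\<close> to \<open>z\<close> must leave \<open>S\<close>.
  The radius is quadratic in \<open>r\<close> because the detour term \<open>R ^ (4 - n)\<close> has
  to beat \<open>r ^ (2 - n)\<close>, and \<open>2 * (n - 4)\<close> is at least
  \<open>n - 2\<close>.\<close>

lemma boundary_reach_ge:
  assumes "0 < a" "S \<subseteq> V" "x \<in> S" "z \<notin> S" "z \<in> cube x r" "1 \<le> r"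
    and "a / sz (x - z) ^ (n - 2) \<le> cp V x z"
  shows "a / (2 * real r ^ (n - 2)) \<le> (\<Sum>u\<in>boundary E S \<inter> cube x (escape_const n a b * r\<^sup>2). cp S x u)"
proof -
  define q where "q = escape_const n a b"
  let ?e = "b\<^sup>2 * 2 ^ (n - 2) * shell_const n"
  have e: "0 \<le> ?e" using shell_const_nonneg by simp
  have q: "2 * ?e / a \<le> real q" "2 \<le> q"
    using real_nat_ceiling_ge[of "2 * ?e / a"] by (auto simp: q_def escape_const_def mult.assoc)
  define R where "R = q * r\<^sup>2"
  have "2 * r \<le> 2 * r\<^sup>2" using assms(6) by (simp add: power2_eq_square)
  also have "\<dots> \<le> R" using q(2) by (simp add: R_def)
  finally have R: "2 * r \<le> R" .
  then have "0 < R" using assms(6) by simp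
  have Rpow: "real q * real r ^ (n - 2) \<le> real R ^ (n - 4)"
  proof -
    have "real q * real r ^ (n - 2) \<le> real q ^ (n - 4) * real r ^ (2 * (n - 4))"
    proof (intro mult_mono)
      show "real q \<le> real q ^ (n - 4)"
        using q(2) n_gt by (intro self_le_power) auto
      show "real r ^ (n - 2) \<le> real r ^ (2 * (n - 4))"
        using assms(6) n_gt by (intro power_increasing) auto
    qed auto
    then show ?thesis by (simp add: R_def power_mult_distrib power_mult)
  qed
  have r0: "0 < real r ^ (n - 2)" "0 < real q" using assms(6) q by auto
  have "?e / real R ^ (n - 4) \<le> ?e / (real q * real r ^ (n - 2))"
    using Rpow e r0 \<open>0 < R\<close> by (intro divide_left_mono mult_pos_pos) auto
  also have "\<dots> \<le> a / (2 * real r ^ (n - 2))"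
    using q(1) assms(1) r0 by (simp add: field_simps)
  finally have err: "?e / real R ^ (n - 4) \<le> a / (2 * real r ^ (n - 2))" .
  have "sz (x - z) \<le> real r"
    using assms(5,6) by (subst sz_le_iff) (auto simp: cube_def linf_norm_minus_commute)
  then have "a / real r ^ (n - 2) \<le> a / sz (x - z) ^ (n - 2)"
    using assms(1) sz_pos[of "x - z"] by (intro divide_left_mono power_mono mult_pos_pos zero_less_power) auto
  then have "a / real r ^ (n - 2) \<le> cp V x z" using assms(7) by linarith
  moreover have "a / real r ^ (n - 2) = a / (2 * real r ^ (n - 2)) + a / (2 * real r ^ (n - 2))"
    by simp
  moreover have "cp V x z - (\<Sum>w\<in>- cube x R \<inter> V. cp V x w * cp V w z) \<le> cp (V \<inter> cube x R) x z"
    using cp_avoid_ge[of x z "- cube x R"] by (simp only: Diff_eq double_complement)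
  ultimately have "a / (2 * real r ^ (n - 2)) \<le> cp (V \<inter> cube x R) x z"
    using leave_cube_le[OF assms(5,6) R] err by linarith
  also have "\<dots> \<le> (\<Sum>u\<in>boundary E S \<inter> cube x R. cp S x u)"
    by (rule exit_cube_ge[OF assms(2-4)])
  finally show ?thesis unfolding R_def q_def .
qed

text \<open>
  An averaged Harnack inequality: by the inequality of Harris, a vertex \<open>x\<close> near the complement
  of \<open>S\<close> passes a polynomial fraction of \<open>cp S o' x\<close> on to nearby boundary vertices.
\<close>

lemma sum_near_complement_le:
  assumes "0 < a" "S \<subseteq> V" "A \<subseteq> S" "1 \<le> r"
    and A: "\<And>x. x \<in> A \<Longrightarrow> \<exists>z. z \<notin> S \<and> z \<in> cube x r \<and> a / sz (x - z) ^ (n - 2) \<le> cp V x z"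
  shows "(\<Sum>x\<in>A. cp S o' x) \<le> harnack_const n a b * real r ^ (3 * n) * Phi S o'"
proof -
  define q where "q = escape_const n a b"
  define R where "R = q * r\<^sup>2"
  have q: "2 \<le> q" by (auto simp: q_def escape_const_def)
  have fS: "finite S" using assms(2) finite_V finite_subset by blast
  have fA: "finite A" using assms(3) fS finite_subset by blast
  have fB: "finite (boundary E S)" using fS by (rule finite_subset[rotated]) (auto simp: boundary_def)
  let ?c = "a / (2 * real r ^ (n - 2))"
  have c: "0 < ?c" using assms by simp
  have "?c * (\<Sum>x\<in>A. cp S o' x) = (\<Sum>x\<in>A. cp S o' x * ?c)"
    unfolding sum_distrib_left by (rule sum.cong[OF refl]) (rule mult.commute)
  also have "\<dots> \<le> (\<Sum>x\<in>A. cp S o' x * (\<Sum>u\<in>boundary E S \<inter> cube x R. cp S x u))"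
  proof (intro sum_mono mult_left_mono cp_nonneg)
    fix x assume x: "x \<in> A"
    then obtain z where "z \<notin> S" "z \<in> cube x r" "a / sz (x - z) ^ (n - 2) \<le> cp V x z"
      using A by blast
    then show "?c \<le> (\<Sum>u\<in>boundary E S \<inter> cube x R. cp S x u)"
      unfolding R_def q_def using assms x by (intro boundary_reach_ge) auto
  qed
  also have "\<dots> \<le> (\<Sum>x\<in>A. \<Sum>u\<in>{u \<in> boundary E S. u \<in> cube x R}. cp S o' u)"
    unfolding sum_distrib_left Int_def mem_Collect_eq Collect_mem_eq
    using cp_mult_le by (intro sum_mono) auto
  also have "\<dots> = (\<Sum>u\<in>boundary E S. \<Sum>x\<in>{x \<in> A. u \<in> cube x R}. cp S o' u)"
    using fA fB by (rule sum.swap_restrict)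
  also have "\<dots> \<le> (\<Sum>u\<in>boundary E S. real ((2 * R + 1) ^ n) * cp S o' u)"
  proof (rule sum_mono)
    fix u assume "u \<in> boundary E S"
    have "{x \<in> A. u \<in> cube x R} \<subseteq> cube u R" by (rule subsetI, elim CollectE conjE, rule cube_symD)
    from card_mono[OF finite_cube this] have "card {x \<in> A. u \<in> cube x R} \<le> (2 * R + 1) ^ n"
      by (simp only: card_cube n_def)
    then show "(\<Sum>x\<in>{x \<in> A. u \<in> cube x R}. cp S o' u) \<le> real ((2 * R + 1) ^ n) * cp S o' u"
      using cp_nonneg by (simp only: sum_constant) (intro mult_right_mono; simp only: of_nat_le_iff)
  qed
  also have "\<dots> = real ((2 * R + 1) ^ n) * Phi S o'"
    by (simp add: Phi_def sum_distrib_left)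
  also have "\<dots> \<le> (3 * real q * real r ^ 2) ^ n * Phi S o'"
  proof (rule mult_right_mono[OF _ Phi_nonneg])
    have "1 \<le> R" using q assms(4) by (simp add: R_def)
    then have "(2 * real R + 1) ^ n \<le> (3 * real R) ^ n" by (intro power_mono) auto
    then show "real ((2 * R + 1) ^ n) \<le> (3 * real q * real r ^ 2) ^ n"
      by (simp add: R_def add.commute mult.assoc)
  qed
  finally have "?c * (\<Sum>x\<in>A. cp S o' x) \<le> (3 * real q * real r ^ 2) ^ n * Phi S o'" .
  then have "(\<Sum>x\<in>A. cp S o' x) \<le> (3 * real q * real r ^ 2) ^ n * Phi S o' / ?c"
    using c by (simp only: pos_le_divide_eq mult.commute)
  also have "\<dots> = 2 / a * (3 * real q) ^ n * (real r ^ (2 * n + (n - 2))) * Phi S o'"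
  proof -
    have "(3 * real q * real r ^ 2) ^ n = (3 * real q) ^ n * real r ^ (2 * n)"
      by (simp only: power_mult_distrib[of "3 * real q"] power_mult)
    then show ?thesis using assms(1,4) by (simp add: power_add)
  qed
  \<comment> \<open>Of the exponent, \<open>2 * n\<close> counts points in the cube of quadratic
    radius and \<open>n - 2\<close> comes from the lower two-point bound.\<close>
  also have "\<dots> \<le> 2 / a * (3 * real q) ^ n * (real r ^ (3 * n)) * Phi S o'"
    using assms(1,4) Phi_nonneg by (intro mult_right_mono mult_left_mono power_increasing) auto
  finally show ?thesis by (simp add: harnack_const_def q_def)
qed

lemma sum_cp_cube_le:
  assumes "B \<subseteq> cube u (m\<^sup>2)" "1 \<le> m" "x \<in> cube u (m\<^sup>2)" "B \<subseteq> V" "S \<subseteq> V"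
  shows "(\<Sum>y\<in>B. cp S x y) \<le> sigma_const n b * real m ^ 4"
proof -
  have fB: "finite B" using assms(4) finite_V finite_subset by blast
  have inj: "inj_on (\<lambda>y. x - y) B" by (auto simp: inj_on_def)
  have "(\<Sum>y\<in>B. cp S x y) \<le> (\<Sum>y\<in>B. b * (1 / sz (x - y) ^ (n - 2)))"
    using cp_mono[OF assms(5)] cp_upper_real by (intro sum_mono) (meson order_trans)
  also have "\<dots> = b * (\<Sum>z\<in>(\<lambda>y. x - y) ` B. 1 / sz z ^ (n - 2))"
    by (subst sum.reindex[OF inj]) (simp add: sum_distrib_left)
  also have "\<dots> \<le> b * (2 * shell_const n * real (2 * m\<^sup>2) ^ (n - (n - 2)))"
  proof (rule mult_left_mono)
    have "(\<lambda>y. x - y) ` B \<subseteq> cube 0 (2 * m\<^sup>2)"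
    proof (rule image_subsetI)
      fix y assume "y \<in> B"
      then have "u \<in> cube y (m\<^sup>2)"
        by (rule cube_symD[OF subsetD[OF assms(1)]])
      then have "x \<in> cube y (m\<^sup>2 + m\<^sup>2)"
        by (rule cube_trans[OF _ assms(3)])
      then show "x - y \<in> cube 0 (2 * m\<^sup>2)"
        unfolding cube_def mult_2[symmetric] by simp
    qed
    then show "(\<Sum>z\<in>(\<lambda>y. x - y) ` B. 1 / sz z ^ (n - 2)) \<le> 2 * shell_const n * real (2 * m\<^sup>2) ^ (n - (n - 2))"
      using fB assms(2) n_gt unfolding n_def by (intro sum_inverse_power_cube_le) auto
  qed (use b_pos in simp)
  also have "n - (n - 2) = 2" using n_gt by simp
  also have "b * (2 * shell_const n * real (2 * m\<^sup>2) ^ 2) = sigma_const n b * real m ^ 4"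
    by (simp add: sigma_const_def power_mult_distrib power_mult[symmetric])
  finally show ?thesis .
qed

text \<open>
  With \<open>8 * n\<close> further points in the chains, the factor \<open>m ^ (8 * n)\<close> gained from them cancels
  the one lost in the Harnack inequality.
\<close>

lemma sum_visits_le:
  assumes "0 < a" "S \<subseteq> V" "1 \<le> m"
    and lower: "\<And>x z. x \<in> S \<Longrightarrow> z \<in> cube x (m\<^sup>2 + L) \<Longrightarrow> a / sz (x - z) ^ (n - 2) \<le> cp V x z"
  shows "(\<Sum>u\<in>boundary E S. \<Sum>x\<in>S \<inter> cube u (m\<^sup>2). via S o' u x) \<le> visit_const n a b L * real m ^ 5 * Phi S o'"
proof -
  define j where "j = 8 * n"
  define \<sigma> where "\<sigma> = sigma_const n b * real m ^ 4"
  \<comment> \<open>The threshold exceeds the mean \<open>m ^ 4\<close> of one link by a factor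
    \<open>m\<close>, so every additional point of a chain gains \<open>1 / m\<close>.\<close>
  define t where "t = real (Suc j) * real m ^ 5"
  define H where "H = 3 ^ n * harnack_const n a b * (1 + real L) ^ (3 * n)"
  have fS: "finite S" using assms(2) finite_V finite_subset by blast
  have fB: "finite (boundary E S)" using fS by (rule finite_subset[rotated]) (auto simp: boundary_def)
  have m: "1 \<le> real m" using assms(3) by simp
  have sc: "0 \<le> sigma_const n b" using b_pos shell_const_nonneg by (simp add: sigma_const_def)
  have t: "real (Suc j) \<le> t" unfolding t_def using m by (simp add: mult_le_cancel_left1)
  let ?c = "real (Suc j) ^ Suc j / t ^ j"
  have c: "?c * \<sigma> ^ j = real (Suc j) * sigma_const n b ^ j / real m ^ j"
  proof -
    have "t ^ j = real (Suc j) ^ j * (real m ^ (4 * j) * real m ^ j)"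
      by (simp add: t_def power_mult_distrib power_mult[symmetric] power_add[symmetric] del: of_nat_Suc)
    moreover have "\<sigma> ^ j = sigma_const n b ^ j * real m ^ (4 * j)"
      by (simp add: \<sigma>_def power_mult_distrib power_mult[symmetric])
    moreover have "real (Suc j) ^ Suc j = real (Suc j) * real (Suc j) ^ j" by simp
    ultimately show ?thesis using m by (simp del: of_nat_Suc power_Suc)
  qed
  \<comment> \<open>These vertices lie within \<open>m\<^sup>2 + L\<close> of the complement: at
    most \<open>m\<^sup>2\<close> from some \<open>u\<close>, which has a neighbour outside
    \<open>S\<close> within distance \<open>L\<close>.\<close>
  define A where "A = {x \<in> S. \<exists>u\<in>boundary E S. x \<in> cube u (m\<^sup>2)}"
  have near: "(\<Sum>x\<in>A. cp S o' x) \<le> harnack_const n a b * real (m\<^sup>2 + L) ^ (3 * n) * Phi S o'"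
  proof (rule sum_near_complement_le[OF assms(1,2)])
    show "A \<subseteq> S" by (auto simp: A_def)
    show "1 \<le> m\<^sup>2 + L" using assms(3) by (simp add: trans_le_add1)
    fix x assume "x \<in> A"
    then obtain u v where uv: "x \<in> S" "x \<in> cube u (m\<^sup>2)" "v \<notin> S" "{u, v} \<in> E"
      by (auto simp: A_def boundary_def)
    have "u \<in> cube x (m\<^sup>2)" using uv(2) by (rule cube_symD)
    then have "v \<in> cube x (m\<^sup>2 + L)"
      using edge_cube[OF uv(4)] by (rule cube_trans)
    then show "\<exists>z. z \<notin> S \<and> z \<in> cube x (m\<^sup>2 + L) \<and> a / sz (x - z) ^ (n - 2) \<le> cp V x z"
      using uv lower by blast
  qed
  \<comment> \<open>The exponent \<open>8 * n\<close> is \<open>2 * n\<close> for the number of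
    \<open>u\<close> sharing a point \<open>x\<close>, plus \<open>6 * n\<close> for the Harnack
    loss at radius of order \<open>m\<^sup>2\<close>.\<close>
  have "(\<Sum>u\<in>boundary E S. \<Sum>x\<in>S \<inter> cube u (m\<^sup>2). cp S o' x) \<le> H * real m ^ (8 * n) * Phi S o'"
  proof -
    have "(\<Sum>u\<in>boundary E S. \<Sum>x\<in>S \<inter> cube u (m\<^sup>2). cp S o' x)
        = (\<Sum>u\<in>boundary E S. \<Sum>x\<in>{x \<in> A. x \<in> cube u (m\<^sup>2)}. cp S o' x)"
      by (intro sum.cong) (auto simp: A_def)
    also have "\<dots> = (\<Sum>x\<in>A. \<Sum>u\<in>{u \<in> boundary E S. x \<in> cube u (m\<^sup>2)}. cp S o' x)"
      using fS fB by (intro sum.swap_restrict) (auto simp: A_def)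
    also have "\<dots> \<le> (\<Sum>x\<in>A. (3 * real m ^ 2) ^ n * cp S o' x)"
    proof (rule sum_mono)
      fix x assume "x \<in> A"
      have "{u \<in> boundary E S. x \<in> cube u (m\<^sup>2)} \<subseteq> cube x (m\<^sup>2)" by (rule subsetI, elim CollectE conjE, rule cube_symD)
      from card_mono[OF finite_cube this]
      have "card {u \<in> boundary E S. x \<in> cube u (m\<^sup>2)} \<le> (2 * m\<^sup>2 + 1) ^ n"
        by (simp only: card_cube n_def)
      also have "\<dots> \<le> (3 * m\<^sup>2) ^ n" using assms(3) by (intro power_mono) auto
      finally have "real (card {u \<in> boundary E S. x \<in> cube u (m\<^sup>2)}) \<le> real ((3 * m\<^sup>2) ^ n)"
        by (simp only: of_nat_le_iff)
      then have "real (card {u \<in> boundary E S. x \<in> cube u (m\<^sup>2)}) * cp S o' x \<le> (3 * real m ^ 2) ^ n * cp S o' x"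
        using cp_nonneg by (intro mult_right_mono) auto
      then show "(\<Sum>u\<in>{u \<in> boundary E S. x \<in> cube u (m\<^sup>2)}. cp S o' x) \<le> (3 * real m ^ 2) ^ n * cp S o' x"
        by simp
    qed
    also have "\<dots> = (3 * real m ^ 2) ^ n * (\<Sum>x\<in>A. cp S o' x)"
      by (simp add: sum_distrib_left)
    also have "\<dots> \<le> (3 * real m ^ 2) ^ n * (harnack_const n a b * real (m\<^sup>2 + L) ^ (3 * n) * Phi S o')"
      using near by (intro mult_left_mono) auto
    also have "\<dots> \<le> (3 * real m ^ 2) ^ n * (harnack_const n a b * ((1 + real L) * real m ^ 2) ^ (3 * n) * Phi S o')"
    proof (intro mult_left_mono mult_right_mono Phi_nonneg power_mono)
      show "real (m\<^sup>2 + L) \<le> (1 + real L) * real m ^ 2"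
        using m by (simp add: distrib_right mult_le_cancel_left1)
    qed (use assms(1) in \<open>auto simp: harnack_const_def\<close>)
    also have "\<dots> = H * real m ^ (8 * n) * Phi S o'"
      by (simp add: H_def power_mult_distrib power_mult[symmetric] power_add[symmetric] mult_ac)
    finally show ?thesis .
  qed
  note sum_near = this
  have "(\<Sum>u\<in>boundary E S. \<Sum>x\<in>S \<inter> cube u (m\<^sup>2). via S o' u x)
      \<le> (\<Sum>u\<in>boundary E S. t * cp S o' u + ?c * ((\<Sum>x\<in>S \<inter> cube u (m\<^sup>2). cp S o' x) * \<sigma> ^ j))"
  proof (intro sum_mono via_sum_le[OF fS _ _ t])
    fix u x assume "x \<in> S \<inter> cube u (m\<^sup>2)"
    then show "(\<Sum>y\<in>S \<inter> cube u (m\<^sup>2). cp S x y) \<le> \<sigma>"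
      unfolding \<sigma>_def using assms by (intro sum_cp_cube_le) auto
  qed (use fS sc in \<open>auto simp: \<sigma>_def\<close>)
  also have "\<dots> = (\<Sum>u\<in>boundary E S. t * cp S o' u + (?c * \<sigma> ^ j) * (\<Sum>x\<in>S \<inter> cube u (m\<^sup>2). cp S o' x))"
    by (simp only: mult.commute[of "\<sigma> ^ j"] mult.assoc)
  also have "\<dots> = t * Phi S o' + (?c * \<sigma> ^ j) * (\<Sum>u\<in>boundary E S. \<Sum>x\<in>S \<inter> cube u (m\<^sup>2). cp S o' x)"
    by (simp only: Phi_def sum.distrib sum_distrib_left[symmetric])
  also have "\<dots> \<le> t * Phi S o' + (?c * \<sigma> ^ j) * (H * real m ^ (8 * n) * Phi S o')"
    unfolding c using sum_near sc by (intro add_left_mono mult_left_mono) auto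
  also have "(?c * \<sigma> ^ j) * (H * real m ^ (8 * n) * Phi S o') = real (Suc j) * sigma_const n b ^ j * H * Phi S o'"
    unfolding c using m by (simp add: j_def)
  also have "t * Phi S o' + real (Suc j) * sigma_const n b ^ j * H * Phi S o'
      \<le> t * Phi S o' + real (Suc j) * sigma_const n b ^ j * H * Phi S o' * real m ^ 5"
  proof -
    have "0 \<le> real (Suc j) * sigma_const n b ^ j * H * Phi S o'"
      using sc Phi_nonneg assms(1) by (auto simp: H_def harnack_const_def)
    then show ?thesis
      using mult_left_mono[of 1 "real m ^ 5" "real (Suc j) * sigma_const n b ^ j * H * Phi S o'"] m
      by (simp add: one_le_power)
  qed
  also have "\<dots> = visit_const n a b L * real m ^ 5 * Phi S o'"
    by (simp add: visit_const_def t_def j_def H_def algebra_simps)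
  finally show ?thesis .
qed

end

section \<open>The bound in finite volume\<close>

definition mass_upper :: "nat \<Rightarrow> real \<Rightarrow> real" where
  "mass_upper n b = 4 * b * (18 * shell_const n + 3 ^ n)"

definition mass_lower :: "nat \<Rightarrow> real \<Rightarrow> real" where
  "mass_lower n a = a / 3 ^ (n - 2)"

text \<open>Product of the constants for the mass of the far points, the triangle, the average over
  \<open>y\<close>, and the decay of visits summed over scales.\<close>

definition error_const :: "nat \<Rightarrow> real \<Rightarrow> real \<Rightarrow> nat \<Rightarrow> real" where
  "error_const n a b L = mass_upper n b * (b\<^sup>2 * (2 * 2 ^ n * shell_const n)) *
     ((16 * shell_const n + 8) * 3 ^ n) * (128 * visit_const n a b L)"

lemma sum_powers_half_le: "(\<Sum>i\<le>I. 1 / 2 ^ i) \<le> (2 :: real)"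
proof -
  have "(\<Sum>i\<le>I. 1 / 2 ^ i) = 2 - (1 / 2 ^ I :: real)"
    by (induction I) (auto simp: field_simps)
  then show ?thesis by simp
qed

lemma power_add_power_le:
  fixes x y :: nat
  assumes "0 < k"
  shows "x ^ k + y ^ k \<le> (x + y) ^ k"
proof -
  have "x ^ Suc j + y ^ Suc j \<le> (x + y) ^ Suc j" for j
  proof (induction j)
    case (Suc j)
    have "x ^ Suc (Suc j) + y ^ Suc (Suc j) \<le> (x + y) * (x ^ Suc j + y ^ Suc j)"
      by (simp add: algebra_simps)
    also have "\<dots> \<le> (x + y) * (x + y) ^ Suc j"
      using Suc.IH by (rule mult_le_mono2)
    finally show ?case by simp
  qed simp
  then show ?thesis using assms by (metis Suc_pred)
qed

text \<open>Take the smallest scale whose cube contains \<open>x\<close>: at the preceding one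
  \<open>x\<close> was outside. Radii grow by 4 per scale, whence 64, the cube of 4.\<close>

lemma dyadic_scale_bound:
  fixes x u :: "int ^ 'd"
  assumes "1 \<le> \<kappa>" "x \<in> cube u ((\<kappa> * 2 ^ I)\<^sup>2)"
  shows "1 / max (real (\<kappa>\<^sup>2)) (sz (x - u)) ^ 3
    \<le> (\<Sum>i\<le>I. of_bool (x \<in> cube u ((\<kappa> * 2 ^ i)\<^sup>2)) * (64 / real (\<kappa> * 2 ^ i) ^ 6))"
proof -
  let ?P = "\<lambda>i. x \<in> cube u ((\<kappa> * 2 ^ i)\<^sup>2)"
  let ?M = "max (real (\<kappa>\<^sup>2)) (sz (x - u))"
  define i where "i = (LEAST i. ?P i)"
  have i: "?P i" unfolding i_def by (rule LeastI[of ?P, OF assms(2)])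
  have "i \<le> I" unfolding i_def by (rule Least_le[of ?P, OF assms(2)])
  have \<kappa>: "0 < real \<kappa>" using assms(1) by simp
  have "real (\<kappa> * 2 ^ i) ^ 6 \<le> 64 * ?M ^ 3"
  proof (cases i)
    case 0
    have "real (\<kappa>\<^sup>2) ^ 3 \<le> ?M ^ 3" by (intro power_mono) auto
    moreover have "real (\<kappa> * 2 ^ i) ^ 6 = real (\<kappa>\<^sup>2) ^ 3"
      using 0 by (simp add: power_mult[symmetric])
    moreover have "0 \<le> ?M ^ 3" by (simp add: le_max_iff_disj)
    ultimately show ?thesis by linarith
  next
    case (Suc k)
    then have "\<not> ?P k" unfolding i_def using not_less_Least[of k ?P] by simp
    then have "\<not> sz (x - u) \<le> real ((\<kappa> * 2 ^ k)\<^sup>2)"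
      using assms(1) by (subst sz_le_iff) (auto simp: cube_def)
    then have "real ((\<kappa> * 2 ^ k)\<^sup>2) \<le> ?M" by simp
    then have "real ((\<kappa> * 2 ^ k)\<^sup>2) ^ 3 \<le> ?M ^ 3" by (intro power_mono) auto
    moreover have "real (\<kappa> * 2 ^ i) ^ 6 = 64 * real ((\<kappa> * 2 ^ k)\<^sup>2) ^ 3"
      unfolding Suc by (simp add: power_mult_distrib power_mult[symmetric])
    ultimately show ?thesis by linarith
  qed
  moreover have "0 < ?M" using assms(1) by (simp add: less_max_iff_disj)
  ultimately have "1 / ?M ^ 3 \<le> 64 / real (\<kappa> * 2 ^ i) ^ 6"
    using \<kappa> by (simp add: divide_simps del: of_nat_mult of_nat_power)
  also have "\<dots> = of_bool (?P i) * (64 / real (\<kappa> * 2 ^ i) ^ 6)" using i by simp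
  also have "\<dots> \<le> (\<Sum>i\<le>I. of_bool (?P i) * (64 / real (\<kappa> * 2 ^ i) ^ 6))"
    using \<open>i \<le> I\<close> by (intro member_le_sum) auto
  finally show ?thesis .
qed

context lattice_percolation
begin

section \<open>Decay of visits over dyadic scales\<close>

lemma visit_const_nonneg: "0 < a \<Longrightarrow> 0 \<le> visit_const n a b L"
  unfolding visit_const_def sigma_const_def harnack_const_def
  using b_pos shell_const_nonneg by (intro add_nonneg_nonneg mult_nonneg_nonneg) auto

lemma finite_boundary: "S \<subseteq> V \<Longrightarrow> finite (boundary E S)"
  by (rule finite_subset[OF _ finite_V]) (auto simp: boundary_def)

text \<open>At scale \<open>m\<close> the visits contribute \<open>m ^ 5\<close> and the triangle
  \<open>m ^ (- 6)\<close>. This margin of one power makes the series over scales geometric, with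
  total at most twice its first term.\<close>

lemma sum_via_decay_le:
  assumes "0 < a" "S \<subseteq> V" "S \<subseteq> cube 0 r" "1 \<le> \<kappa>" "2 * r \<le> (\<kappa> * 2 ^ I)\<^sup>2"
    and lower: "\<And>x z. x \<in> S \<Longrightarrow> z \<in> cube x ((\<kappa> * 2 ^ I)\<^sup>2 + L) \<Longrightarrow> a / sz (x - z) ^ (n - 2) \<le> cp V x z"
  shows "(\<Sum>u\<in>boundary E S. \<Sum>x\<in>S. via S o' u x / max (real (\<kappa>\<^sup>2)) (sz (x - u)) ^ 3)
    \<le> 128 * visit_const n a b L / real \<kappa> * Phi S o'"
proof -
  let ?m = "\<lambda>i. \<kappa> * 2 ^ i" and ?C = "visit_const n a b L"
  have fS: "finite S" using assms(2) finite_V finite_subset by blast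
  have xu: "x \<in> cube u ((?m I)\<^sup>2)" if "x \<in> S" "u \<in> boundary E S" for x u
  proof -
    have "u \<in> cube 0 r" "x \<in> cube 0 r" using that assms(3) by (auto simp: boundary_def)
    then have "x \<in> cube u (r + r)" by (intro cube_trans[OF cube_symD])
    then show ?thesis using cube_mono[of "r + r" "(?m I)\<^sup>2" u] assms(5) by auto
  qed
  have "(\<Sum>u\<in>boundary E S. \<Sum>x\<in>S. via S o' u x / max (real (\<kappa>\<^sup>2)) (sz (x - u)) ^ 3)
      \<le> (\<Sum>u\<in>boundary E S. \<Sum>x\<in>S. via S o' u x * (\<Sum>i\<le>I. of_bool (x \<in> cube u ((?m i)\<^sup>2)) * (64 / real (?m i) ^ 6)))"
  proof (intro sum_mono)
    fix u x assume "u \<in> boundary E S" "x \<in> S"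
    then show "via S o' u x / max (real (\<kappa>\<^sup>2)) (sz (x - u)) ^ 3
        \<le> via S o' u x * (\<Sum>i\<le>I. of_bool (x \<in> cube u ((?m i)\<^sup>2)) * (64 / real (?m i) ^ 6))"
      using mult_left_mono[OF dyadic_scale_bound[OF assms(4) xu] via_nonneg] by simp
  qed
  also have "\<dots> = (\<Sum>i\<le>I. 64 / real (?m i) ^ 6 * (\<Sum>u\<in>boundary E S. \<Sum>x\<in>S \<inter> cube u ((?m i)\<^sup>2). via S o' u x))"
  proof -
    have "(\<Sum>x\<in>S \<inter> cube u ((?m i)\<^sup>2). via S o' u x) = (\<Sum>x\<in>S. via S o' u x * of_bool (x \<in> cube u ((?m i)\<^sup>2)))" for u i
      using fS by (intro sum.mono_neutral_cong_left) auto
    then have "(\<Sum>i\<le>I. 64 / real (?m i) ^ 6 * (\<Sum>u\<in>boundary E S. \<Sum>x\<in>S \<inter> cube u ((?m i)\<^sup>2). via S o' u x))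
      = (\<Sum>i\<le>I. \<Sum>u\<in>boundary E S. \<Sum>x\<in>S. via S o' u x * (of_bool (x \<in> cube u ((?m i)\<^sup>2)) * (64 / real (?m i) ^ 6)))"
      by (simp only: sum_distrib_left mult_ac)
    also have "\<dots> = (\<Sum>u\<in>boundary E S. \<Sum>i\<le>I. \<Sum>x\<in>S. via S o' u x * (of_bool (x \<in> cube u ((?m i)\<^sup>2)) * (64 / real (?m i) ^ 6)))"
      by (rule sum.swap)
    also have "\<dots> = (\<Sum>u\<in>boundary E S. \<Sum>x\<in>S. \<Sum>i\<le>I. via S o' u x * (of_bool (x \<in> cube u ((?m i)\<^sup>2)) * (64 / real (?m i) ^ 6)))"
      by (intro sum.cong refl sum.swap)
    finally show ?thesis unfolding sum_distrib_left by (rule sym)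
  qed
  also have "\<dots> \<le> (\<Sum>i\<le>I. 64 / real (?m i) ^ 6 * (?C * real (?m i) ^ 5 * Phi S o'))"
  proof (intro sum_mono mult_left_mono sum_visits_le[OF assms(1,2)])
    fix i x z assume "i \<in> {..I}" "x \<in> S" "z \<in> cube x ((?m i)\<^sup>2 + L)"
    moreover have "?m i \<le> ?m I" using \<open>i \<in> {..I}\<close> by (auto intro: power_increasing)
    then have "(?m i)\<^sup>2 + L \<le> (?m I)\<^sup>2 + L" by (simp add: power_mono)
    then have "cube x ((?m i)\<^sup>2 + L) \<subseteq> cube x ((?m I)\<^sup>2 + L)" by (rule cube_mono)
    ultimately show "a / sz (x - z) ^ (n - 2) \<le> cp V x z" using lower by blast
  qed (use assms(4) in auto)
  also have "\<dots> = 64 * ?C * Phi S o' / real \<kappa> * (\<Sum>i\<le>I. 1 / 2 ^ i)"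
    unfolding sum_distrib_left
  proof (rule sum.cong[OF refl])
    fix i
    have "0 < real \<kappa>" using assms(4) by simp
    then have "64 / real (?m i) ^ 6 * (?C * real (?m i) ^ 5 * Phi S o') = 64 * ?C * Phi S o' / real (?m i)"
      by (simp add: power_numeral_reduce del: of_nat_mult of_nat_power)
    then show "64 / real (?m i) ^ 6 * (?C * real (?m i) ^ 5 * Phi S o') = 64 * ?C * Phi S o' / real \<kappa> * (1 / 2 ^ i)"
      by simp
  qed
  also have "\<dots> \<le> 64 * ?C * Phi S o' / real \<kappa> * 2"
    using visit_const_nonneg[OF assms(1)] Phi_nonneg[of S o']
    by (intro mult_left_mono sum_powers_half_le) auto
  also have "\<dots> = 128 * ?C / real \<kappa> * Phi S o'" by simp
  finally show ?thesis .
qed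

section \<open>Size of the rerouting boxes and mass of an annulus\<close>

lemma card_edges_touching_le:
  "card {e \<in> F. e \<inter> cube u r \<noteq> {}} \<le> (2 * r + 1) ^ n * (2 * L + 1) ^ n"
proof -
  let ?f = "\<lambda>(w, h). {w, w + h}"
  have "{e \<in> F. e \<inter> cube u r \<noteq> {}} \<subseteq> ?f ` (cube u r \<times> cube 0 L)"
  proof
    fix e assume e: "e \<in> {e \<in> F. e \<inter> cube u r \<noteq> {}}"
    then obtain w where w: "w \<in> e" "w \<in> cube u r" by blast
    have "e \<in> E" using e by (auto simp: F_def)
    then obtain v where v: "e = {w, v}"
      using edge_range[OF \<open>e \<in> E\<close>] w(1) by (metis insert_commute insert_iff singletonD)
    have "v \<in> cube w L" using edge_cube \<open>e \<in> E\<close> v by simp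
    then have "v - w \<in> cube 0 L" by (simp add: cube_def)
    then show "e \<in> ?f ` (cube u r \<times> cube 0 L)"
      using w v by (intro image_eqI[of _ _ "(w, v - w)"]) auto
  qed
  then have "card {e \<in> F. e \<inter> cube u r \<noteq> {}} \<le> card (?f ` (cube u r \<times> cube 0 L))"
    by (intro card_mono) auto
  also have "\<dots> \<le> card (cube u r \<times> (cube 0 L :: (int ^ 'd) set))" by (rule card_image_le) simp
  also have "\<dots> = (2 * r + 1) ^ n * (2 * L + 1) ^ n"
    by (simp only: card_cartesian_product card_cube n_def)
  finally show ?thesis .
qed

lemma sum_mass_upper:
  assumes "X \<subseteq> cube 0 (2 * R)" "1 \<le> R"
  shows "(\<Sum>x\<in>X. cp V w x) \<le> mass_upper n b * real R ^ 2"
proof -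
  have "(\<Sum>x\<in>X. cp V w x) \<le> (\<Sum>x\<in>X. b * (1 / sz (w - x) ^ (n - 2)))"
    by (intro sum_mono cp_upper_real)
  also have "\<dots> = b * (\<Sum>x\<in>X. 1 / sz (w - x) ^ (n - 2))" by (simp add: sum_distrib_left)
  also have "\<dots> \<le> b * ((18 * shell_const n + 3 ^ n) * real (2 * R) ^ 2)"
    using assms n_gt b_pos unfolding n_def by (intro mult_left_mono sum_far_inverse_power_le) auto
  also have "\<dots> = mass_upper n b * real R ^ 2"
    by (simp add: mass_upper_def power_mult_distrib)
  finally show ?thesis .
qed

text \<open>The inner cube is removed because \<open>x\<close> has to avoid the boxes in which
  configurations are changed; at least \<open>R ^ n\<close> points remain, all within
  \<open>3 * R\<close> of \<open>y\<close>.\<close>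

lemma sum_mass_lower:
  fixes R :: nat
  assumes "0 < a" "1 \<le> R" "y \<in> cube 0 R"
    and lower: "\<And>x. x \<in> cube 0 (2 * R) \<Longrightarrow> a / sz (y - x) ^ (n - 2) \<le> cp V y x"
  shows "mass_lower n a * real R ^ 2 \<le> (\<Sum>x\<in>cube 0 (2 * R) - cube 0 R. cp V y x)"
proof -
  let ?X = "cube 0 (2 * R) - cube 0 R :: (int ^ 'd) set"
  have "cube (0 :: int ^ 'd) R \<subseteq> cube 0 (2 * R)" by (rule cube_mono) simp
  then have "card ?X = (2 * (2 * R) + 1) ^ n - (2 * R + 1) ^ n"
    by (subst card_Diff_subset) (simp_all only: finite_cube card_cube n_def)
  moreover have "2 * R + 1 + 2 * R = 2 * (2 * R) + 1" by simp
  with power_add_power_le[of n "2 * R + 1" "2 * R"] n_gt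
  have "(2 * R + 1) ^ n + (2 * R) ^ n \<le> (2 * (2 * R) + 1) ^ n" by (simp only:)
  moreover have "R ^ n \<le> (2 * R) ^ n" by (intro power_mono) auto
  ultimately have "R ^ n \<le> card ?X" by linarith
  then have card: "real R ^ n \<le> real (card ?X)" by (metis of_nat_le_iff of_nat_power)
  have "mass_lower n a * real R ^ 2 = real R ^ n * (a / (3 * real R) ^ (n - 2))"
  proof -
    have "(n - 2) + 2 = n" using n_gt by simp
    then have "real R ^ n = real R ^ (n - 2) * real R ^ 2"
      by (simp only: power_add[symmetric])
    then show ?thesis using assms(2) by (simp add: mass_lower_def power_mult_distrib)
  qed
  also have "\<dots> \<le> real (card ?X) * (a / (3 * real R) ^ (n - 2))"
    using card assms(1) by (intro mult_right_mono) auto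
  also have "\<dots> = (\<Sum>x\<in>?X. a / (3 * real R) ^ (n - 2))" by simp
  also have "\<dots> \<le> (\<Sum>x\<in>?X. cp V y x)"
  proof (rule sum_mono)
    fix x assume x: "x \<in> ?X"
    have "sz x \<le> real (2 * R)" using x assms(2) by (subst sz_le_iff) auto
    moreover have "sz y \<le> real R" using assms(2,3) by (subst sz_le_iff) auto
    ultimately have "sz (y - x) \<le> 3 * real R"
      using sz_triangle[of y x 0] sz_commute[of x 0] by simp
    then have "a / (3 * real R) ^ (n - 2) \<le> a / sz (y - x) ^ (n - 2)"
      using assms(1,2) sz_pos[of "y - x"] by (intro divide_left_mono power_mono mult_pos_pos zero_less_power) auto
    then show "a / (3 * real R) ^ (n - 2) \<le> cp V y x" using lower[of x] x by simp
  qed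
  finally show ?thesis .
qed

text \<open>
  Summed over the far points \<open>x\<close>, the loss caused by \<open>y\<close> being connected to \<open>x\<close> only through
  the cluster of \<open>o'\<close> is an open triangle based at a vertex of the path from \<open>o'\<close> to \<open>u\<close>.
\<close>

lemma sum_disjoint_clusters_ge:
  assumes "S \<subseteq> V" "X \<subseteq> cube 0 (2 * R)" "1 \<le> R"
    and mass: "M \<le> (\<Sum>x\<in>X. cp V y x)"
  shows "M * cp S o' u
      - mass_upper n b * real R ^ 2 * (b\<^sup>2 * (2 * 2 ^ n * shell_const n)) * (\<Sum>a\<in>S. via S o' u a * (1 / sz (a - y) ^ 3))
    \<le> (\<Sum>x\<in>X. sep S o' u y x)"
proof -
  have fS: "finite S" using assms(1) finite_V finite_subset by blast
  let ?U = "mass_upper n b * real R ^ 2" and ?T = "b\<^sup>2 * (2 * 2 ^ n * shell_const n)"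
  let ?g = "\<lambda>w. \<Sum>a\<in>S. via S o' u a * cp V a w"
  have U: "0 \<le> ?U" using b_pos shell_const_nonneg by (simp add: mass_upper_def)
  have g: "0 \<le> ?g w" for w using via_nonneg cp_nonneg by (intro sum_nonneg mult_nonneg_nonneg) auto
  have triangle: "(\<Sum>w\<in>V. cp V a w * cp V y w) \<le> ?T * (1 / sz (a - y) ^ 3)" for a
  proof -
    have "(\<Sum>w\<in>V. cp V a w * cp V y w)
        \<le> (\<Sum>w\<in>V. b\<^sup>2 * (1 / sz (a - w) ^ (n - 2) * (1 / sz (w - y) ^ (n - 2))))"
    proof (rule sum_mono)
      fix w
      have "cp V a w * cp V w y \<le> (b * (1 / sz (a - w) ^ (n - 2))) * (b * (1 / sz (w - y) ^ (n - 2)))"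
        using cp_nonneg b_pos sz_pos[of "a - w"] by (intro mult_mono cp_upper_real) auto
      then show "cp V a w * cp V y w \<le> b\<^sup>2 * (1 / sz (a - w) ^ (n - 2) * (1 / sz (w - y) ^ (n - 2)))"
        using cp_sym[of V y w] by (simp add: power2_eq_square mult_ac)
    qed
    also have "\<dots> = b\<^sup>2 * (\<Sum>w\<in>V. 1 / sz (a - w) ^ (n - 2) * (1 / sz (w - y) ^ (n - 2)))"
      by (simp only: sum_distrib_left)
    also have "\<dots> \<le> b\<^sup>2 * (2 * 2 ^ n * shell_const n / sz (a - y) ^ 3)"
      using finite_V n_gt unfolding n_def by (intro mult_left_mono sum_convolution_le) auto
    finally show ?thesis by simp
  qed
  have "(\<Sum>x\<in>X. \<Sum>w\<in>V. ?g w * (cp V y w * cp V w x)) = (\<Sum>w\<in>V. \<Sum>x\<in>X. ?g w * (cp V y w * cp V w x))"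
    by (rule sum.swap)
  also have "\<dots> = (\<Sum>w\<in>V. ?g w * cp V y w * (\<Sum>x\<in>X. cp V w x))"
    by (simp only: sum_distrib_left mult.assoc)
  \<comment> \<open>The mass bound is uniform in \<open>w\<close>, so the connection from
    \<open>w\<close> to \<open>x\<close> factors out.\<close>
  also have "\<dots> \<le> (\<Sum>w\<in>V. ?g w * cp V y w * ?U)"
    using g cp_nonneg assms(2,3) by (intro sum_mono mult_left_mono sum_mass_upper) auto
  also have "\<dots> = ?U * (\<Sum>a\<in>S. via S o' u a * (\<Sum>w\<in>V. cp V a w * cp V y w))"
  proof -
    have "(\<Sum>w\<in>V. ?g w * cp V y w * ?U) = ?U * (\<Sum>w\<in>V. \<Sum>a\<in>S. via S o' u a * (cp V a w * cp V y w))"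
      by (simp only: sum_distrib_left sum_distrib_right mult_ac)
    also have "(\<Sum>w\<in>V. \<Sum>a\<in>S. via S o' u a * (cp V a w * cp V y w)) = (\<Sum>a\<in>S. \<Sum>w\<in>V. via S o' u a * (cp V a w * cp V y w))"
      by (rule sum.swap)
    finally show ?thesis by (simp only: sum_distrib_left)
  qed
  also have "\<dots> \<le> ?U * (\<Sum>a\<in>S. via S o' u a * (?T * (1 / sz (a - y) ^ 3)))"
    using U via_nonneg triangle by (intro mult_left_mono sum_mono) auto
  also have "\<dots> = ?U * ?T * (\<Sum>a\<in>S. via S o' u a * (1 / sz (a - y) ^ 3))"
    by (simp only: sum_distrib_left mult_ac)
  finally have err: "(\<Sum>x\<in>X. \<Sum>w\<in>V. ?g w * (cp V y w * cp V w x))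
    \<le> ?U * ?T * (\<Sum>a\<in>S. via S o' u a * (1 / sz (a - y) ^ 3))" .
  have "M * cp S o' u \<le> (\<Sum>x\<in>X. cp S o' u * cp V y x)"
    using mult_left_mono[OF mass cp_nonneg[of S o' u]] by (simp add: sum_distrib_left mult.commute)
  then have "M * cp S o' u - ?U * ?T * (\<Sum>a\<in>S. via S o' u a * (1 / sz (a - y) ^ 3))
      \<le> (\<Sum>x\<in>X. cp S o' u * cp V y x - (\<Sum>w\<in>V. ?g w * (cp V y w * cp V w x)))"
    using err by (simp add: sum_subtractf)
  also have "\<dots> \<le> (\<Sum>x\<in>X. sep S o' u y x)"
    by (intro sum_mono disjoint_clusters_ge[OF fS assms(1)])
  finally show ?thesis .
qed

text \<open>\<open>r\<close> encloses \<open>S\<close>, \<open>R\<close> is the inner radius of the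
  annulus of \<open>x\<close>, and \<open>R1\<close> bounds the region where the lower two-point
  bound is needed. None of them, nor the number of scales \<open>I\<close>, occurs in the
  conclusion, which makes it uniform in \<open>S\<close>.\<close>

lemma Phi_bound:
  fixes S :: "(int ^ 'd) set" and \<kappa> I r R R1 :: nat
  defines "K \<equiv> \<kappa>\<^sup>2"
  assumes "0 < a" "S \<subseteq> cube 0 r" "1 \<le> \<kappa>" "2 * r \<le> (\<kappa> * 2 ^ I)\<^sup>2"
    and R: "r + K + L \<le> R" "2 * R \<le> R1" "r + (\<kappa> * 2 ^ I)\<^sup>2 + L \<le> R1"
    and V: "cube 0 R1 \<subseteq> V"
    and lower: "\<And>x z. x \<in> cube 0 R1 \<Longrightarrow> z \<in> cube 0 R1 \<Longrightarrow> a / sz (x - z) ^ (n - 2) \<le> cp V x z"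
    and \<kappa>: "2 * error_const n a b L \<le> mass_lower n a * real \<kappa>"
  shows "rho ^ ((2 * (K + L) + 1) ^ n * (2 * L + 1) ^ n) * (mass_lower n a / 2) * Phi S o'
    \<le> 3 ^ n * real ((2 * (K + L) + 1) ^ n) * mass_upper n b"
proof -
  let ?X = "cube 0 (2 * R) - cube 0 R :: (int ^ 'd) set"
  let ?N = "(2 * (K + L) + 1) ^ n * (2 * L + 1) ^ n" and ?M = "(2 * (K + L) + 1) ^ n"
  let ?l = "mass_lower n a" and ?U = "mass_upper n b" and ?T = "b\<^sup>2 * (2 * 2 ^ n * shell_const n)"
  let ?A = "(16 * shell_const n + 8) * 3 ^ n" and ?W = "128 * visit_const n a b L"
  let ?H = "cube 0 K :: (int ^ 'd) set"
  let ?Q = "\<lambda>u. \<Sum>c\<in>S. via S o' u c / max (real K) (sz (c - u)) ^ 3"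
  let ?Z = "\<lambda>u h. \<Sum>c\<in>S. via S o' u c * (1 / sz (c - (u + h)) ^ 3)"
  let ?sum = "\<Sum>u\<in>boundary E S. \<Sum>h\<in>?H. \<Sum>x\<in>?X. sep S o' u (u + h) x"
  have K: "1 \<le> K" using assms(4) by (simp add: K_def)
  have R1: "1 \<le> R" using K R(1) by simp
  have rR1: "r \<le> R1" "R \<le> R1" using R by auto
  have SV: "S \<subseteq> V" using assms(3) cube_mono[OF rR1(1), of 0] V by blast
  have fB: "finite (boundary E S)" by (rule finite_boundary[OF SV])
  have Bd: "u \<in> cube 0 r" if "u \<in> boundary E S" for u using that assms(3) by (auto simp: boundary_def)
  have U: "0 \<le> ?U" using b_pos shell_const_nonneg by (simp add: mass_upper_def)
  have T: "0 \<le> ?T" using shell_const_nonneg by simp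
  have l: "0 \<le> ?l" using assms(2) by (simp add: mass_lower_def)
  have "real R ^ 2 * real K ^ n * (?l / 2 * Phi S o') \<le> ?sum"
  proof -
    have decay: "(\<Sum>u\<in>boundary E S. \<Sum>c\<in>S. via S o' u c / max (real K) (sz (c - u)) ^ 3) \<le> ?W / real \<kappa> * Phi S o'"
      unfolding K_def
    proof (rule sum_via_decay_le[OF assms(2) SV assms(3,4,5)])
      fix x z assume xz: "x \<in> S" "z \<in> cube x ((\<kappa> * 2 ^ I)\<^sup>2 + L)"
      have "z \<in> cube 0 (r + ((\<kappa> * 2 ^ I)\<^sup>2 + L))"
        by (rule cube_trans[OF _ xz(2)]) (use xz(1) assms(3) in auto)
      then have "z \<in> cube 0 R1" using cube_mono[of "r + ((\<kappa> * 2 ^ I)\<^sup>2 + L)" R1 0] R(3) by auto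
      moreover have "x \<in> cube 0 R1" using xz(1) assms(3) cube_mono[OF rR1(1), of 0] by auto
      ultimately show "a / sz (x - z) ^ (n - 2) \<le> cp V x z" by (rule lower[rotated])
    qed
    \<comment> \<open>The main term is the same for all shifts \<open>h\<close> and gains the size
      of the cube, at least \<open>K ^ n\<close>; the loss is summed over \<open>h\<close> first, so
      that both scale like \<open>K ^ n\<close>.\<close>
    have per_u: "real R ^ 2 * real K ^ n * (?l * cp S o' u)
        - ?U * real R ^ 2 * ?T * (?A * real K ^ n) * ?Q u
      \<le> (\<Sum>h\<in>?H. \<Sum>x\<in>?X. sep S o' u (u + h) x)" if u: "u \<in> boundary E S" for u
    proof -
      have "(\<Sum>h\<in>?H. \<Sum>c\<in>S. via S o' u c * (1 / sz (c - (u + h)) ^ 3))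
          = (\<Sum>c\<in>S. via S o' u c * (\<Sum>h\<in>?H. 1 / sz ((c - u) - h) ^ 3))"
        unfolding sum_distrib_left by (subst sum.swap) (simp add: diff_diff_eq)
      also have "\<dots> \<le> (\<Sum>c\<in>S. via S o' u c * (?A * real K ^ n / max (real K) (sz (c - u)) ^ 3))"
        using K n_gt via_nonneg unfolding n_def by (intro sum_mono mult_left_mono sum_shift_inverse_cubed_le) auto
      also have "\<dots> = ?A * real K ^ n * ?Q u"
        unfolding sum_distrib_left by (rule sum.cong) simp_all
      finally have shift: "(\<Sum>h\<in>?H. \<Sum>c\<in>S. via S o' u c * (1 / sz (c - (u + h)) ^ 3))
        \<le> ?A * real K ^ n * ?Q u" .
      have cardH: "real K ^ n \<le> real (card ?H)"
      proof -
        have "card ?H = (2 * K + 1) ^ n" by (simp only: card_cube n_def)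
        moreover have "K ^ n \<le> (2 * K + 1) ^ n" by (intro power_mono) auto
        ultimately show ?thesis by (metis of_nat_le_iff of_nat_power)
      qed
      have "real R ^ 2 * real K ^ n * (?l * cp S o' u) \<le> real (card ?H) * (?l * real R ^ 2 * cp S o' u)"
        using mult_right_mono[OF cardH, of "?l * real R ^ 2 * cp S o' u"] l cp_nonneg[of S o' u]
        by (simp add: mult_ac)
      moreover have "?U * real R ^ 2 * ?T * (\<Sum>h\<in>?H. \<Sum>c\<in>S. via S o' u c * (1 / sz (c - (u + h)) ^ 3))
        \<le> ?U * real R ^ 2 * ?T * (?A * real K ^ n * ?Q u)"
        using U T by (intro mult_left_mono shift) auto
      ultimately have "real R ^ 2 * real K ^ n * (?l * cp S o' u)
          - ?U * real R ^ 2 * ?T * (?A * real K ^ n) * ?Q u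
        \<le> real (card ?H) * (?l * real R ^ 2 * cp S o' u)
          - ?U * real R ^ 2 * ?T * (\<Sum>h\<in>?H. \<Sum>c\<in>S. via S o' u c * (1 / sz (c - (u + h)) ^ 3))"
        by (simp only: mult.assoc)
      also have "\<dots> = (\<Sum>h\<in>?H. ?l * real R ^ 2 * cp S o' u
          - ?U * real R ^ 2 * ?T * ?Z u h)"
        by (simp only: sum_subtractf sum_constant sum_distrib_left)
      also have "\<dots> \<le> (\<Sum>h\<in>?H. \<Sum>x\<in>?X. sep S o' u (u + h) x)"
      proof (intro sum_mono sum_disjoint_clusters_ge[OF SV _ R1])
        fix h assume h: "h \<in> ?H"
        have uh: "u + h \<in> cube 0 R"
        proof -
          have "u + h \<in> cube u K" using h by (simp add: cube_def)
          then have "u + h \<in> cube 0 (r + K)" by (rule cube_trans[OF Bd[OF u]])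
          then show ?thesis using cube_mono[of "r + K" R 0] R(1) by auto
        qed
        show "?l * real R ^ 2 \<le> (\<Sum>x\<in>?X. cp V (u + h) x)"
        proof (rule sum_mass_lower[OF assms(2) R1 uh])
          fix x :: "int ^ 'd" assume "x \<in> cube 0 (2 * R)"
          then show "a / sz (u + h - x) ^ (n - 2) \<le> cp V (u + h) x"
            using uh cube_mono[OF R(2), of 0] cube_mono[OF rR1(2), of 0] by (intro lower) auto
        qed
      qed auto
      finally show ?thesis .
    qed
    \<comment> \<open>The condition on \<kappa> makes the loss at most half of the main term, which
      is then absorbed.\<close>
    have "real R ^ 2 * real K ^ n * (?l / 2 * Phi S o')
        \<le> real R ^ 2 * real K ^ n * (?l * Phi S o' - error_const n a b L / real \<kappa> * Phi S o')"
    proof (rule mult_left_mono)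
      have "0 < real \<kappa>" using assms(4) by simp
      then have "error_const n a b L / real \<kappa> \<le> ?l / 2" using \<kappa> by (simp add: divide_simps mult.commute)
      from mult_right_mono[OF this Phi_nonneg[of S o']]
      show "?l / 2 * Phi S o' \<le> ?l * Phi S o' - error_const n a b L / real \<kappa> * Phi S o'" by simp
    qed simp
    also have "\<dots> = real R ^ 2 * real K ^ n * (?l * Phi S o')
        - ?U * real R ^ 2 * ?T * (?A * real K ^ n) * (?W / real \<kappa> * Phi S o')"
      by (simp add: error_const_def right_diff_distrib)
    also have "\<dots> \<le> real R ^ 2 * real K ^ n * (?l * Phi S o')
        - ?U * real R ^ 2 * ?T * (?A * real K ^ n) * (\<Sum>u\<in>boundary E S. \<Sum>c\<in>S. via S o' u c / max (real K) (sz (c - u)) ^ 3)"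
      using U T shell_const_nonneg[of n] by (intro diff_left_mono mult_left_mono decay) auto
    also have "\<dots> = (\<Sum>u\<in>boundary E S. real R ^ 2 * real K ^ n * (?l * cp S o' u)
        - ?U * real R ^ 2 * ?T * (?A * real K ^ n) * ?Q u)"
      by (simp only: Phi_def sum_subtractf sum_distrib_left)
    also have "\<dots> \<le> ?sum"
      by (intro sum_mono per_u)
    finally show ?thesis .
  qed
  note below = this
  \<comment> \<open>The rerouting box has radius \<open>K + L\<close>: it must contain
    \<open>y = u + h\<close> as well as a neighbour of \<open>u\<close> outside \<open>S\<close>. It
    stays inside \<open>cube 0 R\<close>, which \<open>x\<close> avoids.\<close>
  have above: "rho ^ ?N * (\<Sum>u\<in>boundary E S. sep S o' u (u + h) x) \<le> real ?M * cp V o' x" if h: "h \<in> ?H" and x: "x \<in> ?X" for h x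
  proof (rule sum_disjoint_clusters_le[where D = "\<lambda>u. cube u (K + L)", OF fB SV])
    fix u assume u: "u \<in> boundary E S"
    have D: "cube u (K + L) \<subseteq> cube 0 R"
    proof
      fix w assume "w \<in> cube u (K + L)"
      then have "w \<in> cube 0 (r + (K + L))" by (rule cube_trans[OF Bd[OF u]])
      then show "w \<in> cube 0 R" using cube_mono[of "r + (K + L)" R 0] R(1) by auto
    qed
    then have DV: "cube u (K + L) \<subseteq> V" using cube_mono[OF rR1(2), of 0] V by blast
    obtain v where v: "v \<notin> S" "{u, v} \<in> E" using u by (auto simp: boundary_def)
    then have "v \<in> cube u (K + L)" using edge_cube[OF v(2)] cube_mono[of L "K + L" u] by auto
    then have "\<not> cube u (K + L) \<subseteq> S" using v by blast
    moreover have "u + h \<in> cube u (K + L)" using h by (simp add: cube_def)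
    moreover have "through_paths F (cube u (K + L))"
    proof (rule through_paths_cube)
      show "{e \<in> nearest_neighbour_edges. e \<subseteq> cube u (K + L)} \<subseteq> F"
        using nn_subset DV by (auto simp: F_def)
    qed (use n_gt K in \<open>auto simp: n_def\<close>)
    ultimately show "cube u (K + L) \<subseteq> V \<and> u \<in> cube u (K + L) \<and> u + h \<in> cube u (K + L) \<and> x \<notin> cube u (K + L)
        \<and> \<not> cube u (K + L) \<subseteq> S \<and> through_paths F (cube u (K + L)) \<and> card {e \<in> F. e \<inter> cube u (K + L) \<noteq> {}} \<le> ?N"
      using DV D x card_edges_touching_le[of u "K + L"] by auto
  next
    fix c
    have "{u \<in> boundary E S. c \<in> cube u (K + L)} \<subseteq> cube c (K + L)"
      by (rule subsetI, elim CollectE conjE, rule cube_symD)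
    from card_mono[OF finite_cube this] show "card {u \<in> boundary E S. c \<in> cube u (K + L)} \<le> ?M"
      by (simp only: card_cube n_def)
  qed
  have "rho ^ ?N * ?sum
      = (\<Sum>h\<in>?H. \<Sum>x\<in>?X. rho ^ ?N * (\<Sum>u\<in>boundary E S. sep S o' u (u + h) x))"
  proof -
    have "?sum = (\<Sum>h\<in>?H. \<Sum>u\<in>boundary E S. \<Sum>x\<in>?X. sep S o' u (u + h) x)"
      by (rule sum.swap)
    also have "\<dots> = (\<Sum>h\<in>?H. \<Sum>x\<in>?X. \<Sum>u\<in>boundary E S. sep S o' u (u + h) x)"
      by (intro sum.cong refl sum.swap)
    finally show ?thesis by (simp only: sum_distrib_left)
  qed
  also have "\<dots> \<le> (\<Sum>h\<in>?H. \<Sum>x\<in>?X. real ?M * cp V o' x)"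
    by (intro sum_mono above)
  also have "\<dots> = real (card ?H) * (real ?M * (\<Sum>x\<in>?X. cp V o' x))"
    by (simp only: sum_constant sum_distrib_left)
  also have "\<dots> \<le> (3 * real K) ^ n * (real ?M * (?U * real R ^ 2))"
  proof (intro mult_mono mult_left_mono)
    have "card ?H = (2 * K + 1) ^ n" by (simp only: card_cube n_def)
    also have "\<dots> \<le> (3 * K) ^ n" using K by (intro power_mono) auto
    finally have "real (card ?H) \<le> real ((3 * K) ^ n)" by (simp only: of_nat_le_iff)
    then show "real (card ?H) \<le> (3 * real K) ^ n" by simp
    show "(\<Sum>x\<in>?X. cp V o' x) \<le> ?U * real R ^ 2"
      using R1 by (intro sum_mass_upper) auto
  qed (auto intro!: mult_nonneg_nonneg sum_nonneg cp_nonneg)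
  finally have "rho ^ ?N * ?sum
    \<le> (3 * real K) ^ n * (real ?M * (?U * real R ^ 2))" .
  moreover have "rho ^ ?N * (real R ^ 2 * real K ^ n * (?l / 2 * Phi S o'))
      \<le> rho ^ ?N * ?sum"
    using below rho_pos by (intro mult_left_mono) auto
  \<comment> \<open>Both sides carry the mass \<open>R ^ 2\<close> of the annulus and the number
    \<open>K ^ n\<close> of shifts.\<close>
  ultimately have "(real R ^ 2 * real K ^ n) * (rho ^ ?N * (?l / 2) * Phi S o')
      \<le> (real R ^ 2 * real K ^ n) * (3 ^ n * real ?M * ?U)"
    unfolding power_mult_distrib by (simp only: mult_ac)
  moreover have "0 < real R ^ 2 * real K ^ n" using R1 K by simp
  ultimately show ?thesis by (simp only: mult_le_cancel_left_pos)
qed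

end

section \<open>Infinite sets\<close>

lemma pmf_bernoulli_True_clip: "pmf (bernoulli_pmf p) True = min 1 (max 0 p)"
  by (simp add: bernoulli_pmf.rep_eq)

lemma finite_boundary_sum_bounded:
  fixes E :: "(int ^ 'd) set set" and q a b :: real
  assumes E: "nearest_neighbour_edges \<subseteq> E" "\<And>e. e \<in> E \<Longrightarrow> \<exists>u v. e = {u, v} \<and> v \<in> cube u L"
    and dim: "6 < CARD('d)"
    and q: "0 < q" "q < 1" "pmf (bernoulli_pmf p) True = q"
    and ab: "0 < a" "0 < b"
    and lower: "\<And>x y. a / sz (x - y) ^ (CARD('d) - 2) \<le> tau E p x y"
    and upper: "\<And>x y. tau E p x y \<le> b / sz (x - y) ^ (CARD('d) - 2)"
  shows "\<exists>C. 0 < C \<and> (\<forall>S. finite S \<longrightarrow> (\<Sum>u\<in>boundary E S. tau_in E p S 0 u) \<le> C)"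
proof -
  define n where "n = CARD('d)"
  \<comment> \<open>Finite-volume connection probabilities approach their limit from below; halving
    the constant leaves room for the approximation. The volume depends on \<open>S\<close>, but
    \<open>a'\<close> and the final bound do not.\<close>
  define a' where "a' = a / 2"
  have a': "0 < a'" using ab by (simp add: a'_def)
  interpret bernoulli q using q by unfold_locales auto
  have l: "0 < mass_lower n a'" using a' by (simp add: mass_lower_def)
  obtain k :: nat where k: "2 * error_const n a' b L / mass_lower n a' \<le> real k"
    using real_arch_simple by blast
  define \<kappa> where "\<kappa> = Suc k"
  have \<kappa>: "1 \<le> \<kappa>" "2 * error_const n a' b L \<le> mass_lower n a' * real \<kappa>"
  proof -
    have "2 * error_const n a' b L / mass_lower n a' \<le> real \<kappa>" using k by (simp add: \<kappa>_def)
    then show "2 * error_const n a' b L \<le> mass_lower n a' * real \<kappa>"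
      using l by (simp only: pos_divide_le_eq mult.commute)
  qed (simp add: \<kappa>_def)
  define K where "K = \<kappa>\<^sup>2"
  define c where "c = rho ^ ((2 * (K + L) + 1) ^ n * (2 * L + 1) ^ n) * (mass_lower n a' / 2)"
  define D where "D = 3 ^ n * real ((2 * (K + L) + 1) ^ n) * mass_upper n b"
  have c: "0 < c" unfolding c_def using rho_pos l by (intro mult_pos_pos zero_less_power) auto
  have D: "0 < D"
    unfolding D_def mass_upper_def using ab shell_const_nonneg[of n]
    by (intro mult_pos_pos add_nonneg_pos) auto
  have main: "(\<Sum>u\<in>boundary E S. tau_in E p S 0 u) \<le> D / c" if fS: "finite S" for S :: "(int ^ 'd) set"
  proof -
    define r where "r = nat (Max (insert 0 (linf_norm ` S)))"
    have Sr: "S \<subseteq> cube 0 r"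
    proof
      fix x assume "x \<in> S"
      then have "linf_norm x \<le> Max (insert 0 (linf_norm ` S))" using fS by (intro Max_ge) auto
      then show "x \<in> cube 0 r" by (simp add: cube_def r_def)
    qed
    \<comment> \<open>Any number of scales with \<open>2 ^ I\<close> at least \<open>2 * r\<close>
      would do, since it disappears from the bound.\<close>
    define I where "I = 2 * r"
    have I: "2 * r \<le> (\<kappa> * 2 ^ I)\<^sup>2"
    proof -
      have "I \<le> 2 ^ I" using less_exp[of I] by simp
      also have "\<dots> \<le> \<kappa> * 2 ^ I" using \<kappa> by simp
      also have "\<dots> \<le> (\<kappa> * 2 ^ I)\<^sup>2" using \<kappa> by (intro self_le_power) auto
      finally show ?thesis by (simp add: I_def)
    qed
    define R where "R = r + K + L"
    define R1 where "R1 = 2 * R + (r + (\<kappa> * 2 ^ I)\<^sup>2 + L)"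
    \<comment> \<open>Only finitely many pairs in \<open>cube 0 R1\<close> matter, so one volume
      gives the lower bound for all of them.\<close>
    have "eventually (\<lambda>N. \<forall>xy\<in>cube 0 R1 \<times> cube 0 R1. a' / sz (fst xy - snd xy) ^ (n - 2)
        < tau_in E p (UNIV \<inter> cube 0 N) (fst xy) (snd xy)) sequentially"
    proof (rule eventually_ball_finite)
      show "\<forall>xy\<in>cube 0 R1 \<times> cube 0 R1. eventually (\<lambda>N. a' / sz (fst xy - snd xy) ^ (n - 2)
        < tau_in E p (UNIV \<inter> cube 0 N) (fst xy) (snd xy)) sequentially"
      proof
        fix xy :: "(int ^ 'd) \<times> (int ^ 'd)"
        have "a' / sz (fst xy - snd xy) ^ (n - 2) < a / sz (fst xy - snd xy) ^ (n - 2)"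
          using ab sz_pos[of "fst xy - snd xy"] by (intro divide_strict_right_mono) (auto simp: a'_def)
        also have "\<dots> \<le> tau E p (fst xy) (snd xy)" unfolding n_def by (rule lower)
        finally show "eventually (\<lambda>N. a' / sz (fst xy - snd xy) ^ (n - 2)
            < tau_in E p (UNIV \<inter> cube 0 N) (fst xy) (snd xy)) sequentially"
          by (rule order_tendstoD(1)[OF tau_in_cube_tendsto(1)])
      qed
    qed auto
    then obtain N0 where N0: "\<And>N x z. N0 \<le> N \<Longrightarrow> x \<in> cube 0 R1 \<Longrightarrow> z \<in> cube 0 R1 \<Longrightarrow>
        a' / sz (x - z) ^ (n - 2) < tau_in E p (UNIV \<inter> cube 0 N) x z"
      unfolding eventually_sequentially by force
    define N where "N = max N0 R1"
    define V where "V = cube (0 :: int ^ 'd) N"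
    define F where "F = {e \<in> E. e \<subseteq> V}"
    have fV: "finite V" by (simp add: V_def)
    have fF: "finite F" by (rule finite_subset[of _ "Pow V"]) (auto simp: F_def fV)
    have cp: "bprob q F (\<lambda>\<omega>. conn \<omega> T x y) = tau_in E p T x y" if "T \<subseteq> V" for T x y
    proof -
      have "{e \<in> E. e \<subseteq> T} \<subseteq> F" using that by (auto simp: F_def)
      then show ?thesis using tau_in_eq_bprob[OF fF, of E T p x y] q(3) by (auto simp: F_def)
    qed
    interpret fp: finite_percolation q F V using fF fV by unfold_locales
    interpret lp: lattice_percolation q F V E L n b
    proof unfold_locales
      fix x y
      have "fp.cp V x y = tau_in E p (UNIV \<inter> cube 0 N) x y"
        unfolding fp.cp_def using cp[of V x y] by (simp add: V_def)
      also have "\<dots> \<le> tau E p x y" by (rule tau_in_cube_tendsto(2))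
      also have "\<dots> \<le> b / sz (x - y) ^ (n - 2)" unfolding n_def by (rule upper)
      finally show "fp.cp V x y \<le> b / sz (x - y) ^ (n - 2)" .
    qed (use E dim ab in \<open>auto simp: F_def n_def\<close>)
    have R1V: "cube 0 R1 \<subseteq> V" unfolding V_def by (rule cube_mono) (simp add: N_def)
    have "c * lp.Phi S 0 \<le> D"
      unfolding c_def D_def K_def
    proof (rule lp.Phi_bound[OF a' Sr \<kappa>(1) I _ _ _ R1V _ \<kappa>(2)])
      show "r + \<kappa>\<^sup>2 + L \<le> R" by (simp add: R_def K_def)
      show "2 * R \<le> R1" "r + (\<kappa> * 2 ^ I)\<^sup>2 + L \<le> R1" by (simp_all add: R1_def)
      fix x z :: "int ^ 'd" assume "x \<in> cube 0 R1" "z \<in> cube 0 R1"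
      then have "a' / sz (x - z) ^ (n - 2) < tau_in E p (UNIV \<inter> cube 0 N) x z"
        by (intro N0) (auto simp: N_def)
      then show "a' / sz (x - z) ^ (n - 2) \<le> fp.cp V x z"
        unfolding fp.cp_def using cp[of V x z] by (simp add: V_def)
    qed
    moreover have "S \<subseteq> V" using Sr cube_mono[of r R1 "0 :: int ^ 'd"] R1V by (auto simp: R1_def)
    then have "lp.Phi S 0 = (\<Sum>u\<in>boundary E S. tau_in E p S 0 u)"
      unfolding lp.Phi_def fp.cp_def by (intro sum.cong refl cp)
    ultimately show ?thesis using c by (simp add: pos_le_divide_eq mult.commute)
  qed
  then show ?thesis using c D by (intro exI[of _ "D / c"]) auto
qed

text \<open>For a finite set of exit edges and a large cube, each edge also leaves the intersection
  of \<open>S\<close> with the cube. The finite bound applies there, with additional nonnegative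
  terms at the edge of the cube; then the cube grows, and last the set of edges. A vertex has at
  most \<open>card (cube 0 L)\<close> neighbours.\<close>

lemma phi_le_of_finite:
  fixes S :: "(int ^ 'd) set"
  assumes edges: "\<And>u v. {u, v} \<in> E \<Longrightarrow> v \<in> cube u L" and p: "0 \<le> p" "p \<le> 1"
    and C: "\<And>T. finite T \<Longrightarrow> (\<Sum>u\<in>boundary E T. tau_in E p T 0 u) \<le> C"
  shows "phi E p S \<le> ennreal (real (card (cube (0 :: int ^ 'd) L)) * C)"
  unfolding phi_def
proof (rule infsum_le_finite_sums)
  show "(\<lambda>(u, v). ennreal (tau_in E p S 0 u * p)) summable_on {(u, v). u \<in> S \<and> v \<notin> S \<and> {u, v} \<in> E}"
    by (rule nonneg_summable_on_complete) simp
next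
  fix A assume A: "finite A" "A \<subseteq> {(u, v). u \<in> S \<and> v \<notin> S \<and> {u, v} \<in> E}"
  let ?D = "real (card (cube (0 :: int ^ 'd) L))"
  obtain n0 where n0: "\<And>u v. (u, v) \<in> A \<Longrightarrow> u \<in> cube 0 n0"
  proof -
    define n0 where "n0 = nat (Max (insert 0 (linf_norm ` fst ` A)))"
    have "u \<in> cube 0 n0" if "(u, v) \<in> A" for u v
    proof -
      have "linf_norm u \<in> insert 0 (linf_norm ` fst ` A)" using that by force
      then have "linf_norm u \<le> Max (insert 0 (linf_norm ` fst ` A))" using A(1) by (intro Max_ge) auto
      then show ?thesis by (simp add: cube_def n0_def)
    qed
    then show ?thesis using that by blast
  qed
  have nonneg: "0 \<le> tau_in E p T x y" for T x y by (simp add: tau_in_def)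
  have le: "(\<Sum>(u, v)\<in>A. tau_in E p (S \<inter> cube 0 n) 0 u * p) \<le> ?D * C" if n: "n0 \<le> n" for n
  proof -
    let ?T = "S \<inter> cube 0 n"
    have sub: "A \<subseteq> Sigma (boundary E ?T) (\<lambda>u. cube u L)"
    proof
      fix uv assume uv: "uv \<in> A"
      obtain u v where [simp]: "uv = (u, v)" by force
      have "u \<in> S" "v \<notin> S" "{u, v} \<in> E" using uv A(2) by auto
      moreover have "u \<in> cube 0 n" using n0[of u v] uv cube_mono[OF n, of 0] by auto
      ultimately show "uv \<in> Sigma (boundary E ?T) (\<lambda>u. cube u L)"
        using edges[of u v] by (auto simp: boundary_def)
    qed
    have fin: "finite (boundary E ?T)"
      by (rule finite_subset[OF _ finite_cube[of 0 n]]) (auto simp: boundary_def)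
    have "(\<Sum>(u, v)\<in>A. tau_in E p ?T 0 u * p) \<le> (\<Sum>(u, v)\<in>Sigma (boundary E ?T) (\<lambda>u. cube u L). tau_in E p ?T 0 u * p)"
      using sub fin nonneg p by (intro sum_mono2) auto
    also have "\<dots> \<le> (\<Sum>(u, v)\<in>Sigma (boundary E ?T) (\<lambda>u. cube u L). tau_in E p ?T 0 u)"
      using nonneg p by (intro sum_mono) (auto intro: mult_left_le)
    also have "\<dots> = (\<Sum>u\<in>boundary E ?T. \<Sum>v\<in>cube u L. tau_in E p ?T 0 u)"
      using fin by (intro sum.Sigma[symmetric]) auto
    also have "\<dots> = ?D * (\<Sum>u\<in>boundary E ?T. tau_in E p ?T 0 u)"
      by (simp add: card_cube sum_distrib_left)
    also have "\<dots> \<le> ?D * C" by (intro mult_left_mono C) auto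
    finally show ?thesis .
  qed
  have "(\<lambda>n. \<Sum>(u, v)\<in>A. tau_in E p (S \<inter> cube 0 n) 0 u * p) \<longlonglongrightarrow> (\<Sum>(u, v)\<in>A. tau_in E p S 0 u * p)"
    unfolding case_prod_beta by (intro tendsto_sum tendsto_mult_right tau_in_cube_tendsto(1))
  then have "(\<Sum>(u, v)\<in>A. tau_in E p S 0 u * p) \<le> ?D * C"
    using le by (intro LIMSEQ_le_const2) auto
  moreover have "(\<Sum>(u, v)\<in>A. ennreal (tau_in E p S 0 u * p)) = ennreal (\<Sum>(u, v)\<in>A. tau_in E p S 0 u * p)"
    unfolding case_prod_beta using nonneg p by (intro sum_ennreal) auto
  ultimately show "(\<Sum>(u, v)\<in>A. ennreal (tau_in E p S 0 u * p)) \<le> ennreal (?D * C)"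
    by (simp add: ennreal_leI)
qed

lemma bprob_0: "finite F \<Longrightarrow> bprob 0 F A = of_bool (A {})"
  by (induction F arbitrary: A rule: finite_induct) (auto simp: bprob_def bexp_insert)

lemma bprob_1: "finite F \<Longrightarrow> bprob 1 F A = of_bool (A F)"
  by (induction F arbitrary: A rule: finite_induct) (auto simp: bprob_def bexp_insert)

text \<open>
  Both degenerate cases contradict the two-point bounds: no vertex is connected to another
  one if all edges are closed, and all vertices are connected if all edges are open.
\<close>

lemma parameter_nondegenerate:
  fixes E :: "(int ^ 'd) set set" and a b :: real
  assumes "nearest_neighbour_edges \<subseteq> E" "6 < CARD('d)" "0 < a" "0 < b"
    and lower: "\<And>x y. a / sz (x - y) ^ (CARD('d) - 2) \<le> tau E p x y"
    and upper: "\<And>x y. tau E p x y \<le> b / sz (x - y) ^ (CARD('d) - 2)"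
  shows "0 < pmf (bernoulli_pmf p) True" "pmf (bernoulli_pmf p) True < 1"
proof -
  let ?q = "pmf (bernoulli_pmf p) True" and ?F = "\<lambda>N. {e \<in> E. e \<subseteq> cube 0 N}"
  have fF: "finite (?F N)" for N by (rule finite_subset[of _ "Pow (cube 0 N)"]) auto
  have t: "tau_in E p (UNIV \<inter> cube 0 N) x y = bprob ?q (?F N) (\<lambda>\<omega>. conn \<omega> (cube 0 N) x y)" for N x y
    using tau_in_eq_bprob[OF fF[of N], of E "cube 0 N" p x y] by auto
  show "0 < ?q"
  proof (rule ccontr)
    assume "\<not> 0 < ?q"
    then have q: "?q = 0" using pmf_nonneg[of "bernoulli_pmf p" True] by linarith
    define y :: "int ^ 'd" where "y = (\<chi> i. 1)"
    have "y \<noteq> 0" by (simp add: y_def vec_eq_iff)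
    have "\<not> conn {} T 0 y" for T
    proof
      assume "conn {} T 0 y"
      then have "y \<in> {0}" by (rule conn_closed) auto
      then show False using \<open>y \<noteq> 0\<close> by simp
    qed
    then have "tau_in E p (UNIV \<inter> cube 0 N) 0 y = 0" for N
      unfolding t q bprob_0[OF fF] by simp
    then have "(\<lambda>N. 0) \<longlonglongrightarrow> tau E p 0 y"
      using tau_in_cube_tendsto(1)[of E p UNIV 0 y] by simp
    then have "tau E p 0 y = 0" by (simp add: LIMSEQ_const_iff)
    moreover have "0 < a / sz (0 - y) ^ (CARD('d) - 2)" using assms(3) sz_pos[of "0 - y"] by simp
    ultimately show False using lower[of 0 y] by linarith
  qed
  show "?q < 1"
  proof (rule ccontr)
    assume "\<not> ?q < 1"
    then have q: "?q = 1" using pmf_le_1[of "bernoulli_pmf p" True] by linarith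
    \<comment> \<open>At distance \<open>m\<close> above \<open>b\<close> the upper bound falls
      below one, although with all edges open the connection is certain.\<close>
    obtain m :: nat where m: "b < real m" using reals_Archimedean2 by blast
    define y :: "int ^ 'd" where "y = (\<chi> i. int m)"
    have m0: "1 \<le> m" using m assms(4) by (cases m) auto
    have y: "linf_norm y = int m"
      unfolding linf_norm_def y_def by simp
    have c: "conn (?F m) (cube 0 m) 0 y"
    proof -
      have "conn nearest_neighbour_edges (cube 0 m) 0 y"
        unfolding cube_eq_bx by (rule bx_connected) (auto simp: bx_def y_def)
      then have "conn (nearest_neighbour_edges \<inter> Pow (cube 0 m)) (cube 0 m) 0 y"
        by (subst conn_cong[of _ _ nearest_neighbour_edges]) auto
      then show ?thesis by (rule conn_mono) (use assms(1) in auto)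
    qed
    have "1 = tau_in E p (UNIV \<inter> cube 0 m) 0 y"
      unfolding t q bprob_1[OF fF] using c by simp
    also have "\<dots> \<le> tau E p 0 y" by (rule tau_in_cube_tendsto(2))
    also have "\<dots> \<le> b / sz (0 - y) ^ (CARD('d) - 2)" by (rule upper)
    also have "sz (0 - y) = real m"
      using y m0 by (simp add: sz_def linf_norm_minus)
    also have "b / real m ^ (CARD('d) - 2) \<le> b / real m"
      using assms(2,4) m0 by (intro divide_left_mono self_le_power mult_pos_pos zero_less_power) auto
    also have "\<dots> < 1" using m m0 by simp
    finally show False by simp
  qed
qed

theorem theorem1p4:
  fixes E :: "(int ^ 'd) set set"
  assumes "E = nearest_neighbour_edges \<or> (\<exists>L\<ge>1. E = spread_out_edges L)"
    and "CARD('d) > 6"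
    and "two_point_assumption E"
  shows "\<exists>C::real. C > 0 \<and>
    (\<forall>S :: (int ^ 'd) set. 0 \<in> S \<longrightarrow> phi E (p_crit E) S \<le> ennreal C)"
proof -
  define p where "p = p_crit E"
  obtain L where nn: "nearest_neighbour_edges \<subseteq> E"
    and L: "\<forall>e\<in>E. \<exists>u v. e = {u, v} \<and> v \<in> cube u L"
    using edges_of_model[OF assms(1)] by auto
  note E = nn bspec[OF L]
  have edges: "v \<in> cube u L" if uv: "{u, v} \<in> E" for u v
  proof -
    obtain u' v' where "{u, v} = {u', v'}" "v' \<in> cube u' L" using E(2)[OF uv] by auto
    then show ?thesis using cube_symD[of v' u' L] by (auto simp: doubleton_eq_iff)
  qed
  have sz_powr: "real_of_int (max 1 (linf_norm z)) powr (- (real CARD('d) - 2)) = 1 / sz z ^ (CARD('d) - 2)"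
    for z :: "int ^ 'd"
  proof -
    have "real CARD('d) - 2 = real (CARD('d) - 2)" using assms(2) by (simp add: of_nat_diff)
    then show ?thesis
      using sz_pos[of z] by (simp only: sz_def powr_minus_divide powr_realpow)
  qed
  obtain a b where ab: "0 < a" "a \<le> b"
    and bounds: "\<And>x y. a / sz (x - y) ^ (CARD('d) - 2) \<le> tau E p x y"
      "\<And>x y. tau E p x y \<le> b / sz (x - y) ^ (CARD('d) - 2)"
    using assms(3) unfolding two_point_assumption_def sz_powr p_def by auto
  have b: "0 < b" using ab by linarith
  \<comment> \<open>The two-point bounds thus place \<open>p_crit\<close> strictly between 0 and 1,
    where the truncation in \<open>bernoulli_pmf\<close> has no effect.\<close>
  note q = parameter_nondegenerate[OF E(1) assms(2) ab(1) b bounds]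
  have p: "0 \<le> p" "p \<le> 1" using q unfolding pmf_bernoulli_True_clip by linarith+
  obtain C where C: "0 < C" "\<And>S. finite S \<Longrightarrow> (\<Sum>u\<in>boundary E S. tau_in E p S 0 u) \<le> C"
    using finite_boundary_sum_bounded[OF E assms(2) q refl ab(1) b bounds] by blast
  have "phi E p S \<le> ennreal (real (card (cube (0 :: int ^ 'd) L)) * C)" for S :: "(int ^ 'd) set"
    by (rule phi_le_of_finite[OF edges p C(2)])
  moreover have "0 < real (card (cube (0 :: int ^ 'd) L)) * C"
    using C(1) by (simp add: card_cube)
  ultimately show ?thesis unfolding p_def by blast
qed

end
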